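(* Let $V$ be an operator space. Then $V$ has the Completely Metric Approximation Property (CMAP) if and only if $\mathcal{G}^\infty_{\mathrm{cb}}(B_V)$ has the CMAP.
   Context: All spaces are complex and complete; $X'$ is the dual of $X$, $B_X$ is the open unit ball of $X$. For an operator space $V$, $M_n(V)$ is the space of $n\times n$ matrices over $V$ with its given norm; $V'$ has the operator space structure $M_n(V')=\mathcal{CB}(V,M_n)$. An operator space $V$ has the CMAP if there is a net of finite rank complete contractions in $\mathcal{CB}(V,V)$ converging pointwise (in norm) to the identity of $V$. A map $f:B_V\to W$ is holomorphic if it is (complex) Fréchet differentiable at every point. $\mathcal{H}^\infty_{\mathrm{cb}}(B_V)$ is the space of holomorphic $f:B_V\to\mathbb C$ with $\|f\|_{\mathcal{H}^\infty_{\mathrm{cb}}}=\sup\{\|(f(x_{ij}))\|_{M_m} : m\in\mathbb N,\ (x_{ij})\in B_{M_m(V)}\}<\infty$; it is an operator space with matrix norms $\|(f_{k\ell})\|_{M_n(\mathcal{H}^\infty_{\mathrm{cb}}(B_V))}=\sup\{\|(f_{k\ell}(x_{ij}))\|_{M_{mn}} : m\in\mathbb N,\ (x_{ij})\in B_{M_m(V)}\}$. For $x\in B_V$, $\delta_V(x)\in\mathcal{H}^\infty_{\mathrm{cb}}(B_V)'$ is the evaluation functional $f\mapsto f(x)$, and $\mathcal{G}^\infty_{\mathrm{cb}}(B_V)=\overline{\operatorname{span}}\{\delta_V(x):x\in B_V\}\subseteq\mathcal{H}^\infty_{\mathrm{cb}}(B_V)'$ with the inherited operator space structure. *)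

theory Defs
  imports Complex_Main "HOL-Library.Function_Algebras" "Jordan_Normal_Form.Matrix"
begin

text \<open>
  A complex vector space with matrix norms lives on a complex subspace (the carrier) of an ambient
  complex vector space. The scalar multiplication is part of the structure; the addition is that of
  the ambient type. The function \<open>mnorm\<close> assigns to a square matrix over the carrier its norm; the
  size is read off from the matrix.
\<close>

record 'a matrix_normed = "'a partial_object" +
  cscale :: "complex \<Rightarrow> 'a \<Rightarrow> 'a"
  mnorm :: "'a mat \<Rightarrow> real"

definition op_norm :: "complex mat \<Rightarrow> real" where
  "op_norm A = Sup {sqrt (\<Sum>i<dim_row A. (cmod ((A *\<^sub>v v) $ i))\<^sup>2) | v.
     v \<in> carrier_vec (dim_col A) \<and> (\<Sum>j<dim_col A. (cmod (v $ j))\<^sup>2) \<le> 1}"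

definition Mat_over :: "nat \<Rightarrow> ('a, 'b) matrix_normed_scheme \<Rightarrow> 'a mat set" where
  "Mat_over n V = {X \<in> carrier_mat n n. \<forall>i<n. \<forall>j<n. X $$ (i, j) \<in> carrier V}"

definition vnorm :: "('a, 'b) matrix_normed_scheme \<Rightarrow> 'a \<Rightarrow> real" where
  "vnorm V x = mnorm V (mat 1 1 (\<lambda>_. x))"

definition two_sided_mult ::
  "('a::ab_group_add, 'b) matrix_normed_scheme \<Rightarrow> complex mat \<Rightarrow> 'a mat \<Rightarrow> complex mat \<Rightarrow> 'a mat" where
  "two_sided_mult V \<alpha> X \<beta> = mat (dim_row \<alpha>) (dim_col \<beta>)
     (\<lambda>(i, j). \<Sum>k<dim_row X. \<Sum>l<dim_col X. cscale V (\<alpha> $$ (i, k) * \<beta> $$ (l, j)) (X $$ (k, l)))"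

text \<open>
  Abstract operator spaces in the sense of Effros and Ruan: norms on all spaces of square matrices
  (of positive size) subject to Ruan's two axioms. Completeness of the first matrix level entails
  completeness of all levels.
\<close>

definition operator_space :: "('a::ab_group_add, 'b) matrix_normed_scheme \<Rightarrow> bool" where
  "operator_space V \<longleftrightarrow>
     vector_space (cscale V) \<and> Modules.module.subspace (cscale V) (carrier V) \<and>
     (\<forall>n>0. \<forall>X \<in> Mat_over n V. mnorm V X \<ge> 0 \<and> (mnorm V X = 0 \<longleftrightarrow> X = 0\<^sub>m n n)) \<and>
     (\<forall>n>0. \<forall>X \<in> Mat_over n V. \<forall>c. mnorm V (map_mat (cscale V c) X) = cmod c * mnorm V X) \<and>
     (\<forall>n>0. \<forall>X \<in> Mat_over n V. \<forall>Y \<in> Mat_over n V. mnorm V (X + Y) \<le> mnorm V X + mnorm V Y) \<and>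
     (\<forall>n>0. \<forall>m>0. \<forall>X \<in> Mat_over n V. \<forall>Y \<in> Mat_over m V.
        mnorm V (four_block_mat X (0\<^sub>m n m) (0\<^sub>m m n) Y) = max (mnorm V X) (mnorm V Y)) \<and>
     (\<forall>n>0. \<forall>m>0. \<forall>X \<in> Mat_over n V. \<forall>\<alpha> \<in> carrier_mat m n. \<forall>\<beta> \<in> carrier_mat n m.
        mnorm V (two_sided_mult V \<alpha> X \<beta>) \<le> op_norm \<alpha> * mnorm V X * op_norm \<beta>) \<and>
     (\<forall>s :: nat \<Rightarrow> 'a. (\<forall>k. s k \<in> carrier V) \<longrightarrow>
        (\<forall>e>0. \<exists>N. \<forall>k\<ge>N. \<forall>l\<ge>N. vnorm V (s k - s l) < e) \<longrightarrow>
        (\<exists>x \<in> carrier V. (\<lambda>k. vnorm V (s k - x)) \<longlonglongrightarrow> 0))"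

definition linear_between ::
  "('a::ab_group_add, 'c) matrix_normed_scheme \<Rightarrow> ('b::ab_group_add, 'd) matrix_normed_scheme
     \<Rightarrow> ('a \<Rightarrow> 'b) \<Rightarrow> bool" where
  "linear_between V W T \<longleftrightarrow>
     (\<forall>x \<in> carrier V. T x \<in> carrier W) \<and>
     (\<forall>x \<in> carrier V. \<forall>y \<in> carrier V. T (x + y) = T x + T y) \<and>
     (\<forall>c. \<forall>x \<in> carrier V. T (cscale V c x) = cscale W c (T x))"

definition complete_contraction ::
  "('a::ab_group_add, 'c) matrix_normed_scheme \<Rightarrow> ('b::ab_group_add, 'd) matrix_normed_scheme
     \<Rightarrow> ('a \<Rightarrow> 'b) \<Rightarrow> bool" where
  "complete_contraction V W T \<longleftrightarrow> linear_between V W T \<and>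
     (\<forall>n>0. \<forall>X \<in> Mat_over n V. mnorm W (map_mat T X) \<le> mnorm V X)"

definition finite_rank ::
  "('a, 'c) matrix_normed_scheme \<Rightarrow> ('b::ab_group_add, 'd) matrix_normed_scheme
     \<Rightarrow> ('a \<Rightarrow> 'b) \<Rightarrow> bool" where
  "finite_rank V W T \<longleftrightarrow>
     (\<exists>B. finite B \<and> B \<subseteq> carrier W \<and> T ` carrier V \<subseteq> Modules.module.span (cscale W) B)"

text \<open>
  A net of maps is given by the filter it generates on the space of maps; a net has a nonempty
  directed index set, so this filter is proper.
\<close>

definition has_CMAP :: "('a::ab_group_add, 'b) matrix_normed_scheme \<Rightarrow> bool" where
  "has_CMAP V \<longleftrightarrow> (\<exists>F :: ('a \<Rightarrow> 'a) filter. F \<noteq> bot \<and>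
     (\<forall>\<^sub>F T in F. finite_rank V V T \<and> complete_contraction V V T) \<and>
     (\<forall>x \<in> carrier V. ((\<lambda>T. vnorm V (T x - x)) \<longlongrightarrow> 0) F))"

definition complex_os :: "complex matrix_normed" where
  "complex_os = \<lparr>carrier = UNIV, cscale = (*), mnorm = op_norm\<rparr>"

text \<open>
  For an \<open>n\<close> by \<open>n\<close> matrix of functions \<open>f\<^bsub>kl\<^esub>\<close> and an \<open>m\<close> by \<open>m\<close> matrix of points \<open>x\<^bsub>ij\<^esub>\<close>, the
  \<open>mn\<close> by \<open>mn\<close> matrix whose block at position \<open>(k, l)\<close> is the matrix of the \<open>f\<^bsub>kl\<^esub> (x\<^bsub>ij\<^esub>)\<close>.
\<close>

definition mat_apply :: "('a \<Rightarrow> complex) mat \<Rightarrow> 'a mat \<Rightarrow> complex mat" where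
  "mat_apply F X = mat (dim_row F * dim_row X) (dim_col F * dim_col X)
     (\<lambda>(r, s). (F $$ (r div dim_row X, s div dim_col X)) (X $$ (r mod dim_row X, s mod dim_col X)))"

text \<open>
  Functions defined on a subset of the ambient type (functionals on the carrier, functions on the
  unit ball) are represented by their extension by zero, so that they form a vector space under
  pointwise operations.
\<close>

definition dual_os :: "('a::ab_group_add, 'b) matrix_normed_scheme \<Rightarrow> ('a \<Rightarrow> complex) matrix_normed" where
  "dual_os V = \<lparr>
     carrier = {\<phi>. linear_between V complex_os \<phi> \<and>
                  (\<exists>K. \<forall>x \<in> carrier V. cmod (\<phi> x) \<le> K * vnorm V x) \<and>
                  (\<forall>x. x \<notin> carrier V \<longrightarrow> \<phi> x = 0)},
     cscale = (\<lambda>c \<phi> x. c * \<phi> x),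
     mnorm = (\<lambda>\<Phi>. SUP X \<in> (\<Union>m\<in>{0<..}. {X \<in> Mat_over m V. mnorm V X \<le> 1}).
                op_norm (mat_apply \<Phi> X))\<rparr>"

definition unit_ball :: "('a, 'b) matrix_normed_scheme \<Rightarrow> 'a set" where
  "unit_ball V = {x \<in> carrier V. vnorm V x < 1}"

definition matrix_unit_ball :: "('a, 'b) matrix_normed_scheme \<Rightarrow> 'a mat set" where
  "matrix_unit_ball V = (\<Union>m\<in>{0<..}. {X \<in> Mat_over m V. mnorm V X < 1})"

definition frechet_differentiable_at ::
  "('a::ab_group_add, 'b) matrix_normed_scheme \<Rightarrow> ('a \<Rightarrow> complex) \<Rightarrow> 'a \<Rightarrow> bool" where
  "frechet_differentiable_at V f x \<longleftrightarrow> (\<exists>L \<in> carrier (dual_os V).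
     \<forall>e>0. \<exists>d>0. \<forall>h \<in> carrier V. vnorm V h < d \<longrightarrow>
       cmod (f (x + h) - f x - L h) \<le> e * vnorm V h)"

definition Hinf_cb :: "('a::ab_group_add, 'b) matrix_normed_scheme \<Rightarrow> ('a \<Rightarrow> complex) matrix_normed" where
  "Hinf_cb V = \<lparr>
     carrier = {f. (\<forall>x \<in> unit_ball V. frechet_differentiable_at V f x) \<and>
                  bdd_above ((\<lambda>X. op_norm (map_mat f X)) ` matrix_unit_ball V) \<and>
                  (\<forall>x. x \<notin> unit_ball V \<longrightarrow> f x = 0)},
     cscale = (\<lambda>c f x. c * f x),
     mnorm = (\<lambda>F. SUP X \<in> matrix_unit_ball V. op_norm (mat_apply F X))\<rparr>"

definition eval_at ::
  "('a::ab_group_add, 'b) matrix_normed_scheme \<Rightarrow> 'a \<Rightarrow> (('a \<Rightarrow> complex) \<Rightarrow> complex)" where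
  "eval_at V x = (\<lambda>f. if f \<in> carrier (Hinf_cb V) then f x else 0)"

definition Ginf_cb ::
  "('a::ab_group_add, 'b) matrix_normed_scheme \<Rightarrow> (('a \<Rightarrow> complex) \<Rightarrow> complex) matrix_normed" where
  "Ginf_cb V = (let D = dual_os (Hinf_cb V) in D\<lparr>
     carrier := {\<phi> \<in> carrier D. \<forall>e>0.
       \<exists>\<psi> \<in> Modules.module.span (cscale D) (eval_at V ` unit_ball V). vnorm D (\<phi> - \<psi>) < e}\<rparr>)"

end

theory Submission
  imports "HOL-Complex_Analysis.Complex_Analysis" Defs
begin

text \<open>
  If G has the approximation property, so does V: the derivative at 0 of the evaluation map embeds V
  into G, and the linearisation of the inclusion of the ball is a left inverse. Both maps are
  complete contractions, the second because the norm of a matrix over V is determined by complete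
  contractions of V into matrix algebras (Effros and Ruan).

  Conversely, a finite rank complete contraction T of V is turned into one of G by precomposing
  functions with r T, truncating the Taylor expansion at degree k and dividing by
  1 + r^k / (1 - r), which by Cauchy's estimates restores complete contractivity. The result has
  finite rank because a homogeneous polynomial on the range of T is determined by its values on a
  finite grid; it converges to the identity along T, r and k since G is generated by evaluations.
\<close>

section \<open>Bounded forms and the operator norm\<close>

unbundle no vec_syntax and fps_syntax

text \<open>Matrix norms are handled through bilinear forms: a bound on a matrix of functions is a
  family of scalar inequalities, one for each pair of vectors, so Cauchy's estimates in one complex
  variable give complete bounds.

  Composition with T alone does not have finite rank on functions, even for T of finite rank, since
  there are infinitely many degrees. Hence the truncation; for r < 1 its tail is dominated by a
  geometric series, which is the origin of r^k / (1 - r).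

  Taylor coefficients are defined along lines, so two facts have to be earned: they are Frechet
  differentiable, and the coefficients of the evaluation map belong to the closed span of the
  evaluations.

  The norm formula for V is the deep point of the other direction. Ruan's axioms enter through a
  gauge on triples (matrix, form, form) rather than on matrices alone. A single Hahn-Banach
  functional on triples then yields both the functional on matrices and the two positive functionals
  that make it completely contractive.\<close>

abbreviation l2 :: "'i set \<Rightarrow> ('i \<Rightarrow> complex) \<Rightarrow> real" where
  "l2 I w \<equiv> L2_set (\<lambda>i. cmod (w i)) I"

lemma l2_scale: "l2 I (\<lambda>i. c * w i) = cmod c * l2 I w"
  by (simp add: norm_mult L2_set_right_distrib)

lemma l2_pos_iff: "finite I \<Longrightarrow> l2 I w > 0 \<longleftrightarrow> (\<exists>i\<in>I. w i \<noteq> 0)"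
  by (metis L2_set_eq_0_iff L2_set_nonneg less_eq_real_def norm_eq_zero order_less_irrefl)

lemma l2_sq: "(l2 I w)\<^sup>2 = (\<Sum>i\<in>I. (cmod (w i))\<^sup>2)"
  by (simp add: L2_set_def sum_nonneg)

lemma cmod_le_l2: "finite I \<Longrightarrow> i \<in> I \<Longrightarrow> cmod (w i) \<le> l2 I w"
  by (rule member_le_L2_set)

lemma Cauchy_Schwarz_l2: "cmod (\<Sum>i\<in>I. w i * v i) \<le> l2 I w * l2 I v"
proof -
  have "cmod (\<Sum>i\<in>I. w i * v i) \<le> (\<Sum>i\<in>I. \<bar>cmod (w i)\<bar> * \<bar>cmod (v i)\<bar>)"
    by (rule order_trans[OF norm_sum]) (simp add: norm_mult)
  also have "\<dots> \<le> l2 I w * l2 I v" by (rule L2_set_mult_ineq)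
  finally show ?thesis .
qed

text \<open>The vector \<open>cnj (v i)\<close> attains the norm: it gives norm squared at most
  \<open>C\<close> times norm. The zero vector is separated because that inequality is divided by
  the norm.\<close>

lemma l2_le_dual:
  assumes "0 \<le> C" "\<And>w. cmod (\<Sum>i\<in>I. w i * v i) \<le> C * l2 I w"
  shows "l2 I v \<le> C"
proof (cases "l2 I v = 0")
  case False
  have "cmod (\<Sum>i\<in>I. cnj (v i) * v i) \<le> C * l2 I (\<lambda>i. cnj (v i))" using assms(2) .
  also have "(\<Sum>i\<in>I. cnj (v i) * v i) = of_real ((l2 I v)\<^sup>2)"
    unfolding l2_sq of_real_sum complex_norm_square by (simp add: mult.commute)
  finally have "(l2 I v)\<^sup>2 \<le> C * l2 I v" by (simp del: of_real_power)
  moreover have "l2 I v > 0" using False L2_set_nonneg[of "\<lambda>i. cmod (v i)" I] by linarith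
  ultimately show ?thesis by (simp add: power2_eq_square)
qed (use assms in simp)

text \<open>A bound for the operator norm of the matrix \<open>A\<close> with rows in
  \<open>I\<close> and columns in \<open>J\<close>. The form is bilinear: since \<open>w\<close> is
  arbitrary, conjugating it changes nothing. Arbitrary index sets let block matrices be indexed by
  pairs. Nonnegativity of \<open>C\<close> is demanded separately because empty index sets make the
  inequality trivial.\<close>

definition form_bound :: "'i set \<Rightarrow> 'j set \<Rightarrow> ('i \<Rightarrow> 'j \<Rightarrow> complex) \<Rightarrow> real \<Rightarrow> bool" where
  "form_bound I J A C \<longleftrightarrow> 0 \<le> C \<and>
     (\<forall>w v. cmod (\<Sum>i\<in>I. \<Sum>j\<in>J. w i * A i j * v j) \<le> C * l2 I w * l2 J v)"

lemma form_boundI: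
  "0 \<le> C \<Longrightarrow> (\<And>w v. cmod (\<Sum>i\<in>I. \<Sum>j\<in>J. w i * A i j * v j) \<le> C * l2 I w * l2 J v)
   \<Longrightarrow> form_bound I J A C"
  by (simp add: form_bound_def)

lemma form_boundD:
  "form_bound I J A C \<Longrightarrow> cmod (\<Sum>i\<in>I. \<Sum>j\<in>J. w i * A i j * v j) \<le> C * l2 I w * l2 J v"
  by (simp add: form_bound_def)

lemma form_bound_nonneg: "form_bound I J A C \<Longrightarrow> 0 \<le> C"
  by (simp add: form_bound_def)

lemma form_bound_cong:
  assumes "\<And>i j. i \<in> I \<Longrightarrow> j \<in> J \<Longrightarrow> A i j = B i j"
  shows "form_bound I J A C \<longleftrightarrow> form_bound I J B C"
  unfolding form_bound_def using assms by (simp cong: sum.cong)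

lemma form_bound_mono: "form_bound I J A C \<Longrightarrow> C \<le> D \<Longrightarrow> form_bound I J A D"
  unfolding form_bound_def
  by (meson L2_set_nonneg mult_right_mono order_trans)

lemma form_bound_0 [simp]: "0 \<le> C \<Longrightarrow> form_bound I J (\<lambda>i j. 0) C"
  by (simp add: form_bound_def L2_set_nonneg)

lemma form_bound_add:
  assumes "form_bound I J A C" "form_bound I J B D"
  shows "form_bound I J (\<lambda>i j. A i j + B i j) (C + D)"
proof (rule form_boundI)
  show "0 \<le> C + D" using form_bound_nonneg[OF assms(1)] form_bound_nonneg[OF assms(2)] by simp
  fix w v
  have "(\<Sum>i\<in>I. \<Sum>j\<in>J. w i * (A i j + B i j) * v j) =
    (\<Sum>i\<in>I. \<Sum>j\<in>J. w i * A i j * v j) + (\<Sum>i\<in>I. \<Sum>j\<in>J. w i * B i j * v j)"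
    by (simp add: algebra_simps sum.distrib)
  moreover have "(C + D) * l2 I w * l2 J v = C * l2 I w * l2 J v + D * l2 I w * l2 J v"
    by (simp add: algebra_simps)
  ultimately show "cmod (\<Sum>i\<in>I. \<Sum>j\<in>J. w i * (A i j + B i j) * v j) \<le> (C + D) * l2 I w * l2 J v"
    using form_boundD[OF assms(1), of w v] form_boundD[OF assms(2), of w v]
      norm_triangle_mono[of "\<Sum>i\<in>I. \<Sum>j\<in>J. w i * A i j * v j" _
        "\<Sum>i\<in>I. \<Sum>j\<in>J. w i * B i j * v j"] by simp
qed

lemma form_bound_scale:
  assumes "form_bound I J A C"
  shows "form_bound I J (\<lambda>i j. c * A i j) (cmod c * C)"
proof (rule form_boundI)
  show "0 \<le> cmod c * C" using form_bound_nonneg[OF assms] by simp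
  fix w v
  have "(\<Sum>i\<in>I. \<Sum>j\<in>J. w i * (c * A i j) * v j) = c * (\<Sum>i\<in>I. \<Sum>j\<in>J. w i * A i j * v j)"
    by (simp add: algebra_simps sum_distrib_left)
  then have "cmod (\<Sum>i\<in>I. \<Sum>j\<in>J. w i * (c * A i j) * v j) =
    cmod c * cmod (\<Sum>i\<in>I. \<Sum>j\<in>J. w i * A i j * v j)" by (simp add: norm_mult)
  also have "\<dots> \<le> cmod c * (C * l2 I w * l2 J v)"
    by (intro mult_left_mono form_boundD[OF assms]) simp
  finally show "cmod (\<Sum>i\<in>I. \<Sum>j\<in>J. w i * (c * A i j) * v j) \<le> cmod c * C * l2 I w * l2 J v"
    by (simp add: mult.assoc)
qed

text \<open>Evaluate the form on the unit vectors at \<open>i\<close> and \<open>j\<close>.\<close>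

lemma form_bound_entry:
  assumes "form_bound I J A C" "finite I" "finite J" "i \<in> I" "j \<in> J"
  shows "cmod (A i j) \<le> C"
proof -
  let ?w = "\<lambda>k. if k = i then 1 else 0 :: complex" and ?v = "\<lambda>k. if k = j then 1 else 0 :: complex"
  have l: "l2 I ?w = 1" "l2 J ?v = 1"
  proof -
    have sq: "(cmod (if b then 1 else 0))\<^sup>2 = (if b then 1 else 0)" for b by simp
    show "l2 I ?w = 1" "l2 J ?v = 1" unfolding L2_set_def sq using assms by simp_all
  qed
  have "(\<Sum>k\<in>I. \<Sum>l\<in>J. ?w k * A k l * ?v l) = (\<Sum>k\<in>I. if k = i then (\<Sum>l\<in>J. if l = j then A k l else 0) else 0)"
  proof (intro sum.cong refl)
    fix k
    have "(\<Sum>l\<in>J. ?w k * A k l * ?v l) = (\<Sum>l\<in>J. ?w k * (if l = j then A k l else 0))"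
      by (intro sum.cong refl) simp
    then show "(\<Sum>l\<in>J. ?w k * A k l * ?v l) = (if k = i then (\<Sum>l\<in>J. if l = j then A k l else 0) else 0)"
      by (simp flip: sum_distrib_left)
  qed
  also have "\<dots> = A i j" using assms by simp
  finally show ?thesis using form_boundD[OF assms(1), of ?w ?v] l by simp
qed

text \<open>Far from sharp; it only supplies some finite bound for suprema and quadratic forms of
  finite matrices.\<close>

lemma form_bound_crude:
  assumes "finite I" "finite J"
  shows "form_bound I J A (\<Sum>i\<in>I. \<Sum>j\<in>J. cmod (A i j))"
proof (rule form_boundI)
  show "0 \<le> (\<Sum>i\<in>I. \<Sum>j\<in>J. cmod (A i j))" by (intro sum_nonneg) auto
  fix w v
  have "cmod (\<Sum>i\<in>I. \<Sum>j\<in>J. w i * A i j * v j) \<le> (\<Sum>i\<in>I. \<Sum>j\<in>J. cmod (w i * A i j * v j))"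
    by (rule order_trans[OF norm_sum], rule sum_mono, rule norm_sum)
  also have "\<dots> \<le> (\<Sum>i\<in>I. \<Sum>j\<in>J. cmod (A i j) * l2 I w * l2 J v)"
  proof (intro sum_mono)
    fix i j assume ij: "i \<in> I" "j \<in> J"
    have "cmod (w i) * cmod (v j) \<le> l2 I w * l2 J v"
      using assms ij by (intro mult_mono cmod_le_l2) (auto simp: L2_set_nonneg)
    then have "cmod (A i j) * (cmod (w i) * cmod (v j)) \<le> cmod (A i j) * (l2 I w * l2 J v)"
      by (intro mult_left_mono) auto
    then show "cmod (w i * A i j * v j) \<le> cmod (A i j) * l2 I w * l2 J v"
      by (simp add: norm_mult mult_ac)
  qed
  also have "\<dots> = (\<Sum>i\<in>I. \<Sum>j\<in>J. cmod (A i j)) * l2 I w * l2 J v"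
    by (simp add: sum_distrib_right)
  finally show "cmod (\<Sum>i\<in>I. \<Sum>j\<in>J. w i * A i j * v j) \<le> (\<Sum>i\<in>I. \<Sum>j\<in>J. cmod (A i j)) * l2 I w * l2 J v" .
qed

lemma form_bound_reindex_aux:
  assumes h: "bij_betw h I I'" and g: "bij_betw g J J'" and fb: "form_bound I' J' A C"
  shows "form_bound I J (\<lambda>i j. A (h i) (g j)) C"
proof (rule form_boundI)
  show "0 \<le> C" using fb form_bound_nonneg by blast
  fix w v :: "_ \<Rightarrow> complex"
  let ?w = "\<lambda>k. w (inv_into I h k)" and ?v = "\<lambda>k. v (inv_into J g k)"
  have eq: "?w (h i) = w i" if "i \<in> I" for i
    using h that by (simp add: bij_betw_inv_into_left)
  have eq': "?v (g j) = v j" if "j \<in> J" for j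
    using g that by (simp add: bij_betw_inv_into_left)
  have "(\<Sum>i\<in>I'. \<Sum>j\<in>J'. ?w i * A i j * ?v j) = (\<Sum>i\<in>I. \<Sum>j\<in>J. w i * A (h i) (g j) * v j)"
    using eq eq'
    by (simp add: sum.reindex_bij_betw[OF h, symmetric] sum.reindex_bij_betw[OF g, symmetric] cong: sum.cong)
  moreover have "l2 I' ?w = l2 I w"
    unfolding L2_set_def using eq by (simp add: sum.reindex_bij_betw[OF h, symmetric] cong: sum.cong)
  moreover have "l2 J' ?v = l2 J v"
    unfolding L2_set_def using eq' by (simp add: sum.reindex_bij_betw[OF g, symmetric] cong: sum.cong)
  ultimately show "cmod (\<Sum>i\<in>I. \<Sum>j\<in>J. w i * A (h i) (g j) * v j) \<le> C * l2 I w * l2 J v"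
    using form_boundD[OF fb, of ?w ?v] by simp
qed

lemma form_bound_reindex:
  assumes h: "bij_betw h I I'" and g: "bij_betw g J J'"
  shows "form_bound I J (\<lambda>i j. A (h i) (g j)) C \<longleftrightarrow> form_bound I' J' A C"
proof
  assume "form_bound I J (\<lambda>i j. A (h i) (g j)) C"
  from form_bound_reindex_aux[OF bij_betw_inv_into[OF h] bij_betw_inv_into[OF g] this]
  have "form_bound I' J' (\<lambda>i j. A (h (inv_into I h i)) (g (inv_into J g j))) C" .
  then show "form_bound I' J' A C"
    using h g by (subst (asm) form_bound_cong[where B = A]) (auto simp: bij_betw_inv_into_right)
qed (rule form_bound_reindex_aux[OF assms])

text \<open>\<open>l2_le_dual\<close> turns the norm of \<open>A v\<close> into a form in two
  vectors, and scaling removes the restriction to vectors of norm at most 1. Later arguments about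
  \<open>op_norm\<close> go through this equivalence.\<close>

lemma op_norm_le_iff:
  assumes A: "A \<in> carrier_mat m n"
  shows "op_norm A \<le> C \<longleftrightarrow> form_bound {..<m} {..<n} (\<lambda>i j. A $$ (i, j)) C"
proof -
  let ?a = "\<lambda>i j. A $$ (i, j)"
  define S where "S = {sqrt (\<Sum>i<dim_row A. (cmod ((A *\<^sub>v v) $ i))\<^sup>2) | v.
     v \<in> carrier_vec (dim_col A) \<and> (\<Sum>j<dim_col A. (cmod (v $ j))\<^sup>2) \<le> 1}"
  have dims: "dim_row A = m" "dim_col A = n" using A by auto
  have mv: "(A *\<^sub>v v) $ i = (\<Sum>j<n. ?a i j * v $ j)" if "v \<in> carrier_vec n" "i < m" for v i
    using A that by (auto simp: scalar_prod_def atLeast0LessThan intro!: sum.cong)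
  have S: "S = {l2 {..<m} (\<lambda>i. \<Sum>j<n. ?a i j * v j) | v. l2 {..<n} v \<le> 1}"
  proof (intro equalityI subsetI)
    fix x assume "x \<in> S"
    then obtain v :: "complex Matrix.vec" where v: "v \<in> carrier_vec n" "(\<Sum>j<n. (cmod (v $ j))\<^sup>2) \<le> 1"
      "x = sqrt (\<Sum>i<m. (cmod ((A *\<^sub>v v) $ i))\<^sup>2)" unfolding S_def dims by blast
    have "x = l2 {..<m} (\<lambda>i. \<Sum>j<n. ?a i j * v $ j)"
      unfolding v(3) L2_set_def using mv[OF v(1)] by (auto intro!: arg_cong[where f = sqrt] sum.cong)
    moreover have "l2 {..<n} (\<lambda>j. v $ j) \<le> 1" using v(2) by (simp add: L2_set_def)
    ultimately show "x \<in> {l2 {..<m} (\<lambda>i. \<Sum>j<n. ?a i j * v j) | v. l2 {..<n} v \<le> 1}" by blast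
  next
    fix x assume "x \<in> {l2 {..<m} (\<lambda>i. \<Sum>j<n. ?a i j * v j) | v. l2 {..<n} v \<le> 1}"
    then obtain v where v: "x = l2 {..<m} (\<lambda>i. \<Sum>j<n. ?a i j * v j)" "l2 {..<n} v \<le> 1" by blast
    have vc: "vec n v \<in> carrier_vec n" by simp
    have "x = sqrt (\<Sum>i<m. (cmod ((A *\<^sub>v vec n v) $ i))\<^sup>2)"
      unfolding v(1) L2_set_def using mv[OF vc] by (auto intro!: arg_cong[where f = sqrt] sum.cong)
    moreover have "(\<Sum>j<n. (cmod (vec n v $ j))\<^sup>2) \<le> 1"
      using v(2) by (simp add: L2_set_def)
    ultimately show "x \<in> S" unfolding S_def dims using vc by blast
  qed
  have bil: "(\<Sum>i<m. \<Sum>j<n. w i * ?a i j * v j) = (\<Sum>i<m. w i * (\<Sum>j<n. ?a i j * v j))" for w v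
    by (simp add: sum_distrib_left mult.assoc)
  have ne: "l2 {..<m} (\<lambda>i. \<Sum>j<n. ?a i j * 0) \<in> S" unfolding S by (auto intro!: exI[of _ "\<lambda>_. 0"] simp: L2_set_def)
  have bdd: "form_bound {..<m} {..<n} ?a K \<Longrightarrow> x \<in> S \<Longrightarrow> x \<le> K" for x K
  proof -
    assume fb: "form_bound {..<m} {..<n} ?a K" and "x \<in> S"
    then obtain v where v: "x = l2 {..<m} (\<lambda>i. \<Sum>j<n. ?a i j * v j)" "l2 {..<n} v \<le> 1"
      unfolding S by blast
    have K: "0 \<le> K" using fb form_bound_nonneg by blast
    show "x \<le> K" unfolding v(1)
    proof (rule l2_le_dual[OF K])
      fix w
      have "cmod (\<Sum>i<m. w i * (\<Sum>j<n. ?a i j * v j)) \<le> K * l2 {..<m} w * l2 {..<n} v"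
        using form_boundD[OF fb, of w v] unfolding bil .
      also have "\<dots> \<le> K * l2 {..<m} w * 1"
        using v(2) K by (intro mult_left_mono) (auto simp: L2_set_nonneg)
      finally show "cmod (\<Sum>i<m. w i * (\<Sum>j<n. ?a i j * v j)) \<le> K * l2 {..<m} w" by simp
    qed
  qed
  \<comment> \<open>\<open>Sup\<close> on the reals is meaningful only for a bounded set; the crude
    bound provides this.\<close>
  have bddS: "bdd_above S"
    by (rule bdd_aboveI, rule bdd[OF form_bound_crude]) auto
  have op: "op_norm A = Sup S" unfolding op_norm_def S_def ..
  show ?thesis
  proof
    assume le: "op_norm A \<le> C"
    have SC: "x \<le> C" if "x \<in> S" for x using cSup_upper[OF that bddS] le op by simp
    have C0: "0 \<le> C" using SC[OF ne] L2_set_nonneg by (meson order_trans)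
    show "form_bound {..<m} {..<n} ?a C"
    proof (rule form_boundI[OF C0])
      fix w v
      let ?l = "l2 {..<n} v"
      show "cmod (\<Sum>i<m. \<Sum>j<n. w i * ?a i j * v j) \<le> C * l2 {..<m} w * ?l"
      proof (cases "?l = 0")
        case True
        then have "v j = 0" if "j < n" for j using that by (subst (asm) L2_set_eq_0_iff) auto
        then show ?thesis using True by simp
      next
        case False
        then have pos: "?l > 0" using L2_set_nonneg[of "\<lambda>i. cmod (v i)" "{..<n}"] by linarith
        define u where "u = (\<lambda>j. inverse (of_real ?l) * v j)"
        have "l2 {..<n} u = 1" unfolding u_def l2_scale using pos by (simp add: norm_inverse)
        then have "l2 {..<m} (\<lambda>i. \<Sum>j<n. ?a i j * u j) \<le> C"
          by (intro SC) (unfold S, auto intro!: exI[of _ u])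
        moreover have "l2 {..<m} (\<lambda>i. \<Sum>j<n. ?a i j * v j) = l2 {..<m} (\<lambda>i. of_real ?l * (\<Sum>j<n. ?a i j * u j))"
          using pos unfolding u_def by (intro arg_cong[where f = "\<lambda>f. l2 {..<m} f"])
            (auto simp: sum_distrib_left field_simps)
        ultimately have "l2 {..<m} (\<lambda>i. \<Sum>j<n. ?a i j * v j) \<le> ?l * C"
          using pos by (simp add: l2_scale mult_left_mono)
        then have "l2 {..<m} w * l2 {..<m} (\<lambda>i. \<Sum>j<n. ?a i j * v j) \<le> l2 {..<m} w * (?l * C)"
          by (intro mult_left_mono) (auto simp: L2_set_nonneg)
        then show ?thesis
          unfolding bil using Cauchy_Schwarz_l2[of w "\<lambda>i. \<Sum>j<n. ?a i j * v j" "{..<m}"] by (simp add: mult_ac)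
      qed
    qed
  next
    assume fb: "form_bound {..<m} {..<n} ?a C"
    show "op_norm A \<le> C" unfolding op using ne bdd[OF fb] by (intro cSup_least) auto
  qed
qed

lemma form_bound_op_norm: "A \<in> carrier_mat m n \<Longrightarrow> form_bound {..<m} {..<n} (\<lambda>i j. A $$ (i, j)) (op_norm A)"
  by (simp flip: op_norm_le_iff)

lemma op_norm_nonneg: "0 \<le> op_norm A"
  using form_bound_op_norm[of A "dim_row A" "dim_col A"] form_bound_nonneg by auto

text \<open>\<open>mat_apply\<close> places index \<open>r\<close> in block \<open>r div p\<close>
  at position \<open>r mod p\<close>; this bijection relates that flattened numbering to
  pairs.\<close>

lemma bij_betw_block:
  "bij_betw (\<lambda>(k, i). k * p + i) ({..<n} \<times> {..<p}) {..<n * p :: nat}"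
proof (rule bij_betw_byWitness[where f' = "\<lambda>r. (r div p, r mod p)"])
  show "(\<lambda>(k, i). k * p + i) ` ({..<n} \<times> {..<p}) \<subseteq> {..<n * p}"
  proof clarsimp
    fix k i assume "k < n" "i < p"
    then have "k * p + i < Suc k * p" "Suc k * p \<le> n * p" by (simp, intro mult_le_mono1, simp)
    then show "k * p + i < n * p" by linarith
  qed
  show "(\<lambda>r. (r div p, r mod p)) ` {..<n * p} \<subseteq> {..<n} \<times> {..<p}"
    by (cases "p = 0") (auto simp: less_mult_imp_div_less)
qed auto

lemma op_norm_mat_apply_le_iff:
  assumes "F \<in> carrier_mat n n" "X \<in> carrier_mat p p"
  shows "op_norm (mat_apply F X) \<le> C \<longleftrightarrow>
    form_bound ({..<n} \<times> {..<p}) ({..<n} \<times> {..<p}) (\<lambda>(k, i) (l, j). (F $$ (k, l)) (X $$ (i, j))) C"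
proof -
  have c: "mat_apply F X \<in> carrier_mat (n * p) (n * p)"
    using assms by (simp add: mat_apply_def)
  note b = bij_betw_block[of p n]
  have "op_norm (mat_apply F X) \<le> C \<longleftrightarrow> form_bound ({..<n} \<times> {..<p}) ({..<n} \<times> {..<p})
    (\<lambda>a b. mat_apply F X $$ ((case a of (k, i) \<Rightarrow> k * p + i), (case b of (k, i) \<Rightarrow> k * p + i))) C"
    unfolding op_norm_le_iff[OF c] by (rule form_bound_reindex[OF b b, symmetric])
  also have "\<dots> \<longleftrightarrow> form_bound ({..<n} \<times> {..<p}) ({..<n} \<times> {..<p}) (\<lambda>(k, i) (l, j). (F $$ (k, l)) (X $$ (i, j))) C"
  proof (rule form_bound_cong)
    fix a b assume ab: "a \<in> {..<n} \<times> {..<p}" "b \<in> {..<n} \<times> {..<p}"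
    obtain k i l j where [simp]: "a = (k, i)" "b = (l, j)" by fastforce
    have lt: "k * p + i < n * p" "l * p + j < n * p"
      using bij_betwE[OF b] ab by auto
    show "mat_apply F X $$ ((case a of (k, i) \<Rightarrow> k * p + i), (case b of (k, i) \<Rightarrow> k * p + i)) =
      (case a of (k, i) \<Rightarrow> \<lambda>(l, j). (F $$ (k, l)) (X $$ (i, j))) b"
      using assms lt ab by (simp add: mat_apply_def)
  qed
  finally show ?thesis .
qed

lemma mat_apply_single:
  "mat_apply (mat 1 1 (\<lambda>_. f)) X = map_mat f X"
  by (rule eq_matI) (auto simp: mat_apply_def)

lemma op_norm_map_mat_le_iff:
  assumes "X \<in> carrier_mat p p"
  shows "op_norm (map_mat f X) \<le> C \<longleftrightarrow> form_bound {..<p} {..<p} (\<lambda>i j. f (X $$ (i, j))) C"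
proof -
  have "map_mat f X \<in> carrier_mat p p" using assms by auto
  then have "op_norm (map_mat f X) \<le> C \<longleftrightarrow> form_bound {..<p} {..<p} (\<lambda>i j. map_mat f X $$ (i, j)) C"
    by (rule op_norm_le_iff)
  also have "\<dots> \<longleftrightarrow> form_bound {..<p} {..<p} (\<lambda>i j. f (X $$ (i, j))) C"
    using assms by (intro form_bound_cong) auto
  finally show ?thesis .
qed

lemma l2_slice:
  assumes "finite K" "finite L" "k \<in> K"
  shows "l2 L (\<lambda>i. u (k, i)) \<le> l2 (K \<times> L) u"
proof -
  have "(\<Sum>i\<in>L. (cmod (u (k, i)))\<^sup>2) = (\<Sum>x\<in>{k} \<times> L. (cmod (u x))\<^sup>2)"
    by (simp add: sum.cartesian_product')
  also have "\<dots> \<le> (\<Sum>x\<in>K \<times> L. (cmod (u x))\<^sup>2)"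
    using assms by (intro sum_mono2) auto
  finally show ?thesis by (simp add: L2_set_def)
qed

text \<open>Estimating block by block is wasteful, but only boundedness is at stake: the supremum in
  a matrix norm is finite once the entries are bounded.\<close>

lemma form_bound_block:
  assumes fin: "finite I" "finite J" "finite K"
    and fb: "\<And>k l. k \<in> K \<Longrightarrow> l \<in> K \<Longrightarrow> form_bound I J (A k l) (C k l)"
  shows "form_bound (K \<times> I) (K \<times> J) (\<lambda>(k, i) (l, j). A k l i j) (\<Sum>k\<in>K. \<Sum>l\<in>K. C k l)"
proof (rule form_boundI)
  show "0 \<le> (\<Sum>k\<in>K. \<Sum>l\<in>K. C k l)" using fb form_bound_nonneg by (intro sum_nonneg) blast
  fix w :: "_ \<Rightarrow> complex" and v :: "_ \<Rightarrow> complex"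
  let ?W = "l2 (K \<times> I) w" and ?V = "l2 (K \<times> J) v"
  have "(\<Sum>a\<in>K \<times> I. \<Sum>b\<in>K \<times> J. w a * (case a of (k, i) \<Rightarrow> \<lambda>(l, j). A k l i j) b * v b) =
    (\<Sum>k\<in>K. \<Sum>i\<in>I. \<Sum>l\<in>K. \<Sum>j\<in>J. w (k, i) * A k l i j * v (l, j))"
    by (simp add: sum.cartesian_product' split_def)
  also have "\<dots> = (\<Sum>k\<in>K. \<Sum>l\<in>K. \<Sum>i\<in>I. \<Sum>j\<in>J. w (k, i) * A k l i j * v (l, j))"
    by (intro sum.cong refl) (rule sum.swap)
  also have "cmod \<dots> \<le> (\<Sum>k\<in>K. \<Sum>l\<in>K. cmod (\<Sum>i\<in>I. \<Sum>j\<in>J. w (k, i) * A k l i j * v (l, j)))"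
    by (rule order_trans[OF norm_sum], rule sum_mono, rule norm_sum)
  also have "\<dots> \<le> (\<Sum>k\<in>K. \<Sum>l\<in>K. C k l * ?W * ?V)"
  proof (intro sum_mono)
    fix k l assume kl: "k \<in> K" "l \<in> K"
    note fb' = fb[OF kl]
    have "cmod (\<Sum>i\<in>I. \<Sum>j\<in>J. w (k, i) * A k l i j * v (l, j)) \<le>
      C k l * l2 I (\<lambda>i. w (k, i)) * l2 J (\<lambda>j. v (l, j))"
      by (rule form_boundD[OF fb'])
    also have "\<dots> \<le> C k l * ?W * ?V"
      using form_bound_nonneg[OF fb'] kl fin by (intro mult_mono l2_slice) (auto simp: L2_set_nonneg)
    finally show "cmod (\<Sum>i\<in>I. \<Sum>j\<in>J. w (k, i) * A k l i j * v (l, j)) \<le> C k l * ?W * ?V" .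
  qed
  finally show "cmod (\<Sum>a\<in>K \<times> I. \<Sum>b\<in>K \<times> J. w a * (case a of (k, i) \<Rightarrow> \<lambda>(l, j). A k l i j) b * v b)
    \<le> (\<Sum>k\<in>K. \<Sum>l\<in>K. C k l) * ?W * ?V"
    by (simp add: sum_distrib_right)
qed

text \<open>Evaluate the large form on the elementary tensors of \<open>w\<close> with
  \<open>w'\<close> and of \<open>v\<close> with \<open>v'\<close>, whose norms are products.
  Compressing one tensor factor by vectors in this way reduces matrix statements to smaller
  ones.\<close>

lemma form_bound_contract:
  assumes fin: "finite I" "finite J"
    and fb: "form_bound (I \<times> K) (J \<times> L) (\<lambda>(i, k) (j, l). A i j k l) C"
  shows "form_bound K L (\<lambda>k l. \<Sum>i\<in>I. \<Sum>j\<in>J. w i * A i j k l * v j) (C * l2 I w * l2 J v)"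
proof (rule form_boundI)
  show "0 \<le> C * l2 I w * l2 J v"
    using form_bound_nonneg[OF fb] by (simp add: L2_set_nonneg)
  fix w' v'
  have tens: "l2 (M \<times> N) (\<lambda>(i, k). x i * y k) = l2 M x * l2 N y" for x y and M :: "'z set" and N :: "'y set"
    unfolding L2_set_def
    by (simp add: split_def norm_mult power_mult_distrib sum_product sum.cartesian_product
        flip: real_sqrt_mult)
  have "(\<Sum>k\<in>K. \<Sum>l\<in>L. w' k * (\<Sum>i\<in>I. \<Sum>j\<in>J. w i * A i j k l * v j) * v' l) =
    (\<Sum>k\<in>K. \<Sum>l\<in>L. \<Sum>i\<in>I. \<Sum>j\<in>J. (w i * w' k) * A i j k l * (v j * v' l))"
    by (simp add: sum_distrib_left sum_distrib_right mult_ac)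
  also have "\<dots> = (\<Sum>k\<in>K. \<Sum>i\<in>I. \<Sum>l\<in>L. \<Sum>j\<in>J. (w i * w' k) * A i j k l * (v j * v' l))"
    by (intro sum.cong refl) (rule sum.swap)
  also have "\<dots> = (\<Sum>i\<in>I. \<Sum>k\<in>K. \<Sum>j\<in>J. \<Sum>l\<in>L. (w i * w' k) * A i j k l * (v j * v' l))"
    by (subst sum.swap) (intro sum.cong refl, rule sum.swap)
  also have "\<dots> = (\<Sum>a\<in>I \<times> K. \<Sum>b\<in>J \<times> L. (case a of (i, k) \<Rightarrow> w i * w' k) *
      (case a of (i, k) \<Rightarrow> \<lambda>(j, l). A i j k l) b * (case b of (j, l) \<Rightarrow> v j * v' l))"
    by (simp add: sum.cartesian_product' split_def)
  finally show "cmod (\<Sum>k\<in>K. \<Sum>l\<in>L. w' k * (\<Sum>i\<in>I. \<Sum>j\<in>J. w i * A i j k l * v j) * v' l)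
    \<le> C * l2 I w * l2 J v * l2 K w' * l2 L v'"
    using form_boundD[OF fb, of "\<lambda>(i, k). w i * w' k" "\<lambda>(j, l). v j * v' l"] by (simp add: tens mult_ac)
qed

text \<open>The canonical shuffle of tensor factors. It reconciles two nestings of blocks: in the
  norm of the dual the outer index is that of the functionals, whereas in a matrix of functions
  applied to points it is that of the functions.\<close>

lemma form_bound_swap:
  "form_bound (I \<times> K) (J \<times> L) (\<lambda>(i, k) (j, l). A i j k l) C \<longleftrightarrow>
   form_bound (K \<times> I) (L \<times> J) (\<lambda>(k, i) (l, j). A i j k l) C"
proof -
  have b: "bij_betw prod.swap (K \<times> I) (I \<times> K)" "bij_betw prod.swap (L \<times> J) (J \<times> L)"
    by (auto simp: bij_betw_def inj_on_def image_iff)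
  show ?thesis
    unfolding form_bound_reindex[OF b, symmetric] by (rule form_bound_cong) auto
qed

section \<open>Spaces of functions normed by test matrices\<close>

lemma vector_space_fun: "vector_space (\<lambda>c (f :: 'x \<Rightarrow> complex) x. c * f x)"
  by unfold_locales (auto simp: algebra_simps)

lemma sum_fun_apply: "(\<Sum>s\<in>S. f s) x = (\<Sum>s\<in>S. f s x)"
  by (induction S rule: infinite_finite_induct) auto

lemma Mat_overD: "X \<in> Mat_over n V \<Longrightarrow> X \<in> carrier_mat n n"
  "X \<in> Mat_over n V \<Longrightarrow> i < n \<Longrightarrow> j < n \<Longrightarrow> X $$ (i, j) \<in> carrier V"
  by (auto simp: Mat_over_def)

lemma Mat_overI: "(\<And>i j. i < n \<Longrightarrow> j < n \<Longrightarrow> X $$ (i, j) \<in> carrier V) \<Longrightarrow> X \<in> carrier_mat n n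
  \<Longrightarrow> X \<in> Mat_over n V"
  by (auto simp: Mat_over_def)

text \<open>Instantiated below both by the bounded holomorphic functions and by their dual.\<close>

locale test_space =
  fixes W :: "('x \<Rightarrow> complex) matrix_normed" and Q :: "'x mat set"
  assumes square: "X \<in> Q \<Longrightarrow> X \<in> carrier_mat (dim_row X) (dim_row X)"
    and nonempty: "Q \<noteq> {}"
    and bounded: "f \<in> carrier W \<Longrightarrow> bdd_above ((\<lambda>X. op_norm (map_mat f X)) ` Q)"
    and mnorm_def: "mnorm W = (\<lambda>F. SUP X\<in>Q. op_norm (mat_apply F X))"
    and cscale_def: "cscale W = (\<lambda>c f x. c * f x)"
    and zero_closed: "(\<lambda>x. 0) \<in> carrier W"
    and add_closed: "f \<in> carrier W \<Longrightarrow> g \<in> carrier W \<Longrightarrow> (\<lambda>x. f x + g x) \<in> carrier W"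
    and scale_closed: "f \<in> carrier W \<Longrightarrow> (\<lambda>x. c * f x) \<in> carrier W"
begin

lemma sum_closed: "(\<And>s. s \<in> S \<Longrightarrow> f s \<in> carrier W) \<Longrightarrow> (\<lambda>x. \<Sum>s\<in>S. f s x) \<in> carrier W"
  by (induction S rule: infinite_finite_induct) (auto intro: zero_closed add_closed)

lemma diff_closed: "f \<in> carrier W \<Longrightarrow> g \<in> carrier W \<Longrightarrow> (\<lambda>x. f x - g x) \<in> carrier W"
  using add_closed[of f "\<lambda>x. - 1 * g x"] scale_closed[of g "-1"] by simp

text \<open>Ensures that the \<open>SUP\<close> in \<open>mnorm\<close> is a genuine supremum;
  bounded entries suffice by the block estimate.\<close>

lemma bounded_mat:
  assumes F: "F \<in> Mat_over n W"
  shows "bdd_above ((\<lambda>X. op_norm (mat_apply F X)) ` Q)"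
proof -
  have "\<forall>k l. \<exists>C. k < n \<longrightarrow> l < n \<longrightarrow> (\<forall>X\<in>Q. op_norm (map_mat (F $$ (k, l)) X) \<le> C)"
  proof (intro allI)
    fix k l
    show "\<exists>C. k < n \<longrightarrow> l < n \<longrightarrow> (\<forall>X\<in>Q. op_norm (map_mat (F $$ (k, l)) X) \<le> C)"
    proof (cases "k < n \<and> l < n")
      case True
      then show ?thesis using bounded[OF Mat_overD(2)[OF F, of k l]] by (auto simp: bdd_above_def)
    qed auto
  qed
  then obtain C where C: "\<And>k l X. k < n \<Longrightarrow> l < n \<Longrightarrow> X \<in> Q \<Longrightarrow> op_norm (map_mat (F $$ (k, l)) X) \<le> C k l"
    by metis
  show ?thesis
  proof (rule bdd_aboveI2)
    fix X assume X: "X \<in> Q"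
    note c = square[OF X]
    show "op_norm (mat_apply F X) \<le> (\<Sum>k<n. \<Sum>l<n. C k l)"
      unfolding op_norm_mat_apply_le_iff[OF Mat_overD(1)[OF F] c]
    proof (rule form_bound_block)
      fix k l assume "k \<in> {..<n}" "l \<in> {..<n}"
      then have "op_norm (map_mat (F $$ (k, l)) X) \<le> C k l" using C X by simp
      then show "form_bound {..<dim_row X} {..<dim_row X} (\<lambda>i j. (F $$ (k, l)) (X $$ (i, j))) (C k l)"
        by (simp only: op_norm_map_mat_le_iff[OF c])
    qed simp_all
  qed
qed

lemma mnorm_leI: "(\<And>X. X \<in> Q \<Longrightarrow> op_norm (mat_apply F X) \<le> C) \<Longrightarrow> mnorm W F \<le> C"
  unfolding mnorm_def by (rule cSUP_least[OF nonempty])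

lemma op_norm_le_mnorm: "F \<in> Mat_over n W \<Longrightarrow> X \<in> Q \<Longrightarrow> op_norm (mat_apply F X) \<le> mnorm W F"
  unfolding mnorm_def by (rule cSUP_upper[OF _ bounded_mat])

lemma mnorm_nonneg: "F \<in> Mat_over n W \<Longrightarrow> 0 \<le> mnorm W F"
  using op_norm_le_mnorm nonempty op_norm_nonneg by (meson ex_in_conv order_trans)

lemma mnorm_form:
  assumes "F \<in> Mat_over n W" "X \<in> Q" "X \<in> carrier_mat p p"
  shows "form_bound ({..<n} \<times> {..<p}) ({..<n} \<times> {..<p}) (\<lambda>(k, i) (l, j). (F $$ (k, l)) (X $$ (i, j))) (mnorm W F)"
  using op_norm_le_mnorm[OF assms(1,2)] op_norm_mat_apply_le_iff[OF Mat_overD(1)[OF assms(1)] assms(3)] by blast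

lemma mnorm_leI_form:
  assumes "F \<in> carrier_mat n n"
    and "\<And>X p. X \<in> Q \<Longrightarrow> X \<in> carrier_mat p p \<Longrightarrow>
      form_bound ({..<n} \<times> {..<p}) ({..<n} \<times> {..<p}) (\<lambda>(k, i) (l, j). (F $$ (k, l)) (X $$ (i, j))) C"
  shows "mnorm W F \<le> C"
proof (rule mnorm_leI)
  fix X assume X: "X \<in> Q"
  show "op_norm (mat_apply F X) \<le> C"
    unfolding op_norm_mat_apply_le_iff[OF assms(1) square[OF X]] by (rule assms(2)[OF X square[OF X]])
qed

lemma single_Mat: "f \<in> carrier W \<Longrightarrow> Matrix.mat 1 1 (\<lambda>_. f) \<in> Mat_over 1 W"
  by (auto simp: Mat_over_def)

lemma vnorm_form:
  assumes "f \<in> carrier W" "X \<in> Q" "X \<in> carrier_mat p p"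
  shows "form_bound {..<p} {..<p} (\<lambda>i j. f (X $$ (i, j))) (vnorm W f)"
  using op_norm_le_mnorm[OF single_Mat[OF assms(1)] assms(2)]
  by (simp only: mat_apply_single op_norm_map_mat_le_iff[OF assms(3)] vnorm_def)

lemma vnorm_leI:
  assumes "\<And>X p. X \<in> Q \<Longrightarrow> X \<in> carrier_mat p p \<Longrightarrow> form_bound {..<p} {..<p} (\<lambda>i j. f (X $$ (i, j))) C"
  shows "vnorm W f \<le> C"
  unfolding vnorm_def
proof (rule mnorm_leI)
  fix X assume X: "X \<in> Q"
  show "op_norm (mat_apply (Matrix.mat 1 1 (\<lambda>_. f)) X) \<le> C"
    unfolding mat_apply_single using assms[OF X square[OF X]] op_norm_map_mat_le_iff[OF square[OF X]] by blast
qed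

lemma vnorm_nonneg: "f \<in> carrier W \<Longrightarrow> 0 \<le> vnorm W f"
  unfolding vnorm_def by (rule mnorm_nonneg[OF single_Mat])

lemma vnorm_add:
  "f \<in> carrier W \<Longrightarrow> g \<in> carrier W \<Longrightarrow> vnorm W (\<lambda>x. f x + g x) \<le> vnorm W f + vnorm W g"
  by (intro vnorm_leI form_bound_add vnorm_form)

lemma vnorm_scale_le:
  "f \<in> carrier W \<Longrightarrow> vnorm W (\<lambda>x. c * f x) \<le> cmod c * vnorm W f"
  by (intro vnorm_leI form_bound_scale vnorm_form)

lemma vnorm_zero: "vnorm W (\<lambda>x. 0) = 0"
  by (intro antisym vnorm_leI vnorm_nonneg) (auto simp: zero_closed)

lemma vnorm_scale:
  assumes "f \<in> carrier W"
  shows "vnorm W (\<lambda>x. c * f x) = cmod c * vnorm W f"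
proof (cases "c = 0")
  case False
  have "vnorm W f = vnorm W (\<lambda>x. inverse c * (c * f x))" using False by (simp flip: mult.assoc)
  also have "\<dots> \<le> cmod (inverse c) * vnorm W (\<lambda>x. c * f x)"
    by (intro vnorm_scale_le scale_closed assms)
  finally have "cmod c * vnorm W f \<le> cmod c * (cmod (inverse c) * vnorm W (\<lambda>x. c * f x))"
    by (rule mult_left_mono) simp
  also have "\<dots> = vnorm W (\<lambda>x. c * f x)" using False by (simp add: norm_inverse)
  finally show ?thesis using vnorm_scale_le[OF assms, of c] by simp
qed (simp add: vnorm_zero)

lemma vnorm_minus_commute:
  assumes "f \<in> carrier W" "g \<in> carrier W"
  shows "vnorm W (\<lambda>x. f x - g x) = vnorm W (\<lambda>x. g x - f x)"
  using vnorm_scale[OF diff_closed[OF assms], of "-1"] by simp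

lemma contract_closed:
  assumes "F \<in> Mat_over m W"
  shows "(\<lambda>x. \<Sum>i<m. \<Sum>j<m. w i * (F $$ (i, j)) x * v j) \<in> carrier W"
proof -
  have "(\<lambda>x. \<Sum>i<m. \<Sum>j<m. (w i * v j) * (F $$ (i, j)) x) \<in> carrier W"
    using Mat_overD(2)[OF assms] by (intro sum_closed scale_closed) auto
  then show ?thesis by (simp add: mult_ac)
qed

lemma vnorm_contract:
  assumes F: "F \<in> Mat_over m W"
  shows "vnorm W (\<lambda>x. \<Sum>i<m. \<Sum>j<m. w i * (F $$ (i, j)) x * v j) \<le> mnorm W F * l2 {..<m} w * l2 {..<m} v"
  by (intro vnorm_leI form_bound_contract mnorm_form[OF F]) auto

lemma subspace: "Modules.module.subspace (cscale W) (carrier W)"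
proof -
  interpret vector_space "cscale W" unfolding cscale_def by (rule vector_space_fun)
  show ?thesis
    using zero_closed add_closed scale_closed
    by (intro subspaceI) (auto simp: cscale_def zero_fun_def plus_fun_def)
qed

end

text \<open>The constant in the definition of the dual may be any real; as norms are nonnegative, it
  can be replaced by \<open>max K 0\<close>.\<close>

lemma mem_dual_iff:
  "\<phi> \<in> carrier (dual_os W) \<longleftrightarrow>
     (\<forall>x \<in> carrier W. \<forall>y \<in> carrier W. \<phi> (x + y) = \<phi> x + \<phi> y) \<and>
     (\<forall>c. \<forall>x \<in> carrier W. \<phi> (cscale W c x) = c * \<phi> x) \<and>
     (\<exists>K\<ge>0. \<forall>x \<in> carrier W. cmod (\<phi> x) \<le> K * vnorm W x) \<and>
     (\<forall>x. x \<notin> carrier W \<longrightarrow> \<phi> x = 0)" if "\<And>x. x \<in> carrier W \<Longrightarrow> 0 \<le> vnorm W x"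
proof -
  have "(\<exists>K\<ge>0. \<forall>x \<in> carrier W. cmod (\<phi> x) \<le> K * vnorm W x)"
    if K: "\<forall>x \<in> carrier W. cmod (\<phi> x) \<le> K * vnorm W x" for K
    using K that by (intro exI[of _ "max K 0"])
      (auto intro: order_trans[OF _ mult_right_mono] \<open>\<And>x. x \<in> carrier W \<Longrightarrow> 0 \<le> vnorm W x\<close>)
  then have "(\<exists>K. \<forall>x \<in> carrier W. cmod (\<phi> x) \<le> K * vnorm W x) \<longleftrightarrow>
    (\<exists>K\<ge>0. \<forall>x \<in> carrier W. cmod (\<phi> x) \<le> K * vnorm W x)" by blast
  then show ?thesis by (auto simp: dual_os_def linear_between_def complex_os_def)
qed

lemma dual_add: "\<phi> \<in> carrier (dual_os W) \<Longrightarrow> x \<in> carrier W \<Longrightarrow> y \<in> carrier W \<Longrightarrow> \<phi> (x + y) = \<phi> x + \<phi> y"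
  and dual_scale: "\<phi> \<in> carrier (dual_os W) \<Longrightarrow> x \<in> carrier W \<Longrightarrow> \<phi> (cscale W c x) = c * \<phi> x"
  and dual_outside: "\<phi> \<in> carrier (dual_os W) \<Longrightarrow> x \<notin> carrier W \<Longrightarrow> \<phi> x = 0"
  by (simp_all add: dual_os_def linear_between_def complex_os_def)

lemma dual_boundedE:
  assumes "\<And>x. x \<in> carrier W \<Longrightarrow> 0 \<le> vnorm W x" "\<phi> \<in> carrier (dual_os W)"
  obtains K where "0 \<le> K" "\<And>x. x \<in> carrier W \<Longrightarrow> cmod (\<phi> x) \<le> K * vnorm W x"
proof -
  have "\<exists>K\<ge>0. \<forall>x \<in> carrier W. cmod (\<phi> x) \<le> K * vnorm W x"
    using mem_dual_iff[OF assms(1), THEN iffD1, OF _ assms(2), THEN conjunct2, THEN conjunct2, THEN conjunct1]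
    by simp
  then show ?thesis using that by blast
qed

lemma dual_closed:
  assumes nonneg: "\<And>x. x \<in> carrier W \<Longrightarrow> 0 \<le> vnorm W x"
  shows "(\<lambda>x. 0) \<in> carrier (dual_os W)"
    and "\<phi> \<in> carrier (dual_os W) \<Longrightarrow> \<psi> \<in> carrier (dual_os W) \<Longrightarrow> (\<lambda>x. \<phi> x + \<psi> x) \<in> carrier (dual_os W)"
    and "\<phi> \<in> carrier (dual_os W) \<Longrightarrow> (\<lambda>x. c * \<phi> x) \<in> carrier (dual_os W)"
proof -
  note mem = mem_dual_iff[OF nonneg]
  show "(\<lambda>x. 0) \<in> carrier (dual_os W)"
    by (rule iffD2[OF mem], assumption) (auto intro!: exI[of _ 0])
  show "(\<lambda>x. \<phi> x + \<psi> x) \<in> carrier (dual_os W)" if "\<phi> \<in> carrier (dual_os W)" "\<psi> \<in> carrier (dual_os W)"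
  proof -
    obtain K where "0 \<le> K" "\<And>x. x \<in> carrier W \<Longrightarrow> cmod (\<phi> x) \<le> K * vnorm W x"
      using dual_boundedE[OF nonneg \<open>\<phi> \<in> _\<close>] by blast
    moreover obtain L where "0 \<le> L" "\<And>x. x \<in> carrier W \<Longrightarrow> cmod (\<psi> x) \<le> L * vnorm W x"
      using dual_boundedE[OF nonneg \<open>\<psi> \<in> _\<close>] by blast
    ultimately have 1: "\<forall>x\<in>carrier W. cmod (\<phi> x + \<psi> x) \<le> (K + L) * vnorm W x"
      by (auto simp: algebra_simps intro: norm_triangle_mono)
    have 2: "\<forall>x\<in>carrier W. \<forall>y\<in>carrier W. \<phi> (x + y) + \<psi> (x + y) = \<phi> x + \<psi> x + (\<phi> y + \<psi> y)"
      using that by (simp add: dual_add dual_scale dual_outside)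
    have 3: "\<forall>c. \<forall>x\<in>carrier W. \<phi> (cscale W c x) + \<psi> (cscale W c x) = c * (\<phi> x + \<psi> x)"
      using that by (simp add: dual_add dual_scale distrib_left)
    have 4: "\<forall>x. x \<notin> carrier W \<longrightarrow> \<phi> x + \<psi> x = 0" using that by (simp add: dual_add dual_scale dual_outside)
    have 5: "0 \<le> K + L" using \<open>0 \<le> K\<close> \<open>0 \<le> L\<close> by simp
    show ?thesis by (rule iffD2[OF mem], assumption) (intro conjI exI[of _ "K + L"] 1 2 3 4 5)
  qed
  show "(\<lambda>x. c * \<phi> x) \<in> carrier (dual_os W)" if "\<phi> \<in> carrier (dual_os W)"
  proof -
    obtain K where "0 \<le> K" "\<And>x. x \<in> carrier W \<Longrightarrow> cmod (\<phi> x) \<le> K * vnorm W x"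
      using dual_boundedE[OF nonneg \<open>\<phi> \<in> _\<close>] by blast
    then have 1: "\<forall>x\<in>carrier W. cmod (c * \<phi> x) \<le> (cmod c * K) * vnorm W x"
      by (auto simp: norm_mult mult.assoc intro!: mult_left_mono)
    have 2: "\<forall>x\<in>carrier W. \<forall>y\<in>carrier W. c * \<phi> (x + y) = c * \<phi> x + c * \<phi> y"
      using that by (simp add: dual_add dual_scale distrib_left)
    have 3: "\<forall>d. \<forall>x\<in>carrier W. c * \<phi> (cscale W d x) = d * (c * \<phi> x)"
      using that by (simp add: dual_add dual_scale dual_outside)
    have 4: "\<forall>x. x \<notin> carrier W \<longrightarrow> c * \<phi> x = 0" using that by (simp add: dual_add dual_scale dual_outside)
    have 5: "0 \<le> cmod c * K" using \<open>0 \<le> K\<close> by simp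
    show ?thesis by (rule iffD2[OF mem], assumption) (intro conjI exI[of _ "cmod c * K"] 1 2 3 4 5)
  qed
qed

section \<open>Operator spaces: first consequences of Ruan's axioms\<close>

locale op_space =
  fixes V :: "'v::ab_group_add matrix_normed"
  assumes os: "operator_space V"
begin

sublocale vs: vector_space "cscale V" using os by (simp add: operator_space_def)

lemma subspace: "vs.subspace (carrier V)" using os by (simp add: operator_space_def)

lemmas zero_mem [simp] = vs.subspace_0[OF subspace]
lemmas add_mem [simp] = vs.subspace_add[OF subspace]
lemmas scale_mem [simp] = vs.subspace_scale[OF subspace]
lemmas diff_mem [simp] = vs.subspace_diff[OF subspace]
lemmas neg_mem [simp] = vs.subspace_neg[OF subspace]

abbreviation nv :: "'v \<Rightarrow> real" where "nv \<equiv> vnorm V"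
abbreviation sm :: "complex \<Rightarrow> 'v \<Rightarrow> 'v" (infixr "\<cdot>" 75) where "sm \<equiv> cscale V"

lemma mn_nonneg: "n > 0 \<Longrightarrow> X \<in> Mat_over n V \<Longrightarrow> 0 \<le> mnorm V X"
  and mn_zero_iff: "n > 0 \<Longrightarrow> X \<in> Mat_over n V \<Longrightarrow> mnorm V X = 0 \<longleftrightarrow> X = 0\<^sub>m n n"
  and mn_scale: "n > 0 \<Longrightarrow> X \<in> Mat_over n V \<Longrightarrow> mnorm V (map_mat (cscale V c) X) = cmod c * mnorm V X"
  and mn_add: "n > 0 \<Longrightarrow> X \<in> Mat_over n V \<Longrightarrow> Y \<in> Mat_over n V \<Longrightarrow> mnorm V (X + Y) \<le> mnorm V X + mnorm V Y"
  and mn_block: "n > 0 \<Longrightarrow> m > 0 \<Longrightarrow> X \<in> Mat_over n V \<Longrightarrow> Y \<in> Mat_over m V \<Longrightarrow>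
     mnorm V (four_block_mat X (0\<^sub>m n m) (0\<^sub>m m n) Y) = max (mnorm V X) (mnorm V Y)"
  and mn_mult: "n > 0 \<Longrightarrow> m > 0 \<Longrightarrow> X \<in> Mat_over n V \<Longrightarrow> \<alpha> \<in> carrier_mat m n \<Longrightarrow> \<beta> \<in> carrier_mat n m \<Longrightarrow>
     mnorm V (two_sided_mult V \<alpha> X \<beta>) \<le> op_norm \<alpha> * mnorm V X * op_norm \<beta>"
proof -
  note ax = os[unfolded operator_space_def, THEN conjunct2, THEN conjunct2]
  note ax1 = ax[THEN conjunct1] and ax2 = ax[THEN conjunct2, THEN conjunct1]
    and ax3 = ax[THEN conjunct2, THEN conjunct2, THEN conjunct1]
    and ax4 = ax[THEN conjunct2, THEN conjunct2, THEN conjunct2, THEN conjunct1]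
    and ax5 = ax[THEN conjunct2, THEN conjunct2, THEN conjunct2, THEN conjunct2, THEN conjunct1]
  show "n > 0 \<Longrightarrow> X \<in> Mat_over n V \<Longrightarrow> 0 \<le> mnorm V X"
    and "n > 0 \<Longrightarrow> X \<in> Mat_over n V \<Longrightarrow> mnorm V X = 0 \<longleftrightarrow> X = 0\<^sub>m n n"
    using ax1 by blast+
  show "n > 0 \<Longrightarrow> X \<in> Mat_over n V \<Longrightarrow> mnorm V (map_mat (cscale V c) X) = cmod c * mnorm V X"
    using ax2 by blast
  show "n > 0 \<Longrightarrow> X \<in> Mat_over n V \<Longrightarrow> Y \<in> Mat_over n V \<Longrightarrow> mnorm V (X + Y) \<le> mnorm V X + mnorm V Y"
    using ax3 by blast
  show "n > 0 \<Longrightarrow> m > 0 \<Longrightarrow> X \<in> Mat_over n V \<Longrightarrow> Y \<in> Mat_over m V \<Longrightarrow>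
     mnorm V (four_block_mat X (0\<^sub>m n m) (0\<^sub>m m n) Y) = max (mnorm V X) (mnorm V Y)"
    using ax4 by blast
  show "n > 0 \<Longrightarrow> m > 0 \<Longrightarrow> X \<in> Mat_over n V \<Longrightarrow> \<alpha> \<in> carrier_mat m n \<Longrightarrow> \<beta> \<in> carrier_mat n m \<Longrightarrow>
     mnorm V (two_sided_mult V \<alpha> X \<beta>) \<le> op_norm \<alpha> * mnorm V X * op_norm \<beta>"
    using ax5 by blast
qed

lemma complete_V:
  assumes "\<And>k. s k \<in> carrier V" "\<And>e. e > 0 \<Longrightarrow> \<exists>N. \<forall>k\<ge>N. \<forall>l\<ge>N. nv (s k - s l) < e"
  obtains x where "x \<in> carrier V" "(\<lambda>k. nv (s k - x)) \<longlonglongrightarrow> 0"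
proof -
  note ax = os[unfolded operator_space_def, THEN conjunct2, THEN conjunct2, THEN conjunct2,
    THEN conjunct2, THEN conjunct2, THEN conjunct2, THEN conjunct2]
  have "\<exists>x \<in> carrier V. (\<lambda>k. nv (s k - x)) \<longlonglongrightarrow> 0"
    using ax[rule_format, OF assms] .
  then show ?thesis using that by blast
qed

lemma single_Mat: "x \<in> carrier V \<Longrightarrow> Matrix.mat 1 1 (\<lambda>_. x) \<in> Mat_over 1 V"
  by (auto simp: Mat_over_def)

lemma nv_nonneg [simp]: "x \<in> carrier V \<Longrightarrow> 0 \<le> nv x"
  unfolding vnorm_def using mn_nonneg[OF _ single_Mat] by simp

lemma nv_zero_iff: "x \<in> carrier V \<Longrightarrow> nv x = 0 \<longleftrightarrow> x = 0"
proof -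
  assume x: "x \<in> carrier V"
  have "Matrix.mat 1 1 (\<lambda>_. x) = 0\<^sub>m 1 1 \<longleftrightarrow> x = 0"
    by (auto simp: mat_eq_iff)
  then show ?thesis unfolding vnorm_def using mn_zero_iff[OF _ single_Mat[OF x]] by simp
qed

lemma nv_0 [simp]: "nv 0 = 0" using nv_zero_iff by simp

lemma nv_scale: "x \<in> carrier V \<Longrightarrow> nv (c \<cdot> x) = cmod c * nv x"
proof -
  assume x: "x \<in> carrier V"
  have "map_mat (cscale V c) (Matrix.mat 1 1 (\<lambda>_. x)) = Matrix.mat 1 1 (\<lambda>_. c \<cdot> x)"
    by (rule eq_matI) auto
  then show ?thesis unfolding vnorm_def using mn_scale[OF _ single_Mat[OF x], of c] by simp
qed

lemma nv_triangle: "x \<in> carrier V \<Longrightarrow> y \<in> carrier V \<Longrightarrow> nv (x + y) \<le> nv x + nv y"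
proof -
  assume x: "x \<in> carrier V" and y: "y \<in> carrier V"
  have "Matrix.mat 1 1 (\<lambda>_. x) + Matrix.mat 1 1 (\<lambda>_. y) = Matrix.mat 1 1 (\<lambda>_. x + y)"
    by (rule eq_matI) auto
  then show ?thesis unfolding vnorm_def using mn_add[OF _ single_Mat[OF x] single_Mat[OF y]] by simp
qed

lemma nv_minus: "x \<in> carrier V \<Longrightarrow> nv (- x) = nv x"
  using nv_scale[of x "-1"] by simp

lemma nv_diff: "x \<in> carrier V \<Longrightarrow> y \<in> carrier V \<Longrightarrow> nv (x - y) \<le> nv x + nv y"
  using nv_triangle[of x "-y"] by (simp add: nv_minus)

text \<open>An entry is the compression of \<open>X\<close> by a unit row and a unit column, scalar
  matrices of norm at most 1, so Ruan's multiplication axiom applies.\<close>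

lemma nv_entry:
  assumes X: "X \<in> Mat_over n V" and ij: "i < n" "j < n"
  shows "nv (X $$ (i, j)) \<le> mnorm V X"
proof -
  have n: "n > 0" using ij by simp
  define \<alpha> where "\<alpha> = Matrix.mat 1 n (\<lambda>(_, k). if k = i then 1 else 0 :: complex)"
  define \<beta> where "\<beta> = Matrix.mat n 1 (\<lambda>(k, _). if k = j then 1 else 0 :: complex)"
  have c: "\<alpha> \<in> carrier_mat 1 n" "\<beta> \<in> carrier_mat n 1" by (auto simp: \<alpha>_def \<beta>_def)
  have "op_norm \<alpha> \<le> 1"
    unfolding op_norm_le_iff[OF c(1)]
  proof (rule form_boundI)
    fix w v :: "nat \<Rightarrow> complex"
    have "(\<Sum>a<1. \<Sum>k<n. w a * \<alpha> $$ (a, k) * v k) = (\<Sum>a<(1::nat). \<Sum>k<n. if k = i then w a * v k else 0)"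
      by (intro sum.cong refl) (auto simp: \<alpha>_def)
    also have "\<dots> = w 0 * v i" using ij by simp
    finally show "cmod (\<Sum>a<1. \<Sum>k<n. w a * \<alpha> $$ (a, k) * v k) \<le> 1 * l2 {..<1} w * l2 {..<n} v"
      using ij cmod_le_l2[of "{..<n}" i v] cmod_le_l2[of "{..<1}" 0 w]
      by (simp add: norm_mult L2_set_nonneg mult_mono)
  qed simp
  moreover have "op_norm \<beta> \<le> 1"
    unfolding op_norm_le_iff[OF c(2)]
  proof (rule form_boundI)
    fix w v :: "nat \<Rightarrow> complex"
    have "(\<Sum>k<n. \<Sum>a<1. w k * \<beta> $$ (k, a) * v a) = (\<Sum>k<n. if k = j then \<Sum>a<(1::nat). w k * v a else 0)"
      by (intro sum.cong refl) (auto simp: \<beta>_def)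
    also have "\<dots> = w j * v 0" using ij by simp
    finally show "cmod (\<Sum>k<n. \<Sum>a<1. w k * \<beta> $$ (k, a) * v a) \<le> 1 * l2 {..<n} w * l2 {..<1} v"
      using ij cmod_le_l2[of "{..<n}" j w] cmod_le_l2[of "{..<1}" 0 v]
      by (simp add: norm_mult L2_set_nonneg mult_mono)
  qed simp
  moreover have "two_sided_mult V \<alpha> X \<beta> = Matrix.mat 1 1 (\<lambda>_. X $$ (i, j))"
  proof (rule eq_matI)
    fix a b assume "a < dim_row (Matrix.mat 1 1 (\<lambda>_. X $$ (i, j)))" "b < dim_col (Matrix.mat 1 1 (\<lambda>_. X $$ (i, j)))"
    then have ab: "a = 0" "b = 0" by auto
    have d: "dim_row X = n" "dim_col X = n" using Mat_overD(1)[OF X] by auto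
    have "two_sided_mult V \<alpha> X \<beta> $$ (a, b) = (\<Sum>k<n. \<Sum>l<n. (\<alpha> $$ (0, k) * \<beta> $$ (l, 0)) \<cdot> (X $$ (k, l)))"
      using c ab by (simp add: two_sided_mult_def d)
    also have "\<dots> = (\<Sum>k<n. \<Sum>l<n. if k = i then if l = j then X $$ (k, l) else 0 else 0)"
      by (intro sum.cong refl) (auto simp: \<alpha>_def \<beta>_def)
    also have "\<dots> = (\<Sum>k<n. if k = i then X $$ (k, j) else 0)"
      using ij by (intro sum.cong refl) auto
    also have "\<dots> = X $$ (i, j)" using ij by simp
    finally show "two_sided_mult V \<alpha> X \<beta> $$ (a, b) = Matrix.mat 1 1 (\<lambda>_. X $$ (i, j)) $$ (a, b)"
      using ab by simp
  qed (use c in \<open>auto simp: two_sided_mult_def\<close>)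
  ultimately have "nv (X $$ (i, j)) \<le> op_norm \<alpha> * mnorm V X * op_norm \<beta>" "op_norm \<alpha> \<le> 1" "op_norm \<beta> \<le> 1"
    using mn_mult[OF n _ X c] unfolding vnorm_def by auto
  moreover have "op_norm \<alpha> * mnorm V X * op_norm \<beta> \<le> 1 * mnorm V X * 1"
    using mn_nonneg[OF n X] calculation op_norm_nonneg by (intro mult_mono) (auto intro: mult_nonneg_nonneg)
  ultimately show ?thesis by simp
qed

abbreviation fd :: "('v \<Rightarrow> complex) \<Rightarrow> 'v \<Rightarrow> bool" where "fd \<equiv> frechet_differentiable_at V"

lemma fd_add:
  assumes "fd f x" "fd g x" shows "fd (\<lambda>y. f y + g y) x"
proof -
  obtain L M where L: "L \<in> carrier (dual_os V)" "M \<in> carrier (dual_os V)"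
    "\<And>e. e > 0 \<Longrightarrow> \<exists>d>0. \<forall>h \<in> carrier V. nv h < d \<longrightarrow> cmod (f (x + h) - f x - L h) \<le> e * nv h"
    "\<And>e. e > 0 \<Longrightarrow> \<exists>d>0. \<forall>h \<in> carrier V. nv h < d \<longrightarrow> cmod (g (x + h) - g x - M h) \<le> e * nv h"
    using assms unfolding frechet_differentiable_at_def by blast
  show ?thesis unfolding frechet_differentiable_at_def
  proof (intro bexI[where x = "\<lambda>h. L h + M h"] allI impI)
    fix e :: real assume "e > 0"
    then have e: "e / 2 > 0" by simp
    obtain d d' where d: "d > 0" "d' > 0"
      "\<And>h. h \<in> carrier V \<Longrightarrow> nv h < d \<Longrightarrow> cmod (f (x + h) - f x - L h) \<le> e / 2 * nv h"
      "\<And>h. h \<in> carrier V \<Longrightarrow> nv h < d' \<Longrightarrow> cmod (g (x + h) - g x - M h) \<le> e / 2 * nv h"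
      using L(3)[OF e] L(4)[OF e] by blast
    show "\<exists>d>0. \<forall>h\<in>carrier V. nv h < d \<longrightarrow> cmod (f (x + h) + g (x + h) - (f x + g x) - (L h + M h)) \<le> e * nv h"
    proof (intro exI[of _ "min d d'"] conjI ballI impI)
      fix h assume h: "h \<in> carrier V" "nv h < min d d'"
      have "cmod ((f (x + h) - f x - L h) + (g (x + h) - g x - M h)) \<le> e / 2 * nv h + e / 2 * nv h"
        using h by (intro norm_triangle_mono d) auto
      then show "cmod (f (x + h) + g (x + h) - (f x + g x) - (L h + M h)) \<le> e * nv h"
        by (simp add: algebra_simps)
    qed (use d in auto)
  qed (rule dual_closed(2)[OF nv_nonneg L(1,2)])
qed

lemma fd_scale:
  assumes "fd f x" shows "fd (\<lambda>y. c * f y) x"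
proof -
  obtain L where L: "L \<in> carrier (dual_os V)"
    "\<And>e. e > 0 \<Longrightarrow> \<exists>d>0. \<forall>h \<in> carrier V. nv h < d \<longrightarrow> cmod (f (x + h) - f x - L h) \<le> e * nv h"
    using assms unfolding frechet_differentiable_at_def by blast
  show ?thesis unfolding frechet_differentiable_at_def
  proof (intro bexI[where x = "\<lambda>h. c * L h"] allI impI)
    fix e :: real assume "e > 0"
    then have e: "e / (cmod c + 1) > 0" by (simp add: add_nonneg_pos)
    obtain d where d: "d > 0"
      "\<And>h. h \<in> carrier V \<Longrightarrow> nv h < d \<Longrightarrow> cmod (f (x + h) - f x - L h) \<le> e / (cmod c + 1) * nv h"
      using L(2)[OF e] by blast
    show "\<exists>d>0. \<forall>h\<in>carrier V. nv h < d \<longrightarrow> cmod (c * f (x + h) - c * f x - c * L h) \<le> e * nv h"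
    proof (intro exI[of _ d] conjI ballI impI)
      fix h assume h: "h \<in> carrier V" "nv h < d"
      have "cmod (c * f (x + h) - c * f x - c * L h) = cmod c * cmod (f (x + h) - f x - L h)"
        by (simp add: algebra_simps flip: norm_mult)
      also have "\<dots> \<le> (cmod c + 1) * (e / (cmod c + 1) * nv h)"
        using h d(2)[OF h] by (intro mult_mono) auto
      also have "\<dots> = e * nv h" by (simp add: add_nonneg_eq_0_iff)
      finally show "cmod (c * f (x + h) - c * f x - c * L h) \<le> e * nv h" .
    qed (use d in auto)
  qed (rule dual_closed(3)[OF nv_nonneg L(1)])
qed

lemma fd_const: "fd (\<lambda>y. c) x"
  unfolding frechet_differentiable_at_def
  by (rule bexI[OF _ dual_closed(1)[OF nv_nonneg]]) (auto intro!: exI[of _ 1])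

lemma fd_sum: "(\<And>s. s \<in> S \<Longrightarrow> fd (f s) x) \<Longrightarrow> fd (\<lambda>y. \<Sum>s\<in>S. f s y) x"
  by (induction S rule: infinite_finite_induct) (auto intro: fd_const fd_add)

section \<open>Bounded holomorphic functions on the ball and their dual\<close>

abbreviation H where "H \<equiv> Hinf_cb V"
abbreviation B where "B \<equiv> unit_ball V"
abbreviation D where "D \<equiv> dual_os H"

lemma fd_cong:
  assumes "\<And>y. y \<in> carrier V \<Longrightarrow> nv (y - x) < \<rho> \<Longrightarrow> f y = g y" "\<rho> > 0" "fd g x" "x \<in> carrier V"
  shows "fd f x"
proof -
  obtain L where L: "L \<in> carrier (dual_os V)"
    "\<And>e. e > 0 \<Longrightarrow> \<exists>d>0. \<forall>h \<in> carrier V. nv h < d \<longrightarrow> cmod (g (x + h) - g x - L h) \<le> e * nv h"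
    using assms unfolding frechet_differentiable_at_def by blast
  show ?thesis unfolding frechet_differentiable_at_def
  proof (intro bexI[where x = L] allI impI)
    fix e :: real assume "e > 0"
    then obtain d where d: "d > 0"
      "\<And>h. h \<in> carrier V \<Longrightarrow> nv h < d \<Longrightarrow> cmod (g (x + h) - g x - L h) \<le> e * nv h"
      using L(2) by blast
    show "\<exists>d>0. \<forall>h\<in>carrier V. nv h < d \<longrightarrow> cmod (f (x + h) - f x - L h) \<le> e * nv h"
      using d assms by (intro exI[of _ "min d \<rho>"]) auto
  qed (rule L)
qed

lemma mem_B: "x \<in> B \<longleftrightarrow> x \<in> carrier V \<and> nv x < 1"
  by (simp add: unit_ball_def)

lemma B_open:
  assumes "x \<in> B" "y \<in> carrier V" "nv (y - x) < 1 - nv x"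
  shows "y \<in> B"
  using assms nv_triangle[of "y - x" x] by (auto simp: mem_B)

lemma mem_H: "f \<in> carrier H \<longleftrightarrow> (\<forall>x\<in>B. fd f x) \<and>
   bdd_above ((\<lambda>X. op_norm (map_mat f X)) ` matrix_unit_ball V) \<and> (\<forall>x. x \<notin> B \<longrightarrow> f x = 0)"
  by (simp add: Hinf_cb_def)

lemma mem_mub: "X \<in> matrix_unit_ball V \<longleftrightarrow> (\<exists>p>0. X \<in> Mat_over p V \<and> mnorm V X < 1)"
  by (auto simp: matrix_unit_ball_def)

lemma single_mub: "x \<in> B \<Longrightarrow> Matrix.mat 1 1 (\<lambda>_. x) \<in> matrix_unit_ball V"
  unfolding mem_mub mem_B vnorm_def using single_Mat by (intro exI[of _ 1]) auto

lemma zero_B [simp]: "0 \<in> B" by (simp add: mem_B)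

lemma bdd_op_norm_iff:
  assumes Q: "\<And>X. X \<in> Q \<Longrightarrow> X \<in> carrier_mat (dim_row X) (dim_row X)"
  shows "bdd_above ((\<lambda>X. op_norm (map_mat f X)) ` Q) \<longleftrightarrow>
    (\<exists>C. \<forall>X\<in>Q. form_bound {..<dim_row X} {..<dim_row X} (\<lambda>i j. f (X $$ (i, j))) C)"
  unfolding bdd_above_def using op_norm_map_mat_le_iff[OF Q] by auto

lemma H_test: "test_space H (matrix_unit_ball V)"
proof
  fix X assume "X \<in> matrix_unit_ball V"
  then show "X \<in> carrier_mat (dim_row X) (dim_row X)"
    unfolding mem_mub Mat_over_def by auto
next
  show "matrix_unit_ball V \<noteq> {}" using single_mub[OF zero_B] by blast
next
  note bi = bdd_op_norm_iff[of "matrix_unit_ball V"]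
  have sq: "X \<in> matrix_unit_ball V \<Longrightarrow> X \<in> carrier_mat (dim_row X) (dim_row X)" for X
    unfolding mem_mub Mat_over_def by auto
  show "(\<lambda>x. 0) \<in> carrier H"
    unfolding mem_H by (subst bi[OF sq]) (auto intro: fd_const intro!: exI[of _ 0])
  fix f assume f: "f \<in> carrier H"
  then show "bdd_above ((\<lambda>X. op_norm (map_mat f X)) ` matrix_unit_ball V)" by (simp add: mem_H)
  obtain C where C: "\<forall>X\<in>matrix_unit_ball V. form_bound {..<dim_row X} {..<dim_row X} (\<lambda>i j. f (X $$ (i, j))) C"
    using f[unfolded mem_H] bi[OF sq, of f] by blast
  show "(\<lambda>x. c * f x) \<in> carrier H" for c
    using f C unfolding mem_H
    by (subst bi[OF sq]) (auto intro: fd_scale intro!: form_bound_scale exI[of _ "cmod c * C"])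
  fix g assume g: "g \<in> carrier H"
  obtain C' where C': "\<forall>X\<in>matrix_unit_ball V. form_bound {..<dim_row X} {..<dim_row X} (\<lambda>i j. g (X $$ (i, j))) C'"
    using g[unfolded mem_H] bi[OF sq, of g] by blast
  have "\<forall>X\<in>matrix_unit_ball V. form_bound {..<dim_row X} {..<dim_row X} (\<lambda>i j. f (X $$ (i, j)) + g (X $$ (i, j))) (C + C')"
    using C C' by (auto intro: form_bound_add)
  then show "(\<lambda>x. f x + g x) \<in> carrier H"
    using f g unfolding mem_H by (subst bi[OF sq]) (auto intro: fd_add)
qed (auto simp: Hinf_cb_def)

sublocale H: test_space H "matrix_unit_ball V" by (rule H_test)

definition tests :: "('v \<Rightarrow> complex) mat set" where
  "tests = (\<Union>m\<in>{0<..}. {F \<in> Mat_over m H. mnorm H F \<le> 1})"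

lemma mem_tests: "F \<in> tests \<longleftrightarrow> (\<exists>m>0. F \<in> Mat_over m H \<and> mnorm H F \<le> 1)"
  by (auto simp: tests_def)

lemmas mem_D = mem_dual_iff[of H, OF H.vnorm_nonneg]

lemma D_add: "\<phi> \<in> carrier D \<Longrightarrow> f \<in> carrier H \<Longrightarrow> g \<in> carrier H \<Longrightarrow> \<phi> (\<lambda>x. f x + g x) = \<phi> f + \<phi> g"
  using dual_add[of \<phi> H f g] unfolding plus_fun_def by simp

lemma D_scale: "\<phi> \<in> carrier D \<Longrightarrow> f \<in> carrier H \<Longrightarrow> \<phi> (\<lambda>x. c * f x) = c * \<phi> f"
  using dual_scale[of \<phi> H f c] unfolding H.cscale_def by simp

lemma D_zero: "\<phi> \<in> carrier D \<Longrightarrow> \<phi> (\<lambda>x. 0) = 0"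
  using D_scale[OF _ H.zero_closed, of \<phi> 0] by simp

lemma D_sum: "\<phi> \<in> carrier D \<Longrightarrow> (\<And>s. s \<in> S \<Longrightarrow> f s \<in> carrier H) \<Longrightarrow>
  \<phi> (\<lambda>x. \<Sum>s\<in>S. f s x) = (\<Sum>s\<in>S. \<phi> (f s))"
proof (induction S rule: infinite_finite_induct)
  case (insert s S)
  have "(\<lambda>x. \<Sum>s\<in>S. f s x) \<in> carrier H" using insert.prems by (intro H.sum_closed) auto
  then show ?case using insert D_add[of \<phi> "f s" "\<lambda>x. \<Sum>s\<in>S. f s x"] by simp
qed (simp_all add: D_zero)

lemma D_contract:
  assumes \<phi>: "\<phi> \<in> carrier D" and F: "F \<in> Mat_over m H"
  shows "\<phi> (\<lambda>x. \<Sum>i<m. \<Sum>j<m. w i * (F $$ (i, j)) x * v j) = (\<Sum>i<m. \<Sum>j<m. w i * \<phi> (F $$ (i, j)) * v j)"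
proof -
  have "(\<lambda>x. \<Sum>i<m. \<Sum>j<m. w i * (F $$ (i, j)) x * v j) = (\<lambda>x. \<Sum>i<m. \<Sum>j<m. (w i * v j) * (F $$ (i, j)) x)"
    by (simp add: mult_ac)
  then have "\<phi> (\<lambda>x. \<Sum>i<m. \<Sum>j<m. w i * (F $$ (i, j)) x * v j) =
    \<phi> (\<lambda>x. \<Sum>i<m. \<Sum>j<m. (w i * v j) * (F $$ (i, j)) x)" by simp
  also have "\<dots> = (\<Sum>i<m. \<phi> (\<lambda>x. \<Sum>j<m. (w i * v j) * (F $$ (i, j)) x))"
    using Mat_overD(2)[OF F] by (intro D_sum[OF \<phi>] H.sum_closed H.scale_closed) auto
  also have "\<dots> = (\<Sum>i<m. \<Sum>j<m. \<phi> (\<lambda>x. (w i * v j) * (F $$ (i, j)) x))"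
    using Mat_overD(2)[OF F] by (intro sum.cong refl D_sum[OF \<phi>] H.scale_closed) auto
  also have "\<dots> = (\<Sum>i<m. \<Sum>j<m. w i * \<phi> (F $$ (i, j)) * v j)"
    using Mat_overD(2)[OF F] by (intro sum.cong refl) (subst D_scale[OF \<phi>], auto simp: mult_ac)
  finally show ?thesis .
qed

text \<open>Compressing a test matrix by vectors reduces complete boundedness of a functional to boundedness.\<close>

lemma D_form_bound:
  assumes \<phi>: "\<phi> \<in> carrier D" and F: "F \<in> Mat_over m H" "mnorm H F \<le> 1"
    and C: "0 \<le> C" "\<And>f. f \<in> carrier H \<Longrightarrow> vnorm H f \<le> 1 \<Longrightarrow> cmod (\<phi> f) \<le> C"
  shows "form_bound {..<m} {..<m} (\<lambda>i j. \<phi> (F $$ (i, j))) C"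
proof (rule form_boundI[OF C(1)])
  fix w v :: "nat \<Rightarrow> complex"
  have bnd: "cmod (\<phi> f) \<le> C * t" if f: "f \<in> carrier H" "vnorm H f \<le> t" "0 < t" for f t
  proof -
    have "vnorm H (\<lambda>x. complex_of_real (1 / t) * f x) \<le> 1"
      using f by (subst H.vnorm_scale) (auto simp: norm_divide)
    from C(2)[OF H.scale_closed[OF f(1)] this]
    have "cmod (complex_of_real (1 / t) * \<phi> f) \<le> C" using D_scale[OF \<phi> f(1)] by metis
    then show ?thesis using f(3) by (simp add: norm_mult norm_divide field_simps)
  qed
  let ?f = "\<lambda>x. \<Sum>i<m. \<Sum>j<m. w i * (F $$ (i, j)) x * v j" and ?t = "l2 {..<m} w * l2 {..<m} v"
  have t0: "0 \<le> ?t" by (simp add: L2_set_nonneg)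
  have "vnorm H ?f \<le> mnorm H F * l2 {..<m} w * l2 {..<m} v" by (rule H.vnorm_contract[OF F(1)])
  also have "\<dots> \<le> ?t" using F(2) t0 H.mnorm_nonneg[OF F(1)]
    by (simp add: mult_left_le_one_le mult.assoc)
  finally have nf: "vnorm H ?f \<le> ?t" .
  have "cmod (\<phi> ?f) \<le> C * ?t"
  \<comment> \<open>\<open>bnd\<close> divides by its bound, and \<open>?t\<close> may vanish; hence
    the detour through positive slack. The \<open>+ 1\<close> in the divisor covers
    \<open>C = 0\<close>.\<close>
  proof (rule field_le_epsilon)
    fix e :: real assume "e > 0"
    then have "e / (C + 1) > 0" using C(1) by simp
    then have "cmod (\<phi> ?f) \<le> C * (?t + e / (C + 1))"
      using nf add_nonneg_pos[OF t0] by (intro bnd H.contract_closed[OF F(1)]) auto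
    also have "\<dots> \<le> C * ?t + e" using C(1) \<open>e > 0\<close> by (simp add: field_simps)
    finally show "cmod (\<phi> ?f) \<le> C * ?t + e" .
  qed
  then show "cmod (\<Sum>i<m. \<Sum>j<m. w i * \<phi> (F $$ (i, j)) * v j) \<le> C * l2 {..<m} w * l2 {..<m} v"
    unfolding D_contract[OF \<phi> F(1)] by (simp add: mult.assoc)
qed

lemma D_test: "test_space D tests"
proof
  fix F assume "F \<in> tests"
  then show "F \<in> carrier_mat (dim_row F) (dim_row F)"
    unfolding mem_tests Mat_over_def by auto
next
  have "Matrix.mat 1 1 (\<lambda>_. \<lambda>x. 0) \<in> tests"
    unfolding mem_tests using H.single_Mat[OF H.zero_closed] H.vnorm_zero
    by (intro exI[of _ 1]) (auto simp: vnorm_def)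
  then show "tests \<noteq> {}" by blast
next
  fix \<phi> assume \<phi>: "\<phi> \<in> carrier D"
  then obtain K where K: "K \<ge> 0" "\<And>f. f \<in> carrier H \<Longrightarrow> cmod (\<phi> f) \<le> K * vnorm H f"
    using dual_boundedE[OF H.vnorm_nonneg] by metis
  show "bdd_above ((\<lambda>F. op_norm (map_mat \<phi> F)) ` tests)"
  proof (rule bdd_aboveI2)
    fix F assume "F \<in> tests"
    then obtain m where F: "F \<in> Mat_over m H" "mnorm H F \<le> 1" unfolding mem_tests by blast
    show "op_norm (map_mat \<phi> F) \<le> K"
      unfolding op_norm_map_mat_le_iff[OF Mat_overD(1)[OF F(1)]]
    proof (rule D_form_bound[OF \<phi> F K(1)])
      fix f assume "f \<in> carrier H" "vnorm H f \<le> 1"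
      then show "cmod (\<phi> f) \<le> K" using K by (meson mult_left_le order_trans)
    qed
  qed
next
  show "mnorm D = (\<lambda>F. SUP X\<in>tests. op_norm (mat_apply F X))" "cscale D = (\<lambda>c f x. c * f x)"
    by (simp_all add: dual_os_def tests_def)
qed (rule dual_closed[OF H.vnorm_nonneg]; assumption)+

sublocale D: test_space D tests by (rule D_test)

text \<open>For a scalar functional the norm and the completely bounded norm agree:
  \<open>D_form_bound\<close> upgrades a bound on functions to one on all test matrices.\<close>

lemma D_vnorm_leI:
  assumes "\<phi> \<in> carrier D" "0 \<le> C" "\<And>f. f \<in> carrier H \<Longrightarrow> vnorm H f \<le> 1 \<Longrightarrow> cmod (\<phi> f) \<le> C"
  shows "vnorm D \<phi> \<le> C"
proof (rule D.vnorm_leI)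
  fix F p assume "F \<in> tests" "F \<in> carrier_mat p p"
  then have "F \<in> Mat_over p H" "mnorm H F \<le> 1" unfolding mem_tests by (auto simp: Mat_over_def)
  then show "form_bound {..<p} {..<p} (\<lambda>i j. \<phi> (F $$ (i, j))) C"
    using assms by (intro D_form_bound) auto
qed

lemma D_le_vnorm:
  assumes "\<phi> \<in> carrier D" "f \<in> carrier H" "vnorm H f \<le> 1"
  shows "cmod (\<phi> f) \<le> vnorm D \<phi>"
proof -
  have "Matrix.mat 1 1 (\<lambda>_. f) \<in> tests"
    unfolding mem_tests using H.single_Mat[OF assms(2)] assms(3) by (auto simp: vnorm_def intro!: exI[of _ 1])
  from form_bound_entry[OF D.vnorm_form[OF assms(1) this], of 1 0 0] show ?thesis by simp
qed

lemma H_cmod_le: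
  assumes "f \<in> carrier H" "x \<in> B"
  shows "cmod (f x) \<le> vnorm H f"
  using form_bound_entry[OF H.vnorm_form[OF assms(1) single_mub[OF assms(2)]], of 1 0 0] by simp

lemma delta_D:
  assumes x: "x \<in> B"
  shows "eval_at V x \<in> carrier D"
proof (rule iffD2[OF mem_D], assumption, intro conjI allI ballI impI)
  show "\<exists>K\<ge>0. \<forall>f\<in>carrier H. cmod (eval_at V x f) \<le> K * vnorm H f"
    using H_cmod_le[OF _ x] by (intro exI[of _ 1]) (simp add: eval_at_def)
  fix f g assume "f \<in> carrier H" "g \<in> carrier H"
  then show "eval_at V x (f + g) = eval_at V x f + eval_at V x g"
    using H.add_closed[of f g] by (simp add: eval_at_def plus_fun_def)
next
  fix c f assume "f \<in> carrier H"
  then show "eval_at V x (cscale H c f) = c * eval_at V x f"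
    using H.scale_closed[of f c] by (simp add: eval_at_def H.cscale_def)
qed (simp add: eval_at_def)

end

section \<open>Holomorphic functions on an operator space\<close>

text \<open>\<open>g\<close> need not extend to the closed disc, so the Cauchy inequality is applied
  on radii \<open>r < 1\<close>, and \<open>r\<close> then tends to 1.\<close>

lemma taylor_coeff_bound:
  assumes g: "g holomorphic_on ball 0 1" and M: "\<And>z. cmod z < 1 \<Longrightarrow> cmod (g z) \<le> M"
  shows "cmod ((deriv ^^ n) g 0 / fact n) \<le> M"
proof -
  let ?a = "cmod ((deriv ^^ n) g 0 / fact n)"
  have le: "?a * r ^ n \<le> M" if r: "0 < r" "r < 1" for r :: real
  proof -
    have "cmod ((deriv ^^ n) g 0) \<le> fact n * M / r ^ n"
    proof (rule Cauchy_inequality)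
      show "g holomorphic_on ball 0 r" using r by (intro holomorphic_on_subset[OF g]) auto
      show "continuous_on (cball 0 r) g"
        using r by (intro holomorphic_on_imp_continuous_on holomorphic_on_subset[OF g]) auto
      show "cmod (g x) \<le> M" if "cmod (0 - x) = r" for x using that r by (intro M) auto
    qed (use r in auto)
    then have "cmod ((deriv ^^ n) g 0) * r ^ n \<le> fact n * M" using r by (simp add: field_simps)
    then show ?thesis by (simp add: norm_divide field_simps)
  qed
  have "((\<lambda>r. ?a * r ^ n) \<longlongrightarrow> ?a * 1 ^ n) (at_left (1::real))"
    by (intro tendsto_intros)
  moreover have "\<forall>\<^sub>F r in at_left (1::real). ?a * r ^ n \<le> M"
    using le eventually_at_left[of 0 "1::real"] by (auto intro!: exI[of _ 0])
  ultimately show ?thesis using tendsto_upperbound[OF _ _ trivial_limit_at_left_real] by fastforce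
qed

text \<open>Each coefficient is at most \<open>M\<close> in modulus, so the tail is dominated by a
  geometric series.\<close>

lemma taylor_tail_bound:
  assumes g: "g holomorphic_on ball 0 1" and M: "\<And>z. cmod z < 1 \<Longrightarrow> cmod (g z) \<le> M"
    and z: "cmod z < 1"
  shows "cmod (g z - (\<Sum>i<k. (deriv ^^ i) g 0 / fact i * z ^ i)) \<le> M * cmod z ^ k / (1 - cmod z)"
proof -
  let ?a = "\<lambda>i. (deriv ^^ i) g 0 / fact i"
  have "(\<lambda>i. ?a i * z ^ i) sums g z"
    using holomorphic_power_series[OF g, of z] z by simp
  then have s: "(\<lambda>i. ?a (i + k) * z ^ (i + k)) sums (g z - (\<Sum>i<k. ?a i * z ^ i))"
    by (rule sums_split_initial_segment)
  have "(\<lambda>i. M * cmod z ^ k * cmod z ^ i) sums (M * cmod z ^ k * (1 / (1 - cmod z)))"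
    using z by (intro sums_mult geometric_sums) auto
  moreover have "cmod (?a (i + k) * z ^ (i + k)) \<le> M * cmod z ^ k * cmod z ^ i" for i
  proof -
    have "cmod (?a (i + k) * z ^ (i + k)) = cmod (?a (i + k)) * (cmod z ^ k * cmod z ^ i)"
      by (simp add: norm_mult norm_power power_add mult_ac norm_divide)
    also have "\<dots> \<le> M * (cmod z ^ k * cmod z ^ i)"
      by (intro mult_right_mono taylor_coeff_bound[OF g M]) auto
    finally show "cmod (?a (i + k) * z ^ (i + k)) \<le> M * cmod z ^ k * cmod z ^ i" by (simp add: mult_ac)
  qed
  ultimately have "cmod (g z - (\<Sum>i<k. ?a i * z ^ i)) \<le> M * cmod z ^ k * (1 / (1 - cmod z))"
    by (rule norm_sums_le[OF s])
  then show ?thesis by simp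
qed

context op_space
begin

lemma frechet_line:
  assumes L: "L \<in> carrier (dual_os V)"
    "\<And>e. e > 0 \<Longrightarrow> \<exists>d>0. \<forall>h \<in> carrier V. nv h < d \<longrightarrow> cmod (f (x + h) - f x - L h) \<le> e * nv h"
    and h: "h \<in> carrier V"
  shows "((\<lambda>l. f (x + l \<cdot> h)) has_field_derivative L h) (at 0)"
  unfolding DERIV_def LIM_def
proof (intro allI impI)
  fix e :: real assume e: "e > 0"
  \<comment> \<open>The \<open>+ 1\<close> keeps the divisor positive when \<open>h\<close> is
    zero.\<close>
  define n where "n = nv h + 1"
  have n: "n > 0" "nv h < n" using h by (auto simp: n_def add_nonneg_pos)
  obtain d where d: "d > 0" "\<And>h. h \<in> carrier V \<Longrightarrow> nv h < d \<Longrightarrow> cmod (f (x + h) - f x - L h) \<le> e / (2 * n) * nv h"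
    using L(2)[of "e / (2 * n)"] e n by auto
  show "\<exists>s>0. \<forall>l. l \<noteq> 0 \<and> dist l 0 < s \<longrightarrow>
    dist ((f (x + (0 + l) \<cdot> h) - f (x + 0 \<cdot> h)) / l) (L h) < e"
  proof (intro exI[of _ "d / n"] conjI allI impI)
    fix l :: complex assume l: "l \<noteq> 0 \<and> dist l 0 < d / n"
    have "cmod l * nv h \<le> cmod l * n" using n by (intro mult_left_mono) auto
    also have "\<dots> < d" using l n by (simp add: field_simps)
    finally have "nv (l \<cdot> h) < d" using h by (simp add: nv_scale)
    from d(2)[OF scale_mem[OF h] this]
    have le: "cmod (f (x + l \<cdot> h) - f x - l * L h) \<le> e / (2 * n) * (cmod l * nv h)"
      using h dual_scale[OF L(1) h] by (simp add: nv_scale)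
    have "dist ((f (x + l \<cdot> h) - f x) / l) (L h) = cmod ((f (x + l \<cdot> h) - f x - l * L h) / l)"
      using l by (simp add: dist_norm diff_divide_distrib)
    also have "\<dots> \<le> e / (2 * n) * nv h"
      using le l by (simp add: norm_divide field_simps)
    also have "\<dots> \<le> e / (2 * n) * n" using n e by (intro mult_left_mono) auto
    also have "\<dots> < e" using n e by simp
    finally show "dist ((f (x + (0 + l) \<cdot> h) - f (x + 0 \<cdot> h)) / l) (L h) < e" by simp
  qed (use d n in auto)
qed

text \<open>Reduces Frechet differentiability to one complex variable, where Cauchy's estimates are
  available. The derivative at \<open>l\<close> comes from \<open>frechet_line\<close> with base
  point \<open>x + l \<cdot> h\<close>.\<close>

lemma fd_line_holomorphic:
  assumes U: "open U" "\<And>l. l \<in> U \<Longrightarrow> fd f (x + l \<cdot> h)" and h: "h \<in> carrier V"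
  shows "(\<lambda>l. f (x + l \<cdot> h)) holomorphic_on U"
proof -
  have "(\<lambda>l. f (x + l \<cdot> h)) field_differentiable at l within U" if l: "l \<in> U" for l
  proof -
    obtain L where L: "L \<in> carrier (dual_os V)"
      "\<And>e. e > 0 \<Longrightarrow> \<exists>d>0. \<forall>k \<in> carrier V. nv k < d \<longrightarrow>
        cmod (f (x + l \<cdot> h + k) - f (x + l \<cdot> h) - L k) \<le> e * nv k"
      using U(2)[OF l] unfolding frechet_differentiable_at_def by blast
    have "((\<lambda>m. f (x + l \<cdot> h + m \<cdot> h)) has_field_derivative L h) (at 0)"
      by (rule frechet_line[OF L h])
    then have "((\<lambda>m. f (x + l \<cdot> h + (m - l) \<cdot> h)) has_field_derivative L h) (at l)"
      using DERIV_shift[of "\<lambda>m. f (x + l \<cdot> h + (m - l) \<cdot> h)" "L h" 0 l] by simp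
    then show ?thesis
      unfolding field_differentiable_def
      by (auto simp: vs.scale_left_diff_distrib intro: has_field_derivative_at_within)
  qed
  then show ?thesis by (simp add: holomorphic_on_def)
qed

text \<open>A locally uniform limit of Frechet differentiable functions is Frechet differentiable: the
  derivatives converge by Cauchy's estimate on lines, so their limit is again linear.\<close>

lemma fd_limit:
  fixes q :: "nat \<Rightarrow> 'v \<Rightarrow> complex"
  assumes x: "x \<in> carrier V" and \<rho>: "\<rho> > 0"
    and q: "\<And>n y. y \<in> carrier V \<Longrightarrow> nv (y - x) < \<rho> \<Longrightarrow> fd (q n) y"
    and lim: "\<And>e. e > 0 \<Longrightarrow> \<exists>N. \<forall>n\<ge>N. \<forall>y\<in>carrier V. nv (y - x) < \<rho> \<longrightarrow> cmod (q n y - f y) \<le> e"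
    and M: "\<And>y. y \<in> carrier V \<Longrightarrow> nv (y - x) < \<rho> \<Longrightarrow> cmod (f y) \<le> M"
  shows "fd f x"
proof -
  have "\<forall>n. \<exists>L. L \<in> carrier (dual_os V) \<and> (\<forall>e>0. \<exists>d>0. \<forall>h \<in> carrier V. nv h < d \<longrightarrow>
       cmod (q n (x + h) - q n x - L h) \<le> e * nv h)"
    using q[OF x] \<rho> unfolding frechet_differentiable_at_def by (auto simp: Bex_def)
  then obtain L where L: "\<And>n. L n \<in> carrier (dual_os V)"
    "\<And>n e. e > 0 \<Longrightarrow> \<exists>d>0. \<forall>h \<in> carrier V. nv h < d \<longrightarrow> cmod (q n (x + h) - q n x - L n h) \<le> e * nv h"
    by metis
  have near: "x + l \<cdot> h \<in> carrier V" "nv (x + l \<cdot> h - x) < \<rho>"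
    if "h \<in> carrier V" "nv h < \<rho>" "cmod l < 1" for h l
  proof -
    show "x + l \<cdot> h \<in> carrier V" using x that by simp
    have "cmod l * nv h \<le> 1 * nv h" using that by (intro mult_right_mono) auto
    then show "nv (x + l \<cdot> h - x) < \<rho>" using that by (simp add: nv_scale)
  qed
  have hol: "(\<lambda>l. q n (x + l \<cdot> h)) holomorphic_on ball 0 1" if "h \<in> carrier V" "nv h < \<rho>" for h n
    using that near by (intro fd_line_holomorphic q) auto
  have der: "((\<lambda>l. q n (x + l \<cdot> h)) has_field_derivative L n h) (at 0)" if "h \<in> carrier V" for h n
    by (rule frechet_line[OF L(1) L(2) that])
  \<comment> \<open>On the unit disc of the line through \<open>x\<close> in direction
    \<open>h\<close>, the functions \<open>q n\<close> and \<open>q m\<close> differ by at most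
    \<open>e + e'\<close>; the first Taylor coefficient inherits this bound.\<close>
  have cauchy: "cmod (L n h - L m h) \<le> e + e'"
    if h: "h \<in> carrier V" "nv h < \<rho>"
      and e: "\<And>y. y \<in> carrier V \<Longrightarrow> nv (y - x) < \<rho> \<Longrightarrow> cmod (q n y - f y) \<le> e"
      and e': "\<And>y. y \<in> carrier V \<Longrightarrow> nv (y - x) < \<rho> \<Longrightarrow> cmod (q m y - f y) \<le> e'"
    for h n m e e'
  proof -
    let ?g = "\<lambda>l. q n (x + l \<cdot> h) - q m (x + l \<cdot> h)"
    have "cmod ((deriv ^^ 1) ?g 0 / fact 1) \<le> e + e'"
    proof (rule taylor_coeff_bound)
      show "?g holomorphic_on ball 0 1" by (intro holomorphic_intros hol h)
      fix z :: complex assume z: "cmod z < 1"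
      have "cmod ((q n (x + z \<cdot> h) - f (x + z \<cdot> h)) - (q m (x + z \<cdot> h) - f (x + z \<cdot> h))) \<le> e + e'"
        by (rule order_trans[OF norm_triangle_ineq4]) (intro add_mono e e' near h z)
      then show "cmod (?g z) \<le> e + e'" by simp
    qed
    moreover have "deriv ?g 0 = L n h - L m h"
      by (intro DERIV_imp_deriv DERIV_diff der h)
    ultimately show ?thesis by simp
  qed
  have conv_small: "convergent (\<lambda>n. L n h)" if h: "h \<in> carrier V" "nv h < \<rho>" for h
  proof -
    have "Cauchy (\<lambda>n. L n h)"
    proof (rule metric_CauchyI)
      fix e :: real assume "e > 0"
      then have "e / 3 > 0" by simp
      then obtain N where N: "\<And>n y. n \<ge> N \<Longrightarrow> y \<in> carrier V \<Longrightarrow> nv (y - x) < \<rho> \<Longrightarrow> cmod (q n y - f y) \<le> e / 3"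
        using lim by blast
      have "dist (L m h) (L n h) < e" if "m \<ge> N" "n \<ge> N" for m n
        using cauchy[OF h N[OF that(1)] N[OF that(2)]] \<open>e > 0\<close> by (simp add: dist_norm)
      then show "\<exists>N. \<forall>m\<ge>N. \<forall>n\<ge>N. dist (L m h) (L n h) < e" by blast
    qed
    then show ?thesis by (simp add: Cauchy_convergent_iff)
  qed
  \<comment> \<open>The derivatives are linear, so an arbitrary direction is first scaled into the
    ball of radius \<open>\<rho>\<close>.\<close>
  have conv: "convergent (\<lambda>n. L n h)" if h: "h \<in> carrier V" for h
  proof -
    define t where "t = \<rho> / (nv h + 1)"
    have t: "t > 0" using \<rho> h by (simp add: t_def add_nonneg_pos)
    have "t * nv h < t * (nv h + 1)" using t by simp
    also have "\<dots> = \<rho>" using nv_nonneg[OF h] by (simp add: t_def)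
    finally have "nv (of_real t \<cdot> h) < \<rho>" using t h by (simp add: nv_scale)
    then have "convergent (\<lambda>n. of_real (1 / t) * L n (of_real t \<cdot> h))"
      using conv_small h by (intro convergent_mult convergent_const) auto
    then show ?thesis using t dual_scale[OF L(1) h] by simp
  qed
  define L0 where "L0 h = lim (\<lambda>n. L n h)" for h
  have L0: "(\<lambda>n. L n h) \<longlonglongrightarrow> L0 h" if "h \<in> carrier V" for h
    using conv[OF that] by (simp add: L0_def convergent_LIMSEQ_iff)
  obtain N where N: "\<And>n y. n \<ge> N \<Longrightarrow> y \<in> carrier V \<Longrightarrow> nv (y - x) < \<rho> \<Longrightarrow> cmod (q n y - f y) \<le> 1"
    using lim[of 1] by auto
  define M' where "M' = M + 1"
  have M': "cmod (q n y) \<le> M'" if "n \<ge> N" "y \<in> carrier V" "nv (y - x) < \<rho>" for n y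
    using N[OF that] M[OF that(2,3)] norm_triangle_ineq2[of "q n y" "f y"] by (simp add: M'_def)
  have M'0: "M' \<ge> 0" using M'[OF order_refl x] \<rho> norm_ge_zero by (simp add: order_trans[OF norm_ge_zero])
  have qlim: "(\<lambda>n. q n y) \<longlonglongrightarrow> f y" if "y \<in> carrier V" "nv (y - x) < \<rho>" for y
  proof (rule metric_LIMSEQ_I)
    fix e :: real assume "e > 0"
    then obtain N where "\<forall>n\<ge>N. \<forall>y\<in>carrier V. nv (y - x) < \<rho> \<longrightarrow> cmod (q n y - f y) \<le> e / 2"
      using lim[of "e / 2"] by auto
    then have "\<forall>n\<ge>N. dist (q n y) (f y) < e" using that \<open>e > 0\<close> by (fastforce simp: dist_norm)
    then show "\<exists>N. \<forall>n\<ge>N. dist (q n y) (f y) < e" by blast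
  qed
  have L0_bound: "cmod (L0 h) \<le> M'" if h: "h \<in> carrier V" "nv h < \<rho>" for h
  proof (rule LIMSEQ_le_const2)
    show "(\<lambda>n. cmod (L n h)) \<longlonglongrightarrow> cmod (L0 h)" by (intro tendsto_intros L0 h)
    have "cmod (L n h) \<le> M'" if "n \<ge> N" for n
    proof -
      have "cmod ((deriv ^^ 1) (\<lambda>l. q n (x + l \<cdot> h)) 0 / fact 1) \<le> M'"
        by (rule taylor_coeff_bound[OF hol[OF h]]) (intro M' that near h)
      then show ?thesis using DERIV_imp_deriv[OF der[OF h(1)]] by simp
    qed
    then show "\<exists>N. \<forall>n\<ge>N. cmod (L n h) \<le> M'" by blast
  qed
  \<comment> \<open>The second-order remainder of \<open>q n\<close> is bounded independently of
    \<open>n\<close> and therefore survives the limit.\<close>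
  have rem: "cmod (f (x + z \<cdot> h) - f x - z * L0 h) \<le> M' * cmod z ^ 2 / (1 - cmod z)"
    if h: "h \<in> carrier V" "nv h < \<rho>" and z: "cmod z < 1" for h z
  proof (rule LIMSEQ_le_const2)
    show "(\<lambda>n. cmod (q n (x + z \<cdot> h) - q n x - z * L n h)) \<longlonglongrightarrow> cmod (f (x + z \<cdot> h) - f x - z * L0 h)"
      using x \<rho> by (intro tendsto_intros qlim L0 near h z) auto
    have "cmod (q n (x + z \<cdot> h) - q n x - z * L n h) \<le> M' * cmod z ^ 2 / (1 - cmod z)" if "n \<ge> N" for n
    proof -
      have "cmod (q n (x + z \<cdot> h) - (\<Sum>i<2. (deriv ^^ i) (\<lambda>l. q n (x + l \<cdot> h)) 0 / fact i * z ^ i))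
        \<le> M' * cmod z ^ 2 / (1 - cmod z)"
        by (rule taylor_tail_bound[OF hol[OF h]]) (intro M' that near h | rule z | assumption)+
      then show ?thesis using DERIV_imp_deriv[OF der[OF h(1), of n]]
        by (simp add: numeral_2_eq_2 algebra_simps)
    qed
    then show "\<exists>N. \<forall>n\<ge>N. cmod (q n (x + z \<cdot> h) - q n x - z * L n h) \<le> M' * cmod z ^ 2 / (1 - cmod z)" by blast
  qed
  have L0_scale: "L0 (c \<cdot> h) = c * L0 h" if h: "h \<in> carrier V" for c h
    by (rule LIMSEQ_unique[OF L0[OF scale_mem[OF h]]])
      (simp add: dual_scale[OF L(1) h] tendsto_mult_left[OF L0[OF h]])
  have L0_dual: "L0 \<in> carrier (dual_os V)"
  proof (rule iffD2[OF mem_dual_iff[of V, OF nv_nonneg]], assumption, intro conjI allI ballI impI)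
    fix h k assume hk: "h \<in> carrier V" "k \<in> carrier V"
    show "L0 (h + k) = L0 h + L0 k"
      by (rule LIMSEQ_unique[OF L0[OF add_mem[OF hk]]])
        (simp add: dual_add[OF L(1) hk] tendsto_add[OF L0[OF hk(1)] L0[OF hk(2)]])
  next
    show "\<exists>K\<ge>0. \<forall>h\<in>carrier V. cmod (L0 h) \<le> K * nv h"
    proof (intro exI[of _ "2 * M' / \<rho>"] conjI ballI)
      fix h assume h: "h \<in> carrier V"
      show "cmod (L0 h) \<le> 2 * M' / \<rho> * nv h"
      proof (cases "nv h = 0")
        case True
        then have "h = 0" using h nv_zero_iff by simp
        then show ?thesis using L0_scale[OF h, of 0] True by simp
      next
        case False
        then have n: "nv h > 0" using nv_nonneg[OF h] by linarith
        let ?t = "\<rho> / (2 * nv h)"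
        have "nv (of_real ?t \<cdot> h) < \<rho>" using n \<rho> h by (simp add: nv_scale norm_divide norm_mult)
        from L0_bound[OF scale_mem[OF h] this] have "cmod (of_real ?t * L0 h) \<le> M'"
          unfolding L0_scale[OF h] .
        then have "?t * cmod (L0 h) \<le> M'" using n \<rho> by (simp add: norm_mult norm_divide)
        then show ?thesis using n \<rho> by (simp add: field_simps)
      qed
    qed (use M'0 \<rho> in auto)
  next
    fix h assume "h \<notin> carrier V"
    then have "L n h = 0" for n using dual_outside[OF L(1)] by blast
    then show "L0 h = 0" unfolding L0_def by simp
  qed (rule L0_scale)
  show ?thesis unfolding frechet_differentiable_at_def
  proof (intro bexI[OF _ L0_dual] allI impI)
    fix e :: real assume e: "e > 0"
    \<comment> \<open>With \<open>z = 2 * nv h / \<rho>\<close> the remainder is at most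
      \<open>2 * M' * z ^ 2\<close>, that is
      \<open>8 * M' * (nv h)\<^sup>2 / \<rho>\<^sup>2\<close>. The second entry makes this at most
      \<open>e * nv h\<close>; the first gives \<open>z \<le> 1 / 2\<close>.\<close>
    define d where "d = min (\<rho> / 4) (e * \<rho>\<^sup>2 / (8 * (M' + 1)))"
    have "e * \<rho>\<^sup>2 / (8 * (M' + 1)) > 0" using e \<rho> M'0 by (intro divide_pos_pos mult_pos_pos) auto
    then have d: "d > 0" "d \<le> \<rho> / 4" "d \<le> e * \<rho>\<^sup>2 / (8 * (M' + 1))"
      unfolding d_def using \<rho> by (simp_all only: min_less_iff_conj min.cobounded1 min.cobounded2) simp
    show "\<exists>d>0. \<forall>h\<in>carrier V. nv h < d \<longrightarrow> cmod (f (x + h) - f x - L0 h) \<le> e * nv h"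
    proof (intro exI[of _ d] conjI ballI impI d)
      fix h assume h: "h \<in> carrier V" "nv h < d"
      show "cmod (f (x + h) - f x - L0 h) \<le> e * nv h"
      proof (cases "nv h = 0")
        case True
        then have "h = 0" using h nv_zero_iff by simp
        then show ?thesis using L0_scale[OF h(1), of 0] True by simp
      next
        case False
        then have n: "nv h > 0" using nv_nonneg[OF h(1)] by linarith
        \<comment> \<open>With this choice \<open>h\<close> divided by \<open>z\<close> has norm
          \<open>\<rho> / 2\<close>, so \<open>rem\<close> applies to that direction at the
          parameter \<open>z\<close>.\<close>
        define z where "z = 2 * nv h / \<rho>"
        have z: "0 < z" "z \<le> 1 / 2" using n \<rho> h(2) d(2) by (auto simp: z_def field_simps)
        have "nv (of_real (1 / z) \<cdot> h) < \<rho>" using n \<rho> h(1) by (simp add: nv_scale z_def norm_divide norm_mult)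
        from rem[OF scale_mem[OF h(1)] this, of "of_real z"]
        have "cmod (f (x + h) - f x - L0 h) \<le> M' * z ^ 2 / (1 - z)"
          using z by (simp add: L0_scale[OF h(1)] norm_mult)
        also have "\<dots> \<le> M' * z ^ 2 / (1 / 2)"
          using z M'0 by (intro divide_left_mono) auto
        also have "\<dots> = nv h * (8 * M' / \<rho>\<^sup>2 * nv h)" using \<rho> by (simp add: z_def power2_eq_square)
        also have "\<dots> \<le> nv h * e"
        proof (intro mult_left_mono)
          have "8 * M' / \<rho>\<^sup>2 * nv h \<le> 8 * (M' + 1) / \<rho>\<^sup>2 * (e * \<rho>\<^sup>2 / (8 * (M' + 1)))"
            using h(2) d(3) M'0 \<rho> n by (intro mult_mono divide_right_mono) auto
          also have "\<dots> = e"
          proof -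
            have "a / b * (e * b / a) = e" if "a \<noteq> 0" "b \<noteq> 0" for a b :: real using that by simp
            then show ?thesis using M'0 \<rho> by simp
          qed
          finally show "8 * M' / \<rho>\<^sup>2 * nv h \<le> e" .
        qed (use n in auto)
        finally show ?thesis by (simp add: mult.commute)
      qed
    qed
  qed
qed

end

section \<open>Taylor coefficients\<close>

context op_space
begin

text \<open>The homogeneous part of degree \<open>j\<close> of the Taylor expansion at the origin,
  read off along the line through \<open>x\<close>. Only small multiples of \<open>x\<close> matter,
  so it is meaningful on the whole of \<open>V\<close> although \<open>f\<close> is cut off outside
  the ball.\<close>

definition homog_part :: "nat \<Rightarrow> ('v \<Rightarrow> complex) \<Rightarrow> 'v \<Rightarrow> complex" where
  "homog_part j f x = (deriv ^^ j) (\<lambda>l. f (l \<cdot> x)) 0 / fact j"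

lemma H_fd: "f \<in> carrier H \<Longrightarrow> x \<in> B \<Longrightarrow> fd f x"
  by (simp add: mem_H)

lemma H_line:
  assumes f: "f \<in> carrier H" and x: "x \<in> carrier V" "nv x < R" and R: "R > 0"
  shows "(\<lambda>l. f (l \<cdot> x)) holomorphic_on ball 0 (1 / R)"
proof -
  have "(\<lambda>l. f (0 + l \<cdot> x)) holomorphic_on ball 0 (1 / R)"
  proof (intro fd_line_holomorphic H_fd f)
    fix l :: complex assume "l \<in> ball 0 (1 / R)"
    then have "cmod l * R < 1" using R by (simp add: field_simps)
    moreover have "cmod l * nv x \<le> cmod l * R" using x by (intro mult_left_mono) auto
    ultimately show "0 + l \<cdot> x \<in> B" using x by (simp add: mem_B nv_scale)
  qed (use x in auto)
  then show ?thesis by simp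
qed

lemma scale_B: "x \<in> B \<Longrightarrow> cmod l \<le> 1 \<Longrightarrow> l \<cdot> x \<in> B"
proof -
  assume x: "x \<in> B" and l: "cmod l \<le> 1"
  have "cmod l * nv x \<le> 1 * nv x" using l x by (intro mult_right_mono) (auto simp: mem_B)
  then show ?thesis using x by (simp add: mem_B nv_scale)
qed

lemma H_line_ball: "f \<in> carrier H \<Longrightarrow> x \<in> B \<Longrightarrow> (\<lambda>l. f (l \<cdot> x)) holomorphic_on ball 0 1"
  using H_line[of f x 1] by (simp add: mem_B)

lemma homog_part_bound_B:
  assumes "f \<in> carrier H" "x \<in> B"
  shows "cmod (homog_part j f x) \<le> vnorm H f"
  unfolding homog_part_def
  by (rule taylor_coeff_bound[OF H_line_ball[OF assms]]) (intro H_cmod_le assms scale_B, simp)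

lemma homog_part_tail_B:
  assumes f: "f \<in> carrier H" and x: "x \<in> B" and z: "cmod z < 1"
  shows "cmod (f (z \<cdot> x) - (\<Sum>i<k. homog_part i f x * z ^ i)) \<le> vnorm H f * cmod z ^ k / (1 - cmod z)"
  unfolding homog_part_def
  by (rule taylor_tail_bound[OF H_line_ball[OF f x] _ z]) (intro H_cmod_le f x scale_B, simp)

lemma homog_part_scale:
  assumes f: "f \<in> carrier H" and x: "x \<in> carrier V"
  shows "homog_part j f (c \<cdot> x) = c ^ j * homog_part j f x"
proof -
  define R where "R = nv x + 1"
  have R: "R > 0" "nv x < R" using x by (auto simp: R_def add_nonneg_pos)
  have "(deriv ^^ j) (\<lambda>w. f ((c * w) \<cdot> x)) 0 = c ^ j * (deriv ^^ j) (\<lambda>l. f (l \<cdot> x)) (c * 0)"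
  proof (rule higher_deriv_compose_linear[OF H_line[OF f x R(2,1)]])
    show "open ((\<lambda>w. c * w) -` ball 0 (1 / R))"
      by (intro continuous_open_vimage continuous_intros) auto
  qed (use R in auto)
  then show ?thesis by (simp add: homog_part_def mult.commute)
qed

text \<open>Homogeneity transfers the estimate on the ball to \<open>x\<close>; the strict
  inequality puts \<open>x\<close> divided by \<open>R\<close> in the open ball.\<close>

lemma homog_part_bound:
  assumes f: "f \<in> carrier H" and x: "x \<in> carrier V" "nv x < R"
  shows "cmod (homog_part j f x) \<le> R ^ j * vnorm H f"
proof -
  have R: "R > 0" using nv_nonneg[OF x(1)] x(2) by linarith
  define y where "y = of_real (1 / R) \<cdot> x"
  have y: "y \<in> B" "x = of_real R \<cdot> y" using x R by (simp_all add: y_def mem_B nv_scale norm_divide)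
  have "cmod (homog_part j f x) = R ^ j * cmod (homog_part j f y)"
    unfolding y(2) using f y(1) R by (subst homog_part_scale) (auto simp: norm_mult norm_power mem_B)
  then show ?thesis using R homog_part_bound_B[OF f y(1)] by simp
qed

lemma homog_part_tail:
  assumes f: "f \<in> carrier H" and x: "x \<in> carrier V" "nv x < R" and z: "cmod z * R < 1"
  shows "cmod (f (z \<cdot> x) - (\<Sum>i<k. homog_part i f x * z ^ i)) \<le> vnorm H f * (cmod z * R) ^ k / (1 - cmod z * R)"
proof -
  have R: "R > 0" using nv_nonneg[OF x(1)] x(2) by linarith
  define y where "y = of_real (1 / R) \<cdot> x"
  have y: "y \<in> B" "x = of_real R \<cdot> y" using x R by (simp_all add: y_def mem_B nv_scale norm_divide)
  have yV: "y \<in> carrier V" using y by (simp add: mem_B)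
  have c: "cmod (z * of_real R) = cmod z * R" using R by (simp add: norm_mult)
  have "cmod (f ((z * of_real R) \<cdot> y) - (\<Sum>i<k. homog_part i f y * (z * of_real R) ^ i))
    \<le> vnorm H f * cmod (z * of_real R) ^ k / (1 - cmod (z * of_real R))"
    using z c by (intro homog_part_tail_B f y) simp
  then show ?thesis
    unfolding c unfolding y(2) by (simp add: homog_part_scale[OF f yV] power_mult_distrib mult_ac)
qed

lemma homog_part_add:
  assumes f: "f \<in> carrier H" "g \<in> carrier H" and x: "x \<in> carrier V"
  shows "homog_part j (\<lambda>y. f y + g y) x = homog_part j f x + homog_part j g x"
proof -
  define R where "R = nv x + 1"
  have R: "R > 0" "nv x < R" using x by (auto simp: R_def add_nonneg_pos)
  have "(deriv ^^ j) (\<lambda>l. f (l \<cdot> x) + g (l \<cdot> x)) 0 =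
    (deriv ^^ j) (\<lambda>l. f (l \<cdot> x)) 0 + (deriv ^^ j) (\<lambda>l. g (l \<cdot> x)) 0"
    by (rule higher_deriv_add[OF H_line[OF f(1) x R(2,1)] H_line[OF f(2) x R(2,1)]]) (use R in auto)
  then show ?thesis by (simp add: homog_part_def add_divide_distrib)
qed

lemma homog_part_cmult:
  assumes f: "f \<in> carrier H" and x: "x \<in> carrier V"
  shows "homog_part j (\<lambda>y. c * f y) x = c * homog_part j f x"
proof -
  define R where "R = nv x + 1"
  have R: "R > 0" "nv x < R" using x by (auto simp: R_def add_nonneg_pos)
  have "(deriv ^^ j) (\<lambda>l. c * f (l \<cdot> x)) 0 = c * (deriv ^^ j) (\<lambda>l. f (l \<cdot> x)) 0"
    by (rule higher_deriv_cmult[OF H_line[OF f x R(2,1)]]) (use R in auto)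
  then show ?thesis by (simp add: homog_part_def)
qed

text \<open>Recursive recovery of the coefficients: the j-th one is the limit of n^j times the error at x/n
  of the Taylor polynomial formed from the previous ones. This carries differentiability and
  membership in the free space from each coefficient to the next.\<close>

lemma homog_part_quotient:
  assumes f: "f \<in> carrier H" and x: "x \<in> carrier V" "nv x < R" and n: "2 * R < real n"
  shows "cmod (of_nat n ^ j * (f (of_real (1 / n) \<cdot> x) - (\<Sum>i<j. homog_part i f x * of_real (1 / n) ^ i)) - homog_part j f x)
    \<le> vnorm H f * (2 * R ^ Suc j / n)"
proof -
  have R: "R > 0" using nv_nonneg[OF x(1)] x(2) by linarith
  then have n0: "real n > 0" using n by linarith
  define z where "z = complex_of_real (1 / n)"
  have z: "cmod z = 1 / n" "of_nat n * z = 1" using n0 by (auto simp: z_def norm_divide)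
  \<comment> \<open>Then \<open>1 - cmod z * R\<close> is at least 1/2, the source of the factor 2
    in the bound.\<close>
  have zR: "cmod z * R < 1 / 2" using n n0 unfolding z(1) by (simp add: field_simps)
  have tl: "cmod (f (z \<cdot> x) - (\<Sum>i<Suc j. homog_part i f x * z ^ i)) \<le>
    vnorm H f * (cmod z * R) ^ Suc j / (1 - cmod z * R)"
    using zR by (intro homog_part_tail f x) simp
  have nz: "of_nat n ^ j * z ^ j = 1" by (simp add: z flip: power_mult_distrib)
  have eq: "of_nat n ^ j * (f (z \<cdot> x) - (\<Sum>i<j. homog_part i f x * z ^ i)) - homog_part j f x =
    of_nat n ^ j * (f (z \<cdot> x) - (\<Sum>i<Suc j. homog_part i f x * z ^ i))"
    using nz by (simp add: algebra_simps)
  have "cmod (of_nat n ^ j * (f (z \<cdot> x) - (\<Sum>i<j. homog_part i f x * z ^ i)) - homog_part j f x) =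
    real n ^ j * cmod (f (z \<cdot> x) - (\<Sum>i<Suc j. homog_part i f x * z ^ i))"
    unfolding eq by (simp add: norm_mult norm_power)
  also have "\<dots> \<le> real n ^ j * (vnorm H f * (cmod z * R) ^ Suc j / (1 - cmod z * R))"
    by (intro mult_left_mono tl) simp
  also have "\<dots> \<le> real n ^ j * (vnorm H f * (cmod z * R) ^ Suc j / (1 / 2))"
    using zR R H.vnorm_nonneg[OF f] by (intro mult_left_mono divide_left_mono mult_nonneg_nonneg) auto
  also have "\<dots> = vnorm H f * (2 * R ^ Suc j / n)"
    using n0 by (simp add: z(1) power_divide field_simps)
  finally show ?thesis by (simp add: z_def)
qed

lemma fd_compose_scale:
  assumes x: "x \<in> carrier V" and f: "fd f (c \<cdot> x)"
  shows "fd (\<lambda>y. f (c \<cdot> y)) x"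
proof (cases "c = 0")
  case True
  then show ?thesis by (simp add: fd_const)
next
  case False
  obtain L where L: "L \<in> carrier (dual_os V)"
    "\<And>e. e > 0 \<Longrightarrow> \<exists>d>0. \<forall>h \<in> carrier V. nv h < d \<longrightarrow> cmod (f (c \<cdot> x + h) - f (c \<cdot> x) - L h) \<le> e * nv h"
    using f unfolding frechet_differentiable_at_def by blast
  show ?thesis unfolding frechet_differentiable_at_def
  proof (intro bexI[where x = "\<lambda>h. c * L h"] allI impI)
    fix e :: real assume "e > 0"
    then have "e / cmod c > 0" using False by simp
    then obtain d where d: "d > 0" "\<And>h. h \<in> carrier V \<Longrightarrow> nv h < d \<Longrightarrow>
      cmod (f (c \<cdot> x + h) - f (c \<cdot> x) - L h) \<le> e / cmod c * nv h"
      using L(2) by blast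
    show "\<exists>d>0. \<forall>h\<in>carrier V. nv h < d \<longrightarrow> cmod (f (c \<cdot> (x + h)) - f (c \<cdot> x) - c * L h) \<le> e * nv h"
    proof (intro exI[of _ "d / cmod c"] conjI ballI impI)
      fix h assume h: "h \<in> carrier V" "nv h < d / cmod c"
      then have "nv (c \<cdot> h) < d" using False by (simp add: nv_scale field_simps)
      from d(2)[OF scale_mem[OF h(1)] this]
      show "cmod (f (c \<cdot> (x + h)) - f (c \<cdot> x) - c * L h) \<le> e * nv h"
        using False h by (simp add: nv_scale vs.scale_right_distrib dual_scale[OF L(1)])
    qed (use d False in auto)
  qed (rule dual_closed(3)[OF nv_nonneg L(1)])
qed

text \<open>Holomorphy on lines alone does not give a bounded linear derivative. Near
  \<open>x\<close>, however, the part of degree \<open>j\<close> is a uniform limit of combinations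
  of a dilate of \<open>f\<close> and lower parts, so \<open>fd_limit\<close> applies.\<close>

lemma fd_homog_part:
  assumes f: "f \<in> carrier H"
  shows "x \<in> carrier V \<Longrightarrow> fd (homog_part j f) x"
proof (induction j arbitrary: x rule: less_induct)
  case (less j)
  define R where "R = nv x + 2"
  have R: "R > 1" using nv_nonneg[OF less.prems] by (simp add: R_def)
  have nR: "nv y < R" if "y \<in> carrier V" "nv (y - x) < 1" for y
    using nv_triangle[of "y - x" x] that less.prems by (simp add: R_def)
  obtain N :: nat where N: "2 * R < real N" using reals_Archimedean2 by blast
  \<comment> \<open>The shift by \<open>N\<close> places the dilate of every nearby \<open>y\<close>
    in the ball already for \<open>n = 0\<close>.\<close>
  define q where "q n y = of_nat (n + N) ^ j * (f (of_real (1 / real (n + N)) \<cdot> y)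
    - (\<Sum>i<j. homog_part i f y * of_real (1 / real (n + N)) ^ i))" for n y
  have K: "0 \<le> vnorm H f" by (rule H.vnorm_nonneg[OF f])
  show ?case
  proof (rule fd_limit[where q = q and \<rho> = 1 and M = "R ^ j * vnorm H f"])
    fix n y assume y: "y \<in> carrier V" "nv (y - x) < 1"
    have n0: "2 * R < real (n + N)" using N by simp
    have "nv y < real (n + N)" using nR[OF y] n0 R by linarith
    then have yB: "of_real (1 / real (n + N)) \<cdot> y \<in> B"
    proof -
      have "0 < real (n + N)" using R n0 by linarith
      then show ?thesis
        using y(1) \<open>nv y < real (n + N)\<close> by (simp add: mem_B nv_scale norm_divide del: of_nat_add)
    qed
    have "fd (\<lambda>y. of_nat (n + N) ^ j * (f (of_real (1 / real (n + N)) \<cdot> y)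
      + (\<Sum>i<j. (- (of_real (1 / real (n + N)) ^ i)) * homog_part i f y))) y"
      by (intro fd_scale fd_add fd_compose_scale fd_sum H_fd f yB y(1) less.IH) auto
    moreover have "q n = (\<lambda>y. of_nat (n + N) ^ j * (f (of_real (1 / real (n + N)) \<cdot> y)
      + (\<Sum>i<j. (- (of_real (1 / real (n + N)) ^ i)) * homog_part i f y)))"
      by (rule ext) (simp add: q_def sum_negf mult.commute)
    ultimately show "fd (q n) y" by simp
  next
    fix e :: real assume e: "e > 0"
    define C where "C = vnorm H f * (2 * R ^ Suc j)"
    have "(\<lambda>n. C / real (n + N)) \<longlonglongrightarrow> 0"
      using LIMSEQ_ignore_initial_segment[OF lim_const_over_n] by blast
    then obtain N' where N': "\<And>n. n \<ge> N' \<Longrightarrow> \<bar>C / real (n + N)\<bar> < e"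
      using LIMSEQ_D[of _ 0 e] e by force
    have "cmod (q n y - homog_part j f y) \<le> e" if "n \<ge> N'" "y \<in> carrier V" "nv (y - x) < 1" for n y
    proof -
      have "cmod (q n y - homog_part j f y) \<le> vnorm H f * (2 * R ^ Suc j / real (n + N))"
        unfolding q_def using N by (intro homog_part_quotient f that nR) auto
      also have "\<dots> = C / real (n + N)" by (simp add: C_def)
      finally show ?thesis using N'[OF that(1)] by linarith
    qed
    then show "\<exists>N. \<forall>n\<ge>N. \<forall>y\<in>carrier V. nv (y - x) < 1 \<longrightarrow> cmod (q n y - homog_part j f y) \<le> e" by blast
  qed (use less.prems f nR in \<open>auto intro: homog_part_bound\<close>)
qed

text \<open>The homogeneous part of degree \<open>j\<close> of the evaluation map, a polynomial from
  \<open>V\<close> to the free space; \<open>delta_part 1\<close> will be the embedding of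
  \<open>V\<close>. Like every functional on \<open>H\<close> it is extended by zero.\<close>

definition delta_part :: "nat \<Rightarrow> 'v \<Rightarrow> ('v \<Rightarrow> complex) \<Rightarrow> complex" where
  "delta_part j x = (\<lambda>f. if f \<in> carrier H then homog_part j f x else 0)"

lemma delta_part_D:
  assumes x: "x \<in> carrier V"
  shows "delta_part j x \<in> carrier D"
proof (rule iffD2[OF mem_D], assumption, intro conjI allI ballI impI)
  have "nv x + 1 > 0" using nv_nonneg[OF x] by linarith
  moreover have "cmod (delta_part j x f) \<le> (nv x + 1) ^ j * vnorm H f" if "f \<in> carrier H" for f
    using homog_part_bound[OF that x, of "nv x + 1" j] that by (simp add: delta_part_def)
  ultimately show "\<exists>K\<ge>0. \<forall>f\<in>carrier H. cmod (delta_part j x f) \<le> K * vnorm H f"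
    by (intro exI[of _ "(nv x + 1) ^ j"]) auto
  fix f g assume "f \<in> carrier H" "g \<in> carrier H"
  then show "delta_part j x (f + g) = delta_part j x f + delta_part j x g"
    using H.add_closed[of f g] homog_part_add x by (simp add: delta_part_def plus_fun_def)
next
  fix c f assume "f \<in> carrier H"
  then show "delta_part j x (cscale H c f) = c * delta_part j x f"
    using H.scale_closed[of f c] homog_part_cmult x by (simp add: delta_part_def H.cscale_def)
qed (simp add: delta_part_def)

section \<open>The free space as a closed subspace of the dual\<close>

abbreviation G where "G \<equiv> Ginf_cb V"

lemma G_simps [simp]: "cscale G = cscale D" "mnorm G = mnorm D" "vnorm G = vnorm D"
  by (simp_all add: Ginf_cb_def Let_def vnorm_def fun_eq_iff)

abbreviation "dspan \<equiv> Modules.module.span (cscale D) (eval_at V ` B)"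

lemma mem_G: "\<phi> \<in> carrier G \<longleftrightarrow> \<phi> \<in> carrier D \<and> (\<forall>e>0. \<exists>\<psi>\<in>dspan. vnorm D (\<phi> - \<psi>) < e)"
  by (simp add: Ginf_cb_def Let_def)

sublocale ds: vector_space "cscale D" unfolding D.cscale_def by (rule vector_space_fun)

lemma D_subspace: "ds.subspace (carrier D)" by (rule D.subspace)

lemma dspan_D: "\<psi> \<in> dspan \<Longrightarrow> \<psi> \<in> carrier D"
  using ds.span_minimal[OF _ D_subspace, of "eval_at V ` B"] delta_D by blast

lemma D_vnorm_triangle: "\<phi> \<in> carrier D \<Longrightarrow> \<psi> \<in> carrier D \<Longrightarrow> vnorm D (\<phi> + \<psi>) \<le> vnorm D \<phi> + vnorm D \<psi>"
  using D.vnorm_add by (simp add: plus_fun_def)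

lemma D_vnorm_minus: "\<phi> \<in> carrier D \<Longrightarrow> \<psi> \<in> carrier D \<Longrightarrow> vnorm D (\<phi> - \<psi>) = vnorm D (\<psi> - \<phi>)"
  using D.vnorm_minus_commute by (simp add: fun_diff_def)

lemma D_vnorm_scale: "\<phi> \<in> carrier D \<Longrightarrow> vnorm D (cscale D c \<phi>) = cmod c * vnorm D \<phi>"
  using D.vnorm_scale by (simp add: D.cscale_def)

lemmas D_mem = ds.subspace_add[OF D_subspace] ds.subspace_diff[OF D_subspace]
  ds.subspace_scale[OF D_subspace] ds.subspace_0[OF D_subspace]

lemma D_vnorm_0 [simp]: "vnorm D 0 = 0"
  using D.vnorm_zero by (simp add: zero_fun_def)

lemma dspan_G: "\<psi> \<in> dspan \<Longrightarrow> \<psi> \<in> carrier G"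
  using dspan_D by (auto simp: mem_G intro!: bexI[of _ \<psi>])

lemma delta_G: "x \<in> B \<Longrightarrow> eval_at V x \<in> carrier G"
  by (intro dspan_G ds.span_base) auto

lemma G_closed:
  assumes "\<phi> \<in> carrier D" "\<And>e. e > 0 \<Longrightarrow> \<exists>\<psi>\<in>carrier G. vnorm D (\<phi> - \<psi>) < e"
  shows "\<phi> \<in> carrier G"
  unfolding mem_G
proof (intro conjI assms allI impI)
  fix e :: real assume "e > 0"
  then have e: "e / 2 > 0" by simp
  obtain \<psi> where \<psi>: "\<psi> \<in> carrier G" "vnorm D (\<phi> - \<psi>) < e / 2" using assms(2)[OF e] by blast
  obtain \<chi> where \<chi>: "\<chi> \<in> dspan" "vnorm D (\<psi> - \<chi>) < e / 2" using \<psi>(1) e unfolding mem_G by blast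
  have "vnorm D ((\<phi> - \<psi>) + (\<psi> - \<chi>)) \<le> vnorm D (\<phi> - \<psi>) + vnorm D (\<psi> - \<chi>)"
    using assms(1) \<psi>(1) \<chi>(1) dspan_D by (intro D_vnorm_triangle D_mem) (auto simp: mem_G)
  then show "\<exists>\<psi>\<in>dspan. vnorm D (\<phi> - \<psi>) < e" using \<psi> \<chi> by (intro bexI[of _ \<chi>]) auto
qed

lemma G_D: "\<phi> \<in> carrier G \<Longrightarrow> \<phi> \<in> carrier D" by (simp add: mem_G)

lemma G_subspace: "ds.subspace (carrier G)"
proof (rule ds.subspaceI)
  show "0 \<in> carrier G" by (intro dspan_G ds.span_zero)
  fix \<phi> \<psi> assume "\<phi> \<in> carrier G" and \<psi>: "\<psi> \<in> carrier G"
  then have \<phi>: "\<phi> \<in> carrier G" by simp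
  show "\<phi> + \<psi> \<in> carrier G"
  proof (rule G_closed)
    fix e :: real assume "e > 0"
    then have e: "e / 2 > 0" by simp
    obtain \<phi>' where \<phi>': "\<phi>' \<in> dspan" "vnorm D (\<phi> - \<phi>') < e / 2" using \<phi> e unfolding mem_G by blast
    obtain \<psi>' where \<psi>': "\<psi>' \<in> dspan" "vnorm D (\<psi> - \<psi>') < e / 2" using \<psi> e unfolding mem_G by blast
    have "vnorm D ((\<phi> - \<phi>') + (\<psi> - \<psi>')) \<le> vnorm D (\<phi> - \<phi>') + vnorm D (\<psi> - \<psi>')"
      using \<phi> \<psi> \<phi>' \<psi>' dspan_D by (intro D_vnorm_triangle D_mem) (auto simp: mem_G)
    then show "\<exists>\<chi>\<in>carrier G. vnorm D (\<phi> + \<psi> - \<chi>) < e"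
      using \<phi>' \<psi>' by (intro bexI[of _ "\<phi>' + \<psi>'"] dspan_G ds.span_add) (auto simp: algebra_simps)
  qed (intro D_mem G_D \<phi> \<psi>)
next
  fix c \<phi> assume \<phi>: "\<phi> \<in> carrier G"
  show "cscale D c \<phi> \<in> carrier G"
  proof (rule G_closed)
    fix e :: real assume "e > 0"
    then have e: "e / (cmod c + 1) > 0" by (simp add: add_nonneg_pos)
    obtain \<phi>' where \<phi>': "\<phi>' \<in> dspan" "vnorm D (\<phi> - \<phi>') < e / (cmod c + 1)" using \<phi> e unfolding mem_G by blast
    have "vnorm D (cscale D c \<phi> - cscale D c \<phi>') = cmod c * vnorm D (\<phi> - \<phi>')"
      using \<phi> \<phi>' dspan_D by (simp add: D_vnorm_scale D_mem G_D flip: ds.scale_right_diff_distrib)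
    also have "\<dots> \<le> cmod c * (e / (cmod c + 1))" using \<phi>' by (intro mult_left_mono) auto
    also have "\<dots> < (cmod c + 1) * (e / (cmod c + 1))" using e by (intro mult_strict_right_mono) auto
    also have "\<dots> = e"
    proof -
      have "cmod c + 1 \<noteq> 0" using norm_ge_zero[of c] by linarith
      then show ?thesis by simp
    qed
    finally show "\<exists>\<chi>\<in>carrier G. vnorm D (cscale D c \<phi> - \<chi>) < e"
      using \<phi>' by (intro bexI[of _ "cscale D c \<phi>'"] dspan_G ds.span_scale) auto
  qed (intro D_mem G_D \<phi>)
qed

lemmas G_mem = ds.subspace_add[OF G_subspace] ds.subspace_diff[OF G_subspace]
  ds.subspace_scale[OF G_subspace] ds.subspace_0[OF G_subspace] ds.subspace_sum[OF G_subspace]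

text \<open>The bound of \<open>homog_part_quotient\<close> is uniform on the unit ball of
  \<open>H\<close>, hence a norm estimate in \<open>D\<close>: the functional is approximated by
  combinations of one evaluation and parts of lower degree, which belong to \<open>G\<close> by
  induction.\<close>

lemma delta_part_G: "x \<in> carrier V \<Longrightarrow> delta_part j x \<in> carrier G"
proof (induction j arbitrary: x rule: less_induct)
  case (less j)
  note x = less.prems
  define R where "R = nv x + 1"
  have R: "R > 0" "nv x < R" using x by (auto simp: R_def add_nonneg_pos)
  show ?case
  proof (rule G_closed[OF delta_part_D[OF x]])
    fix e :: real assume e: "e > 0"
    define C where "C = 2 * R ^ Suc j"
    have C: "C > 0" using R by (simp add: C_def)
    \<comment> \<open>\<open>2 * R\<close> is what \<open>homog_part_quotient\<close> demands of
      \<open>n\<close>; \<open>C / e\<close> makes the error smaller than \<open>e\<close>.\<close>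
    obtain n where n: "max (2 * R) (C / e) < real n" using reals_Archimedean2 by blast
    then have n0: "2 * R < real n" "C / real n < e" "0 < real n" using R e C
      by (auto simp: field_simps)
    define z where "z = complex_of_real (1 / n)"
    define \<psi> where "\<psi> = cscale D (of_nat n ^ j) (eval_at V (z \<cdot> x) - (\<Sum>i<j. cscale D (z ^ i) (delta_part i x)))"
    have zx: "z \<cdot> x \<in> B" using x R n0 by (simp add: z_def mem_B nv_scale norm_divide)
    have \<psi>: "\<psi> \<in> carrier G" unfolding \<psi>_def
      by (intro G_mem delta_G zx less.IH x) auto
    have "vnorm D (delta_part j x - \<psi>) = vnorm D (\<psi> - delta_part j x)"
      by (intro D_vnorm_minus delta_part_D x G_D \<psi>)
    also have "\<dots> \<le> C / real n"
    proof (rule D_vnorm_leI)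
      show "\<psi> - delta_part j x \<in> carrier D" by (intro D_mem G_D \<psi> delta_part_D x)
      show "0 \<le> C / real n" using C n0 by simp
      fix f assume f: "f \<in> carrier H" "vnorm H f \<le> 1"
      have "(\<psi> - delta_part j x) f = of_nat n ^ j * (f (of_real (1 / n) \<cdot> x) - (\<Sum>i<j. homog_part i f x * of_real (1 / n) ^ i)) - homog_part j f x"
        using f by (simp add: \<psi>_def D.cscale_def sum_fun_apply eval_at_def delta_part_def z_def mult.commute)
      also have "cmod \<dots> \<le> vnorm H f * (2 * R ^ Suc j / n)"
        by (rule homog_part_quotient[OF f(1) x R(2) n0(1)])
      also have "\<dots> \<le> 1 * (2 * R ^ Suc j / n)"
        using f R n0 by (intro mult_right_mono) auto
      finally show "cmod ((\<psi> - delta_part j x) f) \<le> C / real n" by (simp add: C_def)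
    qed
    finally show "\<exists>\<psi>\<in>carrier G. vnorm D (delta_part j x - \<psi>) < e" using \<psi> n0 by force
  qed
qed

end

section \<open>Polynomials on finite-dimensional subspaces\<close>

text \<open>The weights are the Lagrange basis polynomials for the nodes 0, ..., n, evaluated at
  \<open>z\<close>. That they serve all polynomials of degree at most \<open>n\<close> at once is
  what later gives an identity of functionals.\<close>

lemma lagrange_interpolation:
  fixes z :: complex
  obtains w where "\<And>c. (\<Sum>k\<le>n. c k * z ^ k) = (\<Sum>t\<le>n. w t * (\<Sum>k\<le>n. c k * of_nat t ^ k))"
proof -
  define l where "l t = (\<Prod>s\<in>{..n} - {t}. Polynomial.smult (1 / (of_nat t - of_nat s)) [:- of_nat s, 1 :: complex:])" for t :: nat
  have l: "poly (l t) (of_nat s) = (if s = t then 1 else 0)" if "s \<le> n" for s t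
  proof (cases "s = t")
    case True
    have "poly (l t) (of_nat t) = (\<Prod>s\<in>{..n} - {t}. 1)"
      unfolding l_def poly_prod by (intro prod.cong) (auto simp flip: diff_divide_distrib)
    then show ?thesis using True by simp
  next
    case False
    then show ?thesis unfolding l_def poly_prod using that by (auto intro!: bexI[of _ s])
  qed
  have deg_l: "degree (l t) \<le> n" if "t \<le> n" for t
  proof -
    have "degree (l t) \<le> (\<Sum>s\<in>{..n} - {t}. 1)"
      unfolding l_def by (rule order_trans[OF degree_prod_sum_le sum_mono]) (auto simp: degree_smult_eq)
    then show ?thesis using that by simp
  qed
  show thesis
  proof
    fix c :: "nat \<Rightarrow> complex"
    define p where "p = (\<Sum>k\<le>n. monom (c k) k)"
    have p: "poly p x = (\<Sum>k\<le>n. c k * x ^ k)" for x by (simp add: p_def poly_sum poly_monom)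
    define q where "q = (\<Sum>t\<le>n. Polynomial.smult (poly p (of_nat t)) (l t))"
    have "p = q"
    proof (rule poly_eqI_degree[where A = "of_nat ` {..n}"])
      fix x :: complex assume "x \<in> of_nat ` {..n}"
      then obtain s where s: "s \<le> n" "x = of_nat s" by auto
      have "poly q x = (\<Sum>t\<le>n. if s = t then poly p (of_nat t) else 0)"
        unfolding q_def poly_sum s(2) using l[OF s(1)] by (intro sum.cong) auto
      then show "poly p x = poly q x" using s by simp
    next
      have card: "card (of_nat ` {..n} :: complex set) = Suc n" by (simp add: card_image)
      show "degree p < card (of_nat ` {..n} :: complex set)" unfolding card p_def
        by (intro le_imp_less_Suc degree_sum_le) (auto intro: order_trans[OF degree_monom_le])
      show "degree q < card (of_nat ` {..n} :: complex set)" unfolding card q_def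
        by (intro le_imp_less_Suc degree_sum_le)
          (simp, rule order_trans[OF degree_smult_le deg_l], simp)
    qed
    then have "poly p z = poly q z" by simp
    also have "\<dots> = (\<Sum>t\<le>n. poly p (of_nat t) * poly (l t) z)" by (simp add: q_def poly_sum)
    finally have "poly p z = (\<Sum>t\<le>n. poly p (of_nat t) * poly (l t) z)" .
    then show "(\<Sum>k\<le>n. c k * z ^ k) = (\<Sum>t\<le>n. poly (l t) z * (\<Sum>k\<le>n. c k * of_nat t ^ k))"
      unfolding p by (simp add: mult.commute)
  qed
qed

text \<open>Functions in a finite-dimensional space are reconstructed from finitely many of their
  values, so pointwise convergence controls the coordinates. A point is added whenever a generator
  is not yet reproduced.\<close>

lemma finite_span_points:
  fixes W :: "('x \<Rightarrow> complex) set"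
  assumes "finite W"
  shows "\<exists>(n::nat) pts e. (\<forall>i<n. e i \<in> Modules.module.span (\<lambda>c f x. c * f x) W) \<and>
    (\<forall>w \<in> Modules.module.span (\<lambda>c f x. c * f x) W. \<forall>x. w x = (\<Sum>i<n. w (pts i) * e i x))"
proof -
  interpret F: vector_space "\<lambda>c (f :: 'x \<Rightarrow> complex) x. c * f x" by (rule vector_space_fun)
  have "\<exists>(n::nat) pts e. (\<forall>i<n. e i \<in> F.span W) \<and> (\<forall>w\<in>W. \<forall>x. w x = (\<Sum>i<n. w (pts i) * e i x))"
    using assms
  proof (induction W)
    case empty
    show ?case by (rule exI[of _ 0]) simp
  next
    case (insert w0 W)
    then obtain n :: nat and pts e where e: "\<And>i. i < n \<Longrightarrow> e i \<in> F.span W"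
      and rep: "\<And>w x. w \<in> W \<Longrightarrow> w x = (\<Sum>i<n. w (pts i) * e i x)" by blast
    have e': "e i \<in> F.span (insert w0 W)" if "i < n" for i
      using e[OF that] F.span_mono[of W "insert w0 W"] by blast
    show ?case
    proof (cases "\<forall>x. w0 x = (\<Sum>i<n. w0 (pts i) * e i x)")
      case True
      then have "\<forall>w\<in>insert w0 W. \<forall>x. w x = (\<Sum>i<n. w (pts i) * e i x)" using rep by blast
      then show ?thesis using e' by blast
    next
      case False
      then obtain y where y: "w0 y \<noteq> (\<Sum>i<n. w0 (pts i) * e i y)" by blast
      define d where "d = w0 y - (\<Sum>i<n. w0 (pts i) * e i y)"
      have d: "d \<noteq> 0" using y by (simp add: d_def)
      \<comment> \<open>\<open>u\<close> is the interpolation defect of \<open>w0\<close>,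
        normalised to be 1 at the new point \<open>y\<close>; the old reconstructing functions are
        then corrected so that they vanish at \<open>y\<close>.\<close>
      define u where "u x = 1 / d * (w0 x - (\<Sum>i<n. w0 (pts i) * e i x))" for x
      have "(\<lambda>x. \<Sum>i<n. w0 (pts i) * e i x) = (\<Sum>i<n. (\<lambda>x. w0 (pts i) * e i x))"
        by (rule ext) (simp add: sum_fun_apply)
      moreover have "(\<Sum>i<n. (\<lambda>x. w0 (pts i) * e i x)) \<in> F.span (insert w0 W)"
        by (intro F.span_sum F.span_scale e') auto
      ultimately have "(\<lambda>x. 1 / d * (w0 - (\<lambda>x. \<Sum>i<n. w0 (pts i) * e i x)) x) \<in> F.span (insert w0 W)"
        using F.span_base[of w0 "insert w0 W"] by (intro F.span_scale F.span_diff) simp_all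
      then have u: "u \<in> F.span (insert w0 W)" by (simp add: u_def[abs_def] fun_diff_def)
      define pts' where "pts' = pts(n := y)"
      define ee where "ee i = (if i < n then e i - (\<lambda>x. e i y * u x) else u)" for i
      have ee: "ee i \<in> F.span (insert w0 W)" for i
        unfolding ee_def using u e' by (auto intro: F.span_diff F.span_scale)
      have sum: "(\<Sum>i<Suc n. w (pts' i) * ee i x) =
        (\<Sum>i<n. w (pts i) * e i x) + (w y - (\<Sum>i<n. w (pts i) * e i y)) * u x" for w x
      proof -
        have "(\<Sum>i<n. w (pts' i) * ee i x) = (\<Sum>i<n. w (pts i) * e i x - w (pts i) * e i y * u x)"
          by (intro sum.cong) (auto simp: pts'_def ee_def algebra_simps)
        then show ?thesis
          by (simp add: pts'_def ee_def sum_subtractf left_diff_distrib sum_distrib_right)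
      qed
      have "w x = (\<Sum>i<Suc n. w (pts' i) * ee i x)" if "w \<in> insert w0 W" for w x
      proof (cases "w = w0")
        case True
        then show ?thesis unfolding sum using d by (simp add: u_def d_def[symmetric])
      next
        case False
        then have "w \<in> W" using that by simp
        then show ?thesis unfolding sum using rep by simp
      qed
      then show ?thesis using ee by (intro exI[of _ "Suc n"] exI[of _ pts'] exI[of _ ee]) blast
    qed
  qed
  then obtain n :: nat and pts e where e: "\<And>i. i < n \<Longrightarrow> e i \<in> F.span W"
    and rep: "\<And>w x. w \<in> W \<Longrightarrow> w x = (\<Sum>i<n. w (pts i) * e i x)" by blast
  have "w x = (\<Sum>i<n. w (pts i) * e i x)" if "w \<in> F.span W" for w x
    using that
  proof (induction rule: F.span_induct)
    case base
    show ?case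
    proof (rule F.subspaceI)
      show "0 \<in> {w. w x = (\<Sum>i<n. w (pts i) * e i x)}" by simp
    next
      fix f g assume "f \<in> {w. w x = (\<Sum>i<n. w (pts i) * e i x)}" "g \<in> {w. w x = (\<Sum>i<n. w (pts i) * e i x)}"
      then have "f x = (\<Sum>i<n. f (pts i) * e i x)" "g x = (\<Sum>i<n. g (pts i) * e i x)" by blast+
      then have "f x + g x = (\<Sum>i<n. (f (pts i) + g (pts i)) * e i x)"
        by (simp only: distrib_right sum.distrib)
      then show "f + g \<in> {w. w x = (\<Sum>i<n. w (pts i) * e i x)}" by simp
    next
      fix c f assume "f \<in> {w. w x = (\<Sum>i<n. w (pts i) * e i x)}"
      then have "f x = (\<Sum>i<n. f (pts i) * e i x)" by blast
      then have "c * f x = (\<Sum>i<n. c * f (pts i) * e i x)" by (simp only: sum_distrib_left mult.assoc)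
      then show "(\<lambda>x. c * f x) \<in> {w. w x = (\<Sum>i<n. w (pts i) * e i x)}" by simp
    qed
  qed (rule rep)
  then show ?thesis using e by blast
qed

text \<open>The reconstruction formula passes to pointwise limits. This carries finite rank from a
  dense subspace to its closure.\<close>

lemma finite_span_closed:
  fixes W :: "('x \<Rightarrow> complex) set"
  assumes W: "finite W" and \<psi>: "\<And>n. \<psi> n \<in> Modules.module.span (\<lambda>c f x. c * f x) W"
    and lim: "\<And>x. (\<lambda>n. \<psi> n x) \<longlonglongrightarrow> \<phi> x"
  shows "\<phi> \<in> Modules.module.span (\<lambda>c f x. c * f x) W"
proof -
  interpret F: vector_space "\<lambda>c (f :: 'x \<Rightarrow> complex) x. c * f x" by (rule vector_space_fun)
  obtain n :: nat and pts e where e: "\<And>i. i < n \<Longrightarrow> e i \<in> F.span W"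
    and rep: "\<And>w x. w \<in> F.span W \<Longrightarrow> w x = (\<Sum>i<n. w (pts i) * e i x)"
    using finite_span_points[OF W] by blast
  have eq: "\<phi> x = (\<Sum>i<n. \<phi> (pts i) * e i x)" for x
  proof (rule LIMSEQ_unique[OF lim])
    have "(\<lambda>m. \<Sum>i<n. \<psi> m (pts i) * e i x) \<longlonglongrightarrow> (\<Sum>i<n. \<phi> (pts i) * e i x)"
      by (intro tendsto_intros lim)
    moreover have "(\<lambda>m. \<psi> m x) = (\<lambda>m. \<Sum>i<n. \<psi> m (pts i) * e i x)"
      by (rule ext, rule rep[OF \<psi>])
    ultimately show "(\<lambda>m. \<psi> m x) \<longlonglongrightarrow> (\<Sum>i<n. \<phi> (pts i) * e i x)" by (simp only:)
  qed
  have "\<phi> = (\<Sum>i<n. (\<lambda>x. \<phi> (pts i) * e i x))"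
    by (rule ext) (unfold sum_fun_apply, rule eq)
  also have "\<dots> \<in> F.span W" by (intro F.span_sum F.span_scale e) auto
  finally show ?thesis .
qed

context op_space
begin

text \<open>An entire function growing at most like the \<open>j\<close>-th power is a polynomial of
  degree at most \<open>j\<close>, by Liouville's theorem; the growth comes from
  \<open>homog_part_bound\<close>.\<close>

lemma homog_part_line_polynomial:
  assumes f: "f \<in> carrier H" and a: "a \<in> carrier V" and b: "b \<in> carrier V"
  obtains c where "\<And>z. homog_part j f (a + z \<cdot> b) = (\<Sum>k\<le>j. c k * z ^ k)"
proof
  fix z
  \<comment> \<open>The \<open>+ 1\<close> makes \<open>nv (a + z \<cdot> b) < cmod z * K\<close>
    strict when \<open>cmod z\<close> is at least 1, as \<open>homog_part_bound\<close>
    requires.\<close>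
  define K where "K = nv a + nv b + 1"
  have K: "K > 0" using nv_nonneg[OF a] nv_nonneg[OF b] by (simp add: K_def)
  show "homog_part j f (a + z \<cdot> b) = (\<Sum>k\<le>j. (deriv ^^ k) (\<lambda>z. homog_part j f (a + z \<cdot> b)) 0 / fact k * z ^ k)"
  proof (rule Liouville_polynomial)
    show "(\<lambda>z. homog_part j f (a + z \<cdot> b)) holomorphic_on UNIV"
      using a b by (intro fd_line_holomorphic fd_homog_part[OF f]) auto
    show "cmod (homog_part j f (a + z \<cdot> b)) \<le> (K ^ j * vnorm H f) * cmod z ^ j" if "1 \<le> cmod z" for z
    proof -
      have "nv (a + z \<cdot> b) \<le> nv a + cmod z * nv b"
        using nv_triangle[OF a scale_mem[OF b], of z] b by (simp add: nv_scale)
      also have "\<dots> < cmod z * K"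
        using mult_right_mono[OF that nv_nonneg[OF a]] that by (simp add: K_def algebra_simps)
      finally have "cmod (homog_part j f (a + z \<cdot> b)) \<le> (cmod z * K) ^ j * vnorm H f"
        using a b by (intro homog_part_bound f) auto
      then show ?thesis by (simp add: power_mult_distrib mult_ac)
    qed
  qed
qed

text \<open>The Lagrange weights depend on \<open>z\<close> and \<open>j\<close> but not on
  \<open>f\<close>, so interpolating each polynomial \<open>homog_part j f\<close> along the line
  becomes one identity between functionals.\<close>

lemma delta_part_interpolate:
  assumes a: "a \<in> carrier V" and b: "b \<in> carrier V"
  obtains w where "delta_part j (a + z \<cdot> b) = (\<Sum>t\<le>j. cscale D (w t) (delta_part j (a + of_nat t \<cdot> b)))"
proof -
  obtain w where w: "\<And>c. (\<Sum>k\<le>j. c k * z ^ k) = (\<Sum>t\<le>j. w t * (\<Sum>k\<le>j. c k * of_nat t ^ k))"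
    using lagrange_interpolation by blast
  have "delta_part j (a + z \<cdot> b) f = (\<Sum>t\<le>j. cscale D (w t) (delta_part j (a + of_nat t \<cdot> b))) f" for f
  proof (cases "f \<in> carrier H")
    case True
    obtain c where "\<And>z. homog_part j f (a + z \<cdot> b) = (\<Sum>k\<le>j. c k * z ^ k)"
      using homog_part_line_polynomial[OF True a b] by blast
    then show ?thesis using True w[of c] by (simp add: delta_part_def sum_fun_apply D.cscale_def)
  qed (simp add: delta_part_def sum_fun_apply D.cscale_def)
  then show thesis using that by blast
qed

text \<open>Coordinates are eliminated one at a time: along \<open>b\<close> the coefficient
  \<open>z\<close> is replaced by the nodes 0, ..., j, so that in the end only points of a finite
  grid remain. The base point \<open>a\<close> is kept general because the nodes shift it.\<close>

lemma delta_part_finite_span: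
  assumes "finite E" "E \<subseteq> carrier V"
  shows "a \<in> carrier V \<Longrightarrow> \<exists>W. finite W \<and> W \<subseteq> carrier G \<and> (\<forall>x\<in>vs.span E. delta_part j (a + x) \<in> ds.span W)"
  using assms
proof (induction E arbitrary: a rule: finite_induct)
  case empty
  then show ?case by (intro exI[of _ "{delta_part j a}"]) (auto simp: delta_part_G ds.span_base)
next
  case (insert b E)
  have b: "b \<in> carrier V" and E: "E \<subseteq> carrier V" using insert.prems by auto
  have "\<forall>t::nat. \<exists>W. finite W \<and> W \<subseteq> carrier G \<and> (\<forall>x\<in>vs.span E. delta_part j (a + of_nat t \<cdot> b + x) \<in> ds.span W)"
    using insert.IH[OF _ E] insert.prems(1) b by simp
  then obtain W where W: "\<And>t::nat. finite (W t)" "\<And>t. W t \<subseteq> carrier G"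
    "\<And>t x. x \<in> vs.span E \<Longrightarrow> delta_part j (a + of_nat t \<cdot> b + x) \<in> ds.span (W t)" by metis
  show ?case
  proof (intro exI[of _ "\<Union>t\<le>j. W t"] conjI ballI)
    fix x assume "x \<in> vs.span (insert b E)"
    then obtain z where z: "x - z \<cdot> b \<in> vs.span E" using vs.span_breakdown_eq by blast
    let ?y = "x - z \<cdot> b"
    have y: "?y \<in> carrier V" using z vs.span_minimal[OF E subspace] by blast
    obtain w where w: "delta_part j ((a + ?y) + z \<cdot> b) = (\<Sum>t\<le>j. cscale D (w t) (delta_part j ((a + ?y) + of_nat t \<cdot> b)))"
      using delta_part_interpolate[OF add_mem[OF insert.prems(1) y] b] .
    have "delta_part j ((a + ?y) + of_nat t \<cdot> b) \<in> ds.span (\<Union>t\<le>j. W t)" if "t \<le> j" for t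
    proof -
      have "delta_part j (a + of_nat t \<cdot> b + ?y) \<in> ds.span (W t)" by (rule W(3)[OF z])
      moreover have "ds.span (W t) \<subseteq> ds.span (\<Union>t\<le>j. W t)" using that by (intro ds.span_mono) auto
      ultimately show ?thesis by (auto simp: algebra_simps)
    qed
    then have "delta_part j ((a + ?y) + z \<cdot> b) \<in> ds.span (\<Union>t\<le>j. W t)"
      unfolding w by (intro ds.span_sum ds.span_scale) auto
    then show "delta_part j (a + x) \<in> ds.span (\<Union>t\<le>j. W t)" by simp
  qed (use W in auto)
qed

end

section \<open>From the space to its free space\<close>

lemma higher_deriv_lincomb:
  assumes "finite S" "\<And>s. s \<in> S \<Longrightarrow> g s holomorphic_on ball 0 1"
  shows "(deriv ^^ n) (\<lambda>l. \<Sum>s\<in>S. c s * g s l) 0 = (\<Sum>s\<in>S. c s * (deriv ^^ n) (g s) 0)"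
  using assms
proof (induction S rule: finite_induct)
  case (insert s S)
  have "(deriv ^^ n) (\<lambda>l. c s * g s l + (\<Sum>s\<in>S. c s * g s l)) 0 =
    (deriv ^^ n) (\<lambda>l. c s * g s l) 0 + (deriv ^^ n) (\<lambda>l. \<Sum>s\<in>S. c s * g s l) 0"
    using insert.prems by (intro higher_deriv_add[where S = "ball 0 1"] holomorphic_intros) auto
  also have "(deriv ^^ n) (\<lambda>l. c s * g s l) 0 = c s * (deriv ^^ n) (g s) 0"
    using insert.prems by (intro higher_deriv_cmult[where A = "ball 0 1"]) auto
  finally show ?case using insert by simp
qed simp

context op_space
begin

text \<open>Testing on vectors reduces these to the scalar Cauchy estimates.\<close>

lemma homog_part_form:
  assumes I: "finite I" and f: "\<And>a b. a \<in> I \<Longrightarrow> b \<in> I \<Longrightarrow> f a b \<in> carrier H"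
    and y: "\<And>a b. a \<in> I \<Longrightarrow> b \<in> I \<Longrightarrow> y a b \<in> B"
    and fb: "\<And>l. cmod l < 1 \<Longrightarrow> form_bound I I (\<lambda>a b. f a b (l \<cdot> y a b)) C"
  shows "form_bound I I (\<lambda>a b. homog_part j (f a b) (y a b)) C"
    and "0 < r \<Longrightarrow> r < 1 \<Longrightarrow>
      form_bound I I (\<lambda>a b. \<Sum>j<k. of_real r ^ j * homog_part j (f a b) (y a b)) ((1 + r ^ k / (1 - r)) * C)"
proof -
  have C: "0 \<le> C" using form_bound_nonneg[OF fb[of 0]] by simp
  \<comment> \<open>Compressing by \<open>w\<close> and \<open>v\<close> gives a scalar holomorphic
    function whose Taylor coefficients are the forms to be estimated.\<close>
  define g where "g w v l = (\<Sum>(a, b)\<in>I \<times> I. (w a * v b) * f a b (l \<cdot> y a b))" for w v l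
  have g: "g w v l = (\<Sum>a\<in>I. \<Sum>b\<in>I. w a * f a b (l \<cdot> y a b) * v b)" for w v l
    by (simp add: g_def sum.cartesian_product' mult_ac)
  have hol: "(\<lambda>l. f a b (l \<cdot> y a b)) holomorphic_on ball 0 1" if "a \<in> I" "b \<in> I" for a b
    using that by (intro H_line_ball f y)
  have ghol: "g w v holomorphic_on ball 0 1" for w v
    unfolding g_def[abs_def] split_def using hol by (intro holomorphic_intros) auto
  have gb: "cmod (g w v l) \<le> C * l2 I w * l2 I v" if "cmod l < 1" for w v l
    unfolding g by (rule form_boundD[OF fb[OF that]])
  have gd: "(deriv ^^ j) (g w v) 0 / fact j = (\<Sum>a\<in>I. \<Sum>b\<in>I. w a * homog_part j (f a b) (y a b) * v b)" for w v j
  proof -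
    have "(deriv ^^ j) (g w v) 0 = (\<Sum>s\<in>I \<times> I. (w (fst s) * v (snd s)) *
      (deriv ^^ j) (\<lambda>l. f (fst s) (snd s) (l \<cdot> y (fst s) (snd s))) 0)"
      unfolding g_def[abs_def] split_def using I hol by (intro higher_deriv_lincomb) auto
    then show ?thesis
      by (simp add: homog_part_def sum.cartesian_product' sum_divide_distrib mult_ac)
  qed
  show "form_bound I I (\<lambda>a b. homog_part j (f a b) (y a b)) C"
  proof (rule form_boundI[OF C])
    fix w v
    show "cmod (\<Sum>a\<in>I. \<Sum>b\<in>I. w a * homog_part j (f a b) (y a b) * v b) \<le> C * l2 I w * l2 I v"
      unfolding gd[symmetric] by (rule taylor_coeff_bound[OF ghol gb])
  qed
  assume r: "0 < r" "r < 1"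
  show "form_bound I I (\<lambda>a b. \<Sum>j<k. of_real r ^ j * homog_part j (f a b) (y a b)) ((1 + r ^ k / (1 - r)) * C)"
  proof (rule form_boundI)
    show "0 \<le> (1 + r ^ k / (1 - r)) * C" using C r by simp
    fix w v
    let ?M = "C * l2 I w * l2 I v"
    have "(\<Sum>a\<in>I. \<Sum>b\<in>I. w a * (\<Sum>j<k. of_real r ^ j * homog_part j (f a b) (y a b)) * v b) =
      (\<Sum>a\<in>I. \<Sum>b\<in>I. \<Sum>j<k. of_real r ^ j * (w a * homog_part j (f a b) (y a b) * v b))"
      by (simp add: sum_distrib_left sum_distrib_right mult_ac)
    also have "\<dots> = (\<Sum>a\<in>I. \<Sum>j<k. \<Sum>b\<in>I. of_real r ^ j * (w a * homog_part j (f a b) (y a b) * v b))"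
      by (rule sum.cong[OF refl], rule sum.swap)
    also have "\<dots> = (\<Sum>j<k. \<Sum>a\<in>I. \<Sum>b\<in>I. of_real r ^ j * (w a * homog_part j (f a b) (y a b) * v b))"
      by (rule sum.swap)
    also have "\<dots> = (\<Sum>j<k. (deriv ^^ j) (g w v) 0 / fact j * of_real r ^ j)"
      unfolding gd by (simp add: sum_distrib_left mult.commute)
    finally have eq: "(\<Sum>a\<in>I. \<Sum>b\<in>I. w a * (\<Sum>j<k. of_real r ^ j * homog_part j (f a b) (y a b)) * v b) =
      (\<Sum>j<k. (deriv ^^ j) (g w v) 0 / fact j * of_real r ^ j)" .
    \<comment> \<open>The partial sum at \<open>r\<close> is the value there minus the tail, hence
      at most \<open>?M\<close> plus \<open>?M * r ^ k / (1 - r)\<close>.\<close>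
    have "cmod (g w v (of_real r) - (\<Sum>j<k. (deriv ^^ j) (g w v) 0 / fact j * of_real r ^ j))
      \<le> ?M * cmod (of_real r) ^ k / (1 - cmod (of_real r))"
      using r by (intro taylor_tail_bound[OF ghol gb]) auto
    moreover have "cmod (g w v (of_real r)) \<le> ?M" using r by (intro gb) auto
    ultimately have "cmod (\<Sum>j<k. (deriv ^^ j) (g w v) 0 / fact j * of_real r ^ j) \<le> ?M + ?M * r ^ k / (1 - r)"
      using r norm_triangle_sub[of "\<Sum>j<k. (deriv ^^ j) (g w v) 0 / fact j * of_real r ^ j" "g w v (of_real r)"]
      by (simp add: norm_minus_commute)
    then show "cmod (\<Sum>a\<in>I. \<Sum>b\<in>I. w a * (\<Sum>j<k. of_real r ^ j * homog_part j (f a b) (y a b)) * v b)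
      \<le> (1 + r ^ k / (1 - r)) * C * l2 I w * l2 I v"
      unfolding eq by (simp add: algebra_simps)
  qed
qed

lemma mub_scale:
  assumes X: "X \<in> matrix_unit_ball V" and l: "cmod l \<le> 1"
  shows "map_mat (cscale V l) X \<in> matrix_unit_ball V"
proof -
  obtain p where p: "p > 0" "X \<in> Mat_over p V" "mnorm V X < 1" using X unfolding mem_mub by blast
  have "cmod l * mnorm V X \<le> 1 * mnorm V X" using l mn_nonneg[OF p(1,2)] by (intro mult_right_mono)
  then have "mnorm V (map_mat (cscale V l) X) < 1" using p mn_scale by simp
  moreover have "map_mat (cscale V l) X \<in> Mat_over p V" using p(2) by (auto simp: Mat_over_def)
  ultimately show ?thesis unfolding mem_mub using p(1) by blast
qed

lemma mub_entry:
  assumes X: "X \<in> matrix_unit_ball V" "X \<in> carrier_mat p p" and ij: "i < p" "j < p"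
  shows "X $$ (i, j) \<in> B"
proof -
  obtain p' where p: "p' > 0" "X \<in> Mat_over p' V" "mnorm V X < 1" using X(1) unfolding mem_mub by blast
  then have "p' = p" using X(2) by (auto simp: Mat_over_def)
  then show ?thesis using nv_entry[OF p(2), of i j] p ij Mat_overD(2)[OF p(2)] by (auto simp: mem_B)
qed

lemma mub_scale_form:
  assumes F: "F \<in> Mat_over m H" and X: "X \<in> matrix_unit_ball V" "X \<in> carrier_mat p p" and l: "cmod l < 1"
  shows "form_bound ({..<m} \<times> {..<p}) ({..<m} \<times> {..<p})
    (\<lambda>(k, i) (n, j). (F $$ (k, n)) (l \<cdot> (X $$ (i, j)))) (mnorm H F)"
proof -
  have "form_bound ({..<m} \<times> {..<p}) ({..<m} \<times> {..<p})
    (\<lambda>(k, i) (n, j). (F $$ (k, n)) (map_mat (cscale V l) X $$ (i, j))) (mnorm H F)"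
    using l X by (intro H.mnorm_form[OF F] mub_scale) auto
  then show ?thesis using X(2) by (subst form_bound_cong) auto
qed

lemma cc_V:
  assumes T: "complete_contraction V V T"
  shows "x \<in> carrier V \<Longrightarrow> T x \<in> carrier V"
    and "x \<in> carrier V \<Longrightarrow> y \<in> carrier V \<Longrightarrow> T (x + y) = T x + T y"
    and "x \<in> carrier V \<Longrightarrow> T (c \<cdot> x) = c \<cdot> T x"
    and "x \<in> carrier V \<Longrightarrow> nv (T x) \<le> nv x"
    and "X \<in> matrix_unit_ball V \<Longrightarrow> map_mat T X \<in> matrix_unit_ball V"
proof -
  have lin: "linear_between V V T" and n: "\<And>n X. n > 0 \<Longrightarrow> X \<in> Mat_over n V \<Longrightarrow> mnorm V (map_mat T X) \<le> mnorm V X"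
    using T by (auto simp: complete_contraction_def)
  show c: "x \<in> carrier V \<Longrightarrow> T x \<in> carrier V" for x using lin by (simp add: linear_between_def)
  show "x \<in> carrier V \<Longrightarrow> y \<in> carrier V \<Longrightarrow> T (x + y) = T x + T y"
    "x \<in> carrier V \<Longrightarrow> T (c \<cdot> x) = c \<cdot> T x"
    using lin by (simp_all add: linear_between_def)
  show "nv (T x) \<le> nv x" if "x \<in> carrier V"
  proof -
    have "map_mat T (Matrix.mat 1 1 (\<lambda>_. x)) = Matrix.mat 1 1 (\<lambda>_. T x)" by (rule eq_matI) auto
    then show ?thesis using n[OF _ single_Mat[OF that]] by (simp add: vnorm_def)
  qed
  show "X \<in> matrix_unit_ball V \<Longrightarrow> map_mat T X \<in> matrix_unit_ball V"
  proof -
    assume "X \<in> matrix_unit_ball V"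
    then obtain p where p: "p > 0" "X \<in> Mat_over p V" "mnorm V X < 1" unfolding mem_mub by blast
    moreover have "map_mat T X \<in> Mat_over p V" using p(2) c by (auto simp: Mat_over_def)
    ultimately show ?thesis unfolding mem_mub using n[OF p(1,2)] by (intro exI[of _ p]) auto
  qed
qed

lemma fd_compose:
  assumes T: "complete_contraction V V T" and x: "x \<in> carrier V" and f: "fd f (T x)"
  shows "fd (\<lambda>y. f (T y)) x"
proof -
  note cc = cc_V[OF T]
  obtain L where L: "L \<in> carrier (dual_os V)"
    "\<And>e. e > 0 \<Longrightarrow> \<exists>d>0. \<forall>h \<in> carrier V. nv h < d \<longrightarrow> cmod (f (T x + h) - f (T x) - L h) \<le> e * nv h"
    using f unfolding frechet_differentiable_at_def by blast
  \<comment> \<open>\<open>T\<close> is unconstrained outside the carrier, while members of the dual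
    must vanish there.\<close>
  define L' where "L' h = (if h \<in> carrier V then L (T h) else 0)" for h
  show ?thesis unfolding frechet_differentiable_at_def
  proof (intro bexI[where x = L'] allI impI)
    fix e :: real assume e: "e > 0"
    then obtain d where d: "d > 0" "\<And>h. h \<in> carrier V \<Longrightarrow> nv h < d \<Longrightarrow>
      cmod (f (T x + h) - f (T x) - L h) \<le> e * nv h"
      using L(2) by blast
    show "\<exists>d>0. \<forall>h\<in>carrier V. nv h < d \<longrightarrow> cmod (f (T (x + h)) - f (T x) - L' h) \<le> e * nv h"
    proof (intro exI[of _ d] conjI ballI impI)
      fix h assume h: "h \<in> carrier V" "nv h < d"
      have "cmod (f (T x + T h) - f (T x) - L (T h)) \<le> e * nv (T h)"
        using h cc(4)[OF h(1)] by (intro d(2) cc(1)) auto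
      also have "\<dots> \<le> e * nv h" using e cc(4)[OF h(1)] by (intro mult_left_mono) auto
      finally show "cmod (f (T (x + h)) - f (T x) - L' h) \<le> e * nv h"
        using cc(2)[OF x h(1)] h by (simp add: L'_def)
    qed (rule d)
  next
    obtain K where K: "K \<ge> 0" "\<And>h. h \<in> carrier V \<Longrightarrow> cmod (L h) \<le> K * nv h"
      using dual_boundedE[OF nv_nonneg L(1)] by blast
    have "cmod (L' h) \<le> K * nv h" if "h \<in> carrier V" for h
    proof -
      have "cmod (L (T h)) \<le> K * nv (T h)" using that by (intro K(2) cc(1))
      also have "\<dots> \<le> K * nv h" using K cc(4)[OF that] by (intro mult_left_mono)
      finally show ?thesis using that by (simp add: L'_def)
    qed
    note L'_bound = this
    show "L' \<in> carrier (dual_os V)"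
      by (rule iffD2[OF mem_dual_iff[of V, OF nv_nonneg]], assumption)
        (use cc K(1) L'_bound in \<open>auto simp: L'_def dual_add[OF L(1)] dual_scale[OF L(1)]\<close>)
  qed
qed

text \<open>The predual of the finite rank approximation on functions: a normalised truncated Taylor
  polynomial of the dilation by r, composed with T. The truncation error for the dilation is at most
  r^k / (1 - r).\<close>

definition trunc :: "real \<Rightarrow> nat \<Rightarrow> ('v \<Rightarrow> 'v) \<Rightarrow> ('v \<Rightarrow> complex) \<Rightarrow> 'v \<Rightarrow> complex" where
  "trunc r k T f x = (if x \<in> B then of_real (1 / (1 + r ^ k / (1 - r))) *
     (\<Sum>j<k. of_real r ^ j * homog_part j f (T x)) else 0)"

definition approx :: "real \<Rightarrow> nat \<Rightarrow> ('v \<Rightarrow> 'v) \<Rightarrow> (('v \<Rightarrow> complex) \<Rightarrow> complex) \<Rightarrow> ('v \<Rightarrow> complex) \<Rightarrow> complex" where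
  "approx r k T \<phi> f = (if f \<in> carrier H then \<phi> (trunc r k T f) else 0)"

section \<open>Contractivity, finite rank and convergence of the approximants\<close>

context
  fixes r :: real and k :: nat and T :: "'v \<Rightarrow> 'v"
  assumes r: "0 < r" "r < 1" and T: "complete_contraction V V T"
begin

lemma T_B: "x \<in> B \<Longrightarrow> T x \<in> B"
  using cc_V(1,4)[OF T, of x] by (auto simp: mem_B)

lemma eps_pos: "0 < r ^ k / (1 - r)" using r by simp

text \<open>\<open>T\<close> preserves the matrix unit ball, so \<open>homog_part_form\<close>
  applies to the images of the entries under \<open>T\<close> and yields the factor
  \<open>1 + r ^ k / (1 - r)\<close>, which the normalising constant in \<open>trunc\<close> cancels
  exactly.\<close>

lemma trunc_form:
  assumes F: "F \<in> Mat_over m H" and X: "X \<in> matrix_unit_ball V" "X \<in> carrier_mat p p"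
  shows "form_bound ({..<m} \<times> {..<p}) ({..<m} \<times> {..<p})
    (\<lambda>(k', i) (n, j). trunc r k T (F $$ (k', n)) (X $$ (i, j))) (mnorm H F)"
proof -
  let ?I = "{..<m} \<times> {..<p}" and ?\<kappa> = "1 / (1 + r ^ k / (1 - r))"
  let ?f = "\<lambda>a b. F $$ (fst a, fst b)" and ?y = "\<lambda>a b. T (X $$ (snd a, snd b))"
  have TX: "map_mat T X \<in> matrix_unit_ball V" "map_mat T X \<in> carrier_mat p p"
    using cc_V(5)[OF T X(1)] X(2) by auto
  have "form_bound ?I ?I (\<lambda>a b. \<Sum>j<k. of_real r ^ j * homog_part j (?f a b) (?y a b)) ((1 + r ^ k / (1 - r)) * mnorm H F)"
  proof (rule homog_part_form(2)[OF _ _ _ _ r])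
    fix l :: complex assume l: "cmod l < 1"
    show "form_bound ?I ?I (\<lambda>a b. ?f a b (l \<cdot> ?y a b)) (mnorm H F)"
      using mub_scale_form[OF F TX l] X(2) by (subst (asm) form_bound_cong) (auto simp: split_def)
  next
    fix a b assume "a \<in> ?I" "b \<in> ?I"
    then show "?f a b \<in> carrier H" "?y a b \<in> B"
      using Mat_overD(2)[OF F] mub_entry[OF X] T_B by auto
  qed simp
  from form_bound_scale[OF this, of "of_real ?\<kappa>"]
  have "form_bound ?I ?I (\<lambda>a b. of_real ?\<kappa> * (\<Sum>j<k. of_real r ^ j * homog_part j (?f a b) (?y a b)))
    (cmod (of_real ?\<kappa>) * ((1 + r ^ k / (1 - r)) * mnorm H F))" .
  moreover have "cmod (of_real ?\<kappa>) * ((1 + r ^ k / (1 - r)) * mnorm H F) = mnorm H F"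
  proof -
    have pos: "1 + r ^ k / (1 - r) > 0" using eps_pos by linarith
    then have "cmod (of_real ?\<kappa>) = ?\<kappa>" by (simp only: norm_of_real abs_of_pos zero_less_divide_1_iff)
    then show ?thesis using pos by simp
  qed
  ultimately have fb: "form_bound ?I ?I (\<lambda>a b. of_real ?\<kappa> * (\<Sum>j<k. of_real r ^ j * homog_part j (?f a b) (?y a b))) (mnorm H F)"
    by (simp only:)
  have "trunc r k T (?f a b) (X $$ (snd a, snd b)) =
    of_real ?\<kappa> * (\<Sum>j<k. of_real r ^ j * homog_part j (?f a b) (?y a b))" if "a \<in> ?I" "b \<in> ?I" for a b
    using mub_entry[OF X] that unfolding trunc_def by auto
  then show ?thesis
    using fb by (subst form_bound_cong[where B = "\<lambda>a b. of_real ?\<kappa> * (\<Sum>j<k. of_real r ^ j * homog_part j (?f a b) (?y a b))"])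
      (auto simp: split_def)
qed

lemma trunc_single:
  assumes f: "f \<in> carrier H" and X: "X \<in> matrix_unit_ball V" "X \<in> carrier_mat p p"
  shows "form_bound {..<p} {..<p} (\<lambda>i j. trunc r k T f (X $$ (i, j))) (vnorm H f)"
proof -
  let ?F = "Matrix.mat 1 1 (\<lambda>_. f)"
  have "form_bound ({..<1::nat} \<times> {..<p}) ({..<1::nat} \<times> {..<p})
    (\<lambda>(k', i) (n, j). trunc r k T (?F $$ (k', n)) (X $$ (i, j))) (vnorm H f)"
    unfolding vnorm_def by (rule trunc_form[OF H.single_Mat[OF f] X])
  \<comment> \<open>A block index of size 1 is removed by contracting with the vector 1.\<close>
  from form_bound_contract[OF _ _ this, of "\<lambda>_. 1" "\<lambda>_. 1"] show ?thesis
    by (simp add: L2_set_def)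
qed

lemma trunc_H:
  assumes f: "f \<in> carrier H"
  shows "trunc r k T f \<in> carrier H"
  unfolding mem_H
proof (intro conjI ballI allI impI)
  fix x assume x: "x \<in> B"
  then have xV: "x \<in> carrier V" by (simp add: mem_B)
  show "fd (trunc r k T f) x"
  proof (rule fd_cong[where \<rho> = "1 - nv x"])
    show "fd (\<lambda>x. of_real (1 / (1 + r ^ k / (1 - r))) * (\<Sum>j<k. of_real r ^ j * homog_part j f (T x))) x"
      using cc_V(1)[OF T xV] by (intro fd_scale fd_sum fd_compose[OF T xV] fd_homog_part f)
    show "trunc r k T f y = of_real (1 / (1 + r ^ k / (1 - r))) * (\<Sum>j<k. of_real r ^ j * homog_part j f (T y))"
      if "y \<in> carrier V" "nv (y - x) < 1 - nv x" for y
      using B_open[OF x that] by (simp add: trunc_def)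
  qed (use x in \<open>auto simp: mem_B\<close>)
next
  show "bdd_above ((\<lambda>X. op_norm (map_mat (trunc r k T f) X)) ` matrix_unit_ball V)"
    by (rule iffD2[OF bdd_op_norm_iff[OF H.square]], assumption)
      (use trunc_single[OF f] H.square in blast)
qed (simp add: trunc_def)

lemma mnorm_trunc:
  assumes F: "F \<in> Mat_over m H"
  shows "map_mat (trunc r k T) F \<in> Mat_over m H" "mnorm H (map_mat (trunc r k T) F) \<le> mnorm H F"
proof -
  show 1: "map_mat (trunc r k T) F \<in> Mat_over m H"
    using F trunc_H by (auto simp: Mat_over_def)
  show "mnorm H (map_mat (trunc r k T) F) \<le> mnorm H F"
  proof (rule H.mnorm_leI_form[OF Mat_overD(1)[OF 1]])
    fix X p assume X: "X \<in> matrix_unit_ball V" "X \<in> carrier_mat p p"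
    show "form_bound ({..<m} \<times> {..<p}) ({..<m} \<times> {..<p})
      (\<lambda>(k', i) (l, j). (map_mat (trunc r k T) F $$ (k', l)) (X $$ (i, j))) (mnorm H F)"
      using trunc_form[OF F X] Mat_overD(1)[OF F] by (subst form_bound_cong) auto
  qed
qed

lemma vnorm_trunc: "f \<in> carrier H \<Longrightarrow> vnorm H (trunc r k T f) \<le> vnorm H f"
  using H.vnorm_leI[OF trunc_single] by blast

lemma trunc_add: "f \<in> carrier H \<Longrightarrow> g \<in> carrier H \<Longrightarrow>
    trunc r k T (\<lambda>x. f x + g x) = (\<lambda>x. trunc r k T f x + trunc r k T g x)"
  using T_B by (auto simp: trunc_def homog_part_add mem_B sum.distrib algebra_simps fun_eq_iff)

lemma trunc_cmult: "f \<in> carrier H \<Longrightarrow> trunc r k T (\<lambda>x. c * f x) = (\<lambda>x. c * trunc r k T f x)"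
  using T_B by (auto simp: trunc_def homog_part_cmult mem_B sum_distrib_left algebra_simps fun_eq_iff)

lemma approx_D:
  assumes \<phi>: "\<phi> \<in> carrier D"
  shows "approx r k T \<phi> \<in> carrier D"
proof (rule iffD2[OF mem_D], assumption, intro conjI allI ballI impI)
  obtain K where K: "K \<ge> 0" "\<And>f. f \<in> carrier H \<Longrightarrow> cmod (\<phi> f) \<le> K * vnorm H f"
    using dual_boundedE[OF H.vnorm_nonneg \<phi>] by blast
  have "cmod (approx r k T \<phi> f) \<le> K * vnorm H f" if "f \<in> carrier H" for f
  proof -
    have "cmod (\<phi> (trunc r k T f)) \<le> K * vnorm H (trunc r k T f)" by (intro K trunc_H that)
    also have "\<dots> \<le> K * vnorm H f" by (intro mult_left_mono vnorm_trunc that K)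
    finally show ?thesis using that by (simp add: approx_def)
  qed
  then show "\<exists>K\<ge>0. \<forall>f\<in>carrier H. cmod (approx r k T \<phi> f) \<le> K * vnorm H f" using K by blast
  fix f g assume fg: "f \<in> carrier H" "g \<in> carrier H"
  then show "approx r k T \<phi> (f + g) = approx r k T \<phi> f + approx r k T \<phi> g"
    using H.add_closed[OF fg] D_add[OF \<phi> trunc_H[OF fg(1)] trunc_H[OF fg(2)]]
    by (simp add: approx_def plus_fun_def trunc_add)
next
  fix c f assume f: "f \<in> carrier H"
  then show "approx r k T \<phi> (cscale H c f) = c * approx r k T \<phi> f"
    using H.scale_closed[OF f] D_scale[OF \<phi> trunc_H[OF f]] by (simp add: approx_def trunc_cmult H.cscale_def)
qed (simp add: approx_def)

lemma approx_add: "approx r k T (\<phi> + \<psi>) = approx r k T \<phi> + approx r k T \<psi>"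
  and approx_diff: "approx r k T (\<phi> - \<psi>) = approx r k T \<phi> - approx r k T \<psi>"
  and approx_scale: "approx r k T (cscale D c \<phi>) = cscale D c (approx r k T \<phi>)"
  by (auto simp: approx_def fun_eq_iff D.cscale_def)

text \<open>Dual to \<open>mnorm_trunc\<close>: \<open>trunc\<close> maps test matrices to test
  matrices, and \<open>approx\<close> evaluates functionals on the images.\<close>

lemma approx_contraction:
  assumes \<Phi>: "\<Phi> \<in> Mat_over n D"
  shows "mnorm D (map_mat (approx r k T) \<Phi>) \<le> mnorm D \<Phi>"
proof (rule D.mnorm_leI_form)
  show "map_mat (approx r k T) \<Phi> \<in> carrier_mat n n" using Mat_overD(1)[OF \<Phi>] by auto
  fix F p assume F: "F \<in> tests" "F \<in> carrier_mat p p"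
  then have FH: "F \<in> Mat_over p H" "mnorm H F \<le> 1" "p > 0" unfolding mem_tests by (auto simp: Mat_over_def)
  let ?F = "map_mat (trunc r k T) F"
  have "?F \<in> tests" unfolding mem_tests using mnorm_trunc[OF FH(1)] FH(2,3) by (intro exI[of _ p]) auto
  moreover have "?F \<in> carrier_mat p p" using F by auto
  ultimately have "form_bound ({..<n} \<times> {..<p}) ({..<n} \<times> {..<p})
    (\<lambda>(k', i) (l, j). (\<Phi> $$ (k', l)) (?F $$ (i, j))) (mnorm D \<Phi>)"
    by (rule D.mnorm_form[OF \<Phi>])
  then show "form_bound ({..<n} \<times> {..<p}) ({..<n} \<times> {..<p})
    (\<lambda>(k', i) (l, j). (map_mat (approx r k T) \<Phi> $$ (k', l)) (F $$ (i, j))) (mnorm D \<Phi>)"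
    using Mat_overD[OF FH(1)] Mat_overD(1)[OF \<Phi>]
    by (subst form_bound_cong[where B = "\<lambda>(k', i) (l, j). (\<Phi> $$ (k', l)) (?F $$ (i, j))"])
      (auto simp: approx_def)
qed

lemma vnorm_approx:
  assumes "\<phi> \<in> carrier D" shows "vnorm D (approx r k T \<phi>) \<le> vnorm D \<phi>"
proof -
  have "map_mat (approx r k T) (Matrix.mat 1 1 (\<lambda>_. \<phi>)) = Matrix.mat 1 1 (\<lambda>_. approx r k T \<phi>)"
    by (rule eq_matI) auto
  then show ?thesis using approx_contraction[OF D.single_Mat[OF assms]] by (simp add: vnorm_def)
qed

text \<open>Only parts of degree below \<open>k\<close> at the point \<open>T x\<close> occur; for
  \<open>T\<close> of finite rank all of these lie in a finite-dimensional space.\<close>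

lemma approx_delta:
  assumes x: "x \<in> B"
  shows "approx r k T (eval_at V x) =
    cscale D (of_real (1 / (1 + r ^ k / (1 - r)))) (\<Sum>j<k. cscale D (of_real r ^ j) (delta_part j (T x)))"
  using x trunc_H by (auto simp: approx_def eval_at_def delta_part_def D.cscale_def trunc_def sum_fun_apply fun_eq_iff)

text \<open>Stated for a general subspace, as it serves both for \<open>carrier G\<close> and for
  the span of a finite set.\<close>

lemma approx_dspan:
  assumes Z: "ds.subspace Z" "\<And>x. x \<in> B \<Longrightarrow> approx r k T (eval_at V x) \<in> Z" and \<psi>: "\<psi> \<in> dspan"
  shows "approx r k T \<psi> \<in> Z"
  using \<psi>
proof (induction rule: ds.span_induct)
  case base
  have "approx r k T 0 = 0" by (auto simp: approx_def fun_eq_iff)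
  then show ?case using Z(1)
    by (intro ds.subspaceI) (auto simp: approx_add approx_scale ds.subspace_0 ds.subspace_add ds.subspace_scale)
next
  case (step x)
  then show ?case using Z(2) by auto
qed

lemma approx_G:
  assumes \<phi>: "\<phi> \<in> carrier G"
  shows "approx r k T \<phi> \<in> carrier G"
proof (rule G_closed[OF approx_D[OF G_D[OF \<phi>]]])
  fix e :: real assume "e > 0"
  then obtain \<psi> where \<psi>: "\<psi> \<in> dspan" "vnorm D (\<phi> - \<psi>) < e" using \<phi> unfolding mem_G by blast
  have "approx r k T \<psi> \<in> carrier G"
  proof (rule approx_dspan[OF G_subspace _ \<psi>(1)])
    fix x assume x: "x \<in> B"
    show "approx r k T (eval_at V x) \<in> carrier G"
      unfolding approx_delta[OF x] using T_B[OF x] by (intro G_mem delta_part_G) (simp add: mem_B)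
  qed
  moreover have "vnorm D (approx r k T \<phi> - approx r k T \<psi>) \<le> vnorm D (\<phi> - \<psi>)"
    unfolding approx_diff[symmetric] by (intro vnorm_approx D_mem G_D[OF \<phi>] dspan_D \<psi>)
  ultimately show "\<exists>\<theta>\<in>carrier G. vnorm D (approx r k T \<phi> - \<theta>) < e" using \<psi>(2) by force
qed

text \<open>One finite set spans the images of all evaluations, hence of their span. For the
  closure, norm approximation gives pointwise convergence, and \<open>finite_span_closed\<close>
  applies.\<close>

lemma approx_finite_rank:
  assumes fr: "finite_rank V V T"
  shows "finite_rank G G (approx r k T)"
proof -
  obtain E where E: "finite E" "E \<subseteq> carrier V" "T ` carrier V \<subseteq> vs.span E"
    using fr unfolding finite_rank_def by blast
  have "\<forall>j. \<exists>W. finite W \<and> W \<subseteq> carrier G \<and> (\<forall>x\<in>vs.span E. delta_part j (0 + x) \<in> ds.span W)"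
    using delta_part_finite_span[OF E(1,2) zero_mem] by blast
  then obtain W where W: "\<And>j. finite (W j)" "\<And>j. W j \<subseteq> carrier G"
    "\<And>j x. x \<in> vs.span E \<Longrightarrow> delta_part j x \<in> ds.span (W j)" unfolding add_0 by metis
  define Z where "Z = (\<Union>j<k. W j)"
  have Z: "finite Z" "Z \<subseteq> carrier G" using W by (auto simp: Z_def)
  have delta: "approx r k T (eval_at V x) \<in> ds.span Z" if x: "x \<in> B" for x
    unfolding approx_delta[OF x]
  proof (intro ds.span_scale ds.span_sum)
    fix j assume "j \<in> {..<k}"
    then have "ds.span (W j) \<subseteq> ds.span Z" by (intro ds.span_mono) (auto simp: Z_def)
    moreover have "T x \<in> vs.span E" using E(3) x by (auto simp: mem_B)
    ultimately show "delta_part j (T x) \<in> ds.span Z" using W(3) by blast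
  qed
  have "approx r k T \<phi> \<in> ds.span Z" if \<phi>: "\<phi> \<in> carrier G" for \<phi>
  proof -
    have "\<forall>n. \<exists>\<psi>\<in>dspan. vnorm D (\<phi> - \<psi>) < 1 / real (Suc n)"
      using \<phi> unfolding mem_G by (simp del: of_nat_Suc)
    then obtain \<psi> where \<psi>: "\<And>n. \<psi> n \<in> dspan" "\<And>n. vnorm D (\<phi> - \<psi> n) < 1 / real (Suc n)" by metis
    show ?thesis unfolding D.cscale_def
    proof (rule finite_span_closed[OF Z(1)])
      show "approx r k T (\<psi> n) \<in> Modules.module.span (\<lambda>c f x. c * f x) Z" for n
        using approx_dspan[OF ds.subspace_span delta \<psi>(1)] unfolding D.cscale_def .
      fix f
      show "(\<lambda>n. approx r k T (\<psi> n) f) \<longlonglongrightarrow> approx r k T \<phi> f"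
      proof (cases "f \<in> carrier H")
        case True
        \<comment> \<open>\<open>D_le_vnorm\<close> speaks of the unit ball of \<open>H\<close>, so
          the function is divided by a positive bound of its norm.\<close>
        obtain t where t: "t > 0" "vnorm H f \<le> t"
          using H.vnorm_nonneg[OF True] by (intro that[of "vnorm H f + 1"]) auto
        have "vnorm H (\<lambda>x. of_real (1 / t) * trunc r k T f x) \<le> 1"
          using t vnorm_trunc[OF True] by (subst H.vnorm_scale[OF trunc_H[OF True]]) (auto simp: norm_divide)
        then have *: "cmod (\<theta> (\<lambda>x. of_real (1 / t) * trunc r k T f x)) \<le> vnorm D \<theta>" if "\<theta> \<in> carrier D" for \<theta>
          using that by (intro D_le_vnorm H.scale_closed trunc_H True)
        have "cmod (\<theta> (trunc r k T f)) \<le> t * vnorm D \<theta>" if "\<theta> \<in> carrier D" for \<theta>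
          using *[OF that] t unfolding D_scale[OF that trunc_H[OF True]]
          by (simp add: norm_mult norm_divide field_simps)
        then have "cmod ((\<phi> - \<psi> n) (trunc r k T f)) \<le> t * vnorm D (\<phi> - \<psi> n)" for n
          using G_D[OF \<phi>] dspan_D[OF \<psi>(1)] D_mem by blast
        moreover have "t * vnorm D (\<phi> - \<psi> n) \<le> t * (1 / real (Suc n))" for n
          using t less_imp_le[OF \<psi>(2)] by (intro mult_left_mono) auto
        ultimately have "cmod (approx r k T (\<psi> n) f - approx r k T \<phi> f) \<le> t * (1 / real (Suc n))" for n
          using True order_trans by (fastforce simp: approx_def norm_minus_commute)
        moreover have "(\<lambda>n. t * (1 / real (Suc n))) \<longlonglongrightarrow> t * 0"
          by (intro tendsto_intros) (rule LIMSEQ_inverse_real_of_nat[unfolded inverse_eq_divide])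
        ultimately have "(\<lambda>n. approx r k T (\<psi> n) f - approx r k T \<phi> f) \<longlonglongrightarrow> 0"
          using Lim_null_comparison[OF always_eventually,
            of "\<lambda>n. approx r k T (\<psi> n) f - approx r k T \<phi> f" "\<lambda>n. t * (1 / real (Suc n))"]
          by (simp only: mult_zero_right simp_thms)
        then show ?thesis by (rule LIM_zero_cancel)
      qed (simp add: approx_def)
    qed
  qed
  then show ?thesis unfolding finite_rank_def G_simps using Z by blast
qed

lemma approx_cc: "complete_contraction G G (approx r k T)"
  unfolding complete_contraction_def linear_between_def G_simps
proof (intro conjI ballI allI impI)
  fix n :: nat and \<Phi> assume "\<Phi> \<in> Mat_over n G"
  then have "\<Phi> \<in> Mat_over n D" using G_D by (auto simp: Mat_over_def)
  then show "mnorm D (map_mat (approx r k T) \<Phi>) \<le> mnorm D \<Phi>" by (rule approx_contraction)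
qed (auto simp: approx_G approx_add approx_scale)

text \<open>The error at \<open>f\<close> splits in three: the normalisation, the Taylor tail at
  \<open>y\<close>, which is the dilate of \<open>T x\<close> by \<open>r\<close>, and the increment
  of \<open>f\<close> from \<open>x\<close> to \<open>y\<close>. The first two cost
  \<open>r ^ k / (1 - r)\<close> each; the third is a Lipschitz estimate near
  \<open>x\<close>.\<close>

lemma approx_delta_error:
  assumes x: "x \<in> B" and d: "nv (T x - x) + (1 - r) < (1 - nv x) / 2"
  shows "vnorm D (approx r k T (eval_at V x) - eval_at V x) \<le>
    2 * (r ^ k / (1 - r)) + 2 * (nv (T x - x) + (1 - r)) / (1 - nv x)"
proof (rule D_vnorm_leI)
  have xV: "x \<in> carrier V" "nv x < 1" using x by (auto simp: mem_B)
  have TxV: "T x \<in> carrier V" using cc_V(1)[OF T] xV by blast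
  define \<epsilon> where "\<epsilon> = r ^ k / (1 - r)"
  have \<epsilon>: "\<epsilon> > 0" unfolding \<epsilon>_def by (rule eps_pos)
  define y where "y = of_real r \<cdot> T x"
  have yV: "y \<in> carrier V" using TxV by (simp add: y_def)
  define s where "s = nv (y - x)"
  have "y - x = of_real r \<cdot> (T x - x) - of_real (1 - r) \<cdot> x"
    by (simp add: y_def vs.scale_right_diff_distrib vs.scale_left_diff_distrib)
  then have "s \<le> nv (of_real r \<cdot> (T x - x)) + nv (of_real (1 - r) \<cdot> x)"
    using nv_diff TxV xV by (simp add: s_def)
  also have "\<dots> = r * nv (T x - x) + (1 - r) * nv x" using TxV xV r
    by (simp add: nv_scale del: of_real_diff)
  also have "\<dots> \<le> 1 * nv (T x - x) + (1 - r) * 1"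
    using TxV xV r by (intro add_mono mult_mono) auto
  finally have s: "s \<le> nv (T x - x) + (1 - r)" by simp
  have s0: "0 \<le> s" using yV xV by (simp add: s_def)
  show "0 \<le> 2 * (r ^ k / (1 - r)) + 2 * (nv (T x - x) + (1 - r)) / (1 - nv x)"
    using r xV TxV by (intro add_nonneg_nonneg divide_nonneg_nonneg mult_nonneg_nonneg) auto
  show "approx r k T (eval_at V x) - eval_at V x \<in> carrier D"
    by (intro D_mem approx_D delta_D x)
  fix f assume f: "f \<in> carrier H" "vnorm H f \<le> 1"
  have lip: "cmod (f y - f x) \<le> 2 * s / (1 - nv x)"
  proof (cases "s = 0")
    case True
    then have "y - x = 0" using nv_zero_iff[of "y - x"] yV xV by (simp add: s_def)
    then show ?thesis using True by simp
  next
    case False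
    then have sp: "s > 0" using s0 by simp
    \<comment> \<open>\<open>y - x\<close> is \<open>t\<close> times a direction \<open>h\<close> of
      norm \<open>1 - nv x\<close>, along which the open unit disc stays in the ball. Assumption
      \<open>d\<close> gives \<open>t < 1 / 2\<close>, hence the factor 2.\<close>
    define t where "t = s / (1 - nv x)"
    have t: "t > 0" "t < 1 / 2" using sp s d xV by (auto simp: t_def field_simps)
    define h where "h = of_real (1 / t) \<cdot> (y - x)"
    have h: "h \<in> carrier V" "nv h = 1 - nv x" "of_real t \<cdot> h = y - x"
      using yV xV sp t by (auto simp: h_def nv_scale norm_divide s_def[symmetric]) (simp add: t_def)
    have inB: "x + l \<cdot> h \<in> B" if "cmod l < 1" for l
    proof (rule B_open[OF x])
      show "nv (x + l \<cdot> h - x) < 1 - nv x" using h(1,2) that xV by (simp add: nv_scale)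
    qed (use h xV in auto)
    have "cmod (f (x + of_real t \<cdot> h) - (\<Sum>i<1. (deriv ^^ i) (\<lambda>l. f (x + l \<cdot> h)) 0 / fact i * of_real t ^ i))
      \<le> 1 * cmod (of_real t) ^ 1 / (1 - cmod (of_real t))"
    proof (rule taylor_tail_bound)
      show "(\<lambda>l. f (x + l \<cdot> h)) holomorphic_on ball 0 1"
        using inB by (intro fd_line_holomorphic H_fd f h) auto
      show "cmod (f (x + z \<cdot> h)) \<le> 1" if "cmod z < 1" for z
        using H_cmod_le[OF f(1) inB[OF that]] f(2) by simp
    qed (use t in auto)
    then have "cmod (f y - f x) \<le> t / (1 - t)" using h(3) t by simp
    also have "\<dots> \<le> t / (1 / 2)" using t by (intro divide_left_mono) auto
    finally show ?thesis by (simp add: t_def mult.commute)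
  qed
  let ?S = "\<Sum>j<k. of_real r ^ j * homog_part j f (T x)"
  have tail: "cmod (f y - ?S) \<le> \<epsilon>"
  proof -
    have "cmod (f y - (\<Sum>i<k. homog_part i f (T x) * of_real r ^ i)) \<le> vnorm H f * cmod (of_real r) ^ k / (1 - cmod (of_real r))"
      unfolding y_def using r by (intro homog_part_tail_B f T_B x) auto
    also have "\<dots> = vnorm H f * \<epsilon>" using r by (simp add: \<epsilon>_def)
    also have "\<dots> \<le> 1 * \<epsilon>" using f \<epsilon> by (intro mult_right_mono) auto
    finally show ?thesis by (simp add: mult.commute)
  qed
  have "y \<in> B" unfolding y_def using r by (intro scale_B T_B x) auto
  then have "cmod (f y) \<le> 1" using H_cmod_le[OF f(1)] f(2) by (meson order_trans)
  then have S1: "cmod ?S \<le> 1 + \<epsilon>"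
    using tail norm_triangle_sub[of ?S "f y"] by (simp add: norm_minus_commute)
  \<comment> \<open>The normalising constant differs from 1 by
    \<open>\<epsilon> / (1 + \<epsilon>)\<close>, and the bound \<open>S1\<close> cancels the
    denominator.\<close>
  have \<kappa>: "cmod (of_real (1 / (1 + \<epsilon>)) * ?S - ?S) \<le> \<epsilon>"
  proof -
    have "of_real (1 / (1 + \<epsilon>)) * ?S - ?S = of_real (- \<epsilon> / (1 + \<epsilon>)) * ?S"
    proof -
      have "1 / (1 + \<epsilon>) - 1 = - \<epsilon> / (1 + \<epsilon>)" using \<epsilon> by (simp add: field_simps)
      then have "of_real (1 / (1 + \<epsilon>)) - 1 = (of_real (- \<epsilon> / (1 + \<epsilon>)) :: complex)"
        by (metis of_real_1 of_real_diff)
      moreover have "of_real (1 / (1 + \<epsilon>)) * ?S - ?S = (of_real (1 / (1 + \<epsilon>)) - 1) * ?S"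
        by (simp only: left_diff_distrib mult_1)
      ultimately show ?thesis by (simp only:)
    qed
    also have "cmod \<dots> = \<epsilon> / (1 + \<epsilon>) * cmod ?S" using \<epsilon> by (simp add: norm_mult norm_divide del: of_real_add of_real_divide)
    also have "\<dots> \<le> \<epsilon> / (1 + \<epsilon>) * (1 + \<epsilon>)" using \<epsilon> S1 by (intro mult_left_mono) auto
    also have "\<dots> = \<epsilon>" using \<epsilon> by simp
    finally show ?thesis .
  qed
  have "(approx r k T (eval_at V x) - eval_at V x) f = trunc r k T f x - f x"
    using f trunc_H[OF f(1)] by (simp add: approx_def eval_at_def)
  also have "trunc r k T f x = of_real (1 / (1 + \<epsilon>)) * ?S"
    using x by (simp only: trunc_def \<epsilon>_def if_True)
  also have "of_real (1 / (1 + \<epsilon>)) * ?S - f x = (of_real (1 / (1 + \<epsilon>)) * ?S - ?S) + (?S - f y) + (f y - f x)"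
    by simp
  also have "cmod \<dots> \<le> \<epsilon> + \<epsilon> + 2 * s / (1 - nv x)"
    using \<kappa> tail lip by (intro norm_triangle_mono) (auto simp: norm_minus_commute)
  also have "\<dots> \<le> 2 * \<epsilon> + 2 * (nv (T x - x) + (1 - r)) / (1 - nv x)"
    using s xV by (simp add: divide_right_mono)
  finally show "cmod ((approx r k T (eval_at V x) - eval_at V x) f) \<le>
    2 * (r ^ k / (1 - r)) + 2 * (nv (T x - x) + (1 - r)) / (1 - nv x)" by (simp add: \<epsilon>_def)
qed

end

text \<open>The net is indexed by \<open>T\<close> and a natural number \<open>n\<close>, which
  fixes \<open>r n\<close> close to 1 and then \<open>k n\<close> large enough for the truncation
  error at that \<open>r n\<close>. Convergence on evaluations extends to their span by linearity
  and to \<open>G\<close> by uniform contractivity.\<close>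

lemma CMAP_forward:
  assumes "has_CMAP V"
  shows "has_CMAP G"
proof -
  obtain \<F> :: "('v \<Rightarrow> 'v) filter" where \<F>: "\<F> \<noteq> bot"
    "\<forall>\<^sub>F T in \<F>. finite_rank V V T \<and> complete_contraction V V T"
    "\<And>x. x \<in> carrier V \<Longrightarrow> ((\<lambda>T. nv (T x - x)) \<longlongrightarrow> 0) \<F>"
    using assms unfolding has_CMAP_def by blast
  \<comment> \<open>The shift by 2 keeps \<open>r 0\<close> positive.\<close>
  define r :: "nat \<Rightarrow> real" where "r n = 1 - 1 / real (n + 2)" for n
  have r: "0 < r n" "r n < 1" for n by (auto simp: r_def field_simps)
  have "\<forall>n. \<exists>k. r n ^ k / (1 - r n) < 1 / real (Suc n)"
  proof
    fix n
    have "(1 - r n) / real (Suc n) > 0" using r[of n] by simp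
    then obtain k where "r n ^ k < (1 - r n) / real (Suc n)"
      using real_arch_pow_inv[OF _ r(2)] by blast
    then show "\<exists>k. r n ^ k / (1 - r n) < 1 / real (Suc n)"
      using r[of n] by (intro exI[of _ k]) (simp add: field_simps)
  qed
  then obtain k where k: "\<And>n. r n ^ k n / (1 - r n) < 1 / real (Suc n)" by metis
  define A where "A p = approx (r (snd p)) (k (snd p)) (fst p)" for p :: "('v \<Rightarrow> 'v) \<times> nat"
  \<comment> \<open>In the product filter \<open>T\<close> and \<open>n\<close> vary independently;
    it is proper because both factors are.\<close>
  define \<P> where "\<P> = \<F> \<times>\<^sub>F sequentially"
  have good: "\<forall>\<^sub>F p in \<P>. finite_rank V V (fst p) \<and> complete_contraction V V (fst p)"
    unfolding \<P>_def using \<F>(2) by (rule eventually_compose_filterlim[OF _ filterlim_fst])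
  have r_lim: "((\<lambda>p. 1 - r (snd p)) \<longlongrightarrow> 0) \<P>"
  proof -
    have "(\<lambda>n. 1 - r n) \<longlonglongrightarrow> 0"
    proof -
      have "(\<lambda>n. 1 - r n) = (\<lambda>n. 1 / of_nat (n + 2))" by (simp add: r_def fun_eq_iff)
      then show ?thesis
        using LIMSEQ_ignore_initial_segment[OF lim_const_over_n[of "1::real"], of 2] by (simp only:)
    qed
    then show ?thesis unfolding \<P>_def by (rule filterlim_compose[OF _ filterlim_snd])
  qed
  have k_lim: "((\<lambda>p. r (snd p) ^ k (snd p) / (1 - r (snd p))) \<longlongrightarrow> 0) \<P>"
  proof -
    have "(\<lambda>n. r n ^ k n / (1 - r n)) \<longlonglongrightarrow> 0"
    proof (rule Lim_null_comparison)
      show "\<forall>\<^sub>F n in sequentially. norm (r n ^ k n / (1 - r n)) \<le> 1 / real (Suc n)"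
        using k r by (intro always_eventually allI) (simp add: less_imp_le)
      show "(\<lambda>n. 1 / real (Suc n)) \<longlonglongrightarrow> 0"
        by (rule LIMSEQ_inverse_real_of_nat[unfolded inverse_eq_divide])
    qed
    then show ?thesis unfolding \<P>_def by (rule filterlim_compose[OF _ filterlim_snd])
  qed
  have T_lim: "((\<lambda>p. nv (fst p x - x)) \<longlongrightarrow> 0) \<P>" if "x \<in> carrier V" for x
    unfolding \<P>_def by (rule filterlim_compose[OF \<F>(3)[OF that] filterlim_fst])
  have delta_lim: "((\<lambda>p. vnorm D (A p (eval_at V x) - eval_at V x)) \<longlongrightarrow> 0) \<P>" if x: "x \<in> B" for x
  proof (rule Lim_null_comparison)
    have xV: "x \<in> carrier V" "nv x < 1" using x by (auto simp: mem_B)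
    let ?u = "\<lambda>p. nv (fst p x - x) + (1 - r (snd p))"
    have u: "(?u \<longlongrightarrow> 0 + 0) \<P>" by (intro tendsto_add T_lim xV r_lim)
    then have "\<forall>\<^sub>F p in \<P>. ?u p < (1 - nv x) / 2" using xV by (intro order_tendstoD(2)[OF u]) simp
    with good show "\<forall>\<^sub>F p in \<P>. norm (vnorm D (A p (eval_at V x) - eval_at V x)) \<le>
      2 * (r (snd p) ^ k (snd p) / (1 - r (snd p))) + 2 * ?u p / (1 - nv x)"
    proof eventually_elim
      case (elim p)
      have "approx (r (snd p)) (k (snd p)) (fst p) (eval_at V x) - eval_at V x \<in> carrier D"
        using elim by (intro D_mem approx_D r delta_D x) auto
      then show ?case unfolding A_def using elim D.vnorm_nonneg
        by (simp only: real_norm_def abs_of_nonneg) (intro approx_delta_error r x, auto)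
    qed
    have "((\<lambda>p. 2 * (r (snd p) ^ k (snd p) / (1 - r (snd p))) + 2 * ?u p / (1 - nv x)) \<longlongrightarrow>
      2 * 0 + 2 * (0 + 0) / (1 - nv x)) \<P>"
      using xV by (intro tendsto_intros k_lim T_lim r_lim) auto
    then show "((\<lambda>p. 2 * (r (snd p) ^ k (snd p) / (1 - r (snd p))) + 2 * ?u p / (1 - nv x)) \<longlongrightarrow> 0) \<P>" by simp
  qed
  have A_D: "A p \<phi> \<in> carrier D" "vnorm D (A p \<phi>) \<le> vnorm D \<phi>"
    if "complete_contraction V V (fst p)" "\<phi> \<in> carrier D" for p \<phi>
    unfolding A_def using that by (auto intro: approx_D vnorm_approx r)
  have A_lin: "A p (\<phi> + \<psi>) = A p \<phi> + A p \<psi>" "A p (\<phi> - \<psi>) = A p \<phi> - A p \<psi>" "A p (cscale D c \<phi>) = cscale D c (A p \<phi>)"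
    for p \<phi> \<psi> c
    unfolding A_def by (auto simp: approx_def fun_eq_iff D.cscale_def)
  have span_lim: "((\<lambda>p. vnorm D (A p \<psi> - \<psi>)) \<longlongrightarrow> 0) \<P>" if "\<psi> \<in> dspan" for \<psi>
  proof -
    have "\<psi> \<in> carrier D \<and> ((\<lambda>p. vnorm D (A p \<psi> - \<psi>)) \<longlongrightarrow> 0) \<P>"
      using that
    proof (induction rule: ds.span_induct)
      case base
      show ?case
      proof (rule ds.subspaceI; clarify)
        have "A p 0 = 0" for p by (auto simp: A_def approx_def fun_eq_iff)
        then show "0 \<in> carrier D \<and> ((\<lambda>p. vnorm D (A p 0 - 0)) \<longlongrightarrow> 0) \<P>" by (simp add: D_mem)
      next
        fix \<phi> \<psi> assume *: "\<phi> \<in> carrier D" "((\<lambda>p. vnorm D (A p \<phi> - \<phi>)) \<longlongrightarrow> 0) \<P>"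
          "\<psi> \<in> carrier D" "((\<lambda>p. vnorm D (A p \<psi> - \<psi>)) \<longlongrightarrow> 0) \<P>"
        have "((\<lambda>p. vnorm D (A p (\<phi> + \<psi>) - (\<phi> + \<psi>))) \<longlongrightarrow> 0) \<P>"
        proof (rule Lim_null_comparison)
          show "\<forall>\<^sub>F p in \<P>. norm (vnorm D (A p (\<phi> + \<psi>) - (\<phi> + \<psi>))) \<le> vnorm D (A p \<phi> - \<phi>) + vnorm D (A p \<psi> - \<psi>)"
            using good
          proof eventually_elim
            case (elim p)
            have m: "A p \<phi> - \<phi> \<in> carrier D" "A p \<psi> - \<psi> \<in> carrier D" using elim * by (auto intro!: D_mem A_D)
            have "A p (\<phi> + \<psi>) - (\<phi> + \<psi>) = (A p \<phi> - \<phi>) + (A p \<psi> - \<psi>)" by (simp add: A_lin)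
            then show ?case using D_vnorm_triangle[OF m] D.vnorm_nonneg[OF D_mem(1)[OF m]]
              by (simp only: real_norm_def abs_of_nonneg)
          qed
          show "((\<lambda>p. vnorm D (A p \<phi> - \<phi>) + vnorm D (A p \<psi> - \<psi>)) \<longlongrightarrow> 0) \<P>"
            using tendsto_add[OF *(2,4)] by simp
        qed
        then show "\<phi> + \<psi> \<in> carrier D \<and> ((\<lambda>p. vnorm D (A p (\<phi> + \<psi>) - (\<phi> + \<psi>))) \<longlongrightarrow> 0) \<P>"
          using * by (simp add: D_mem)
      next
        fix c \<phi> assume *: "\<phi> \<in> carrier D" "((\<lambda>p. vnorm D (A p \<phi> - \<phi>)) \<longlongrightarrow> 0) \<P>"
        have "\<forall>\<^sub>F p in \<P>. vnorm D (A p (cscale D c \<phi>) - cscale D c \<phi>) = cmod c * vnorm D (A p \<phi> - \<phi>)"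
          using good
        proof eventually_elim
          case (elim p)
          then have "A p \<phi> - \<phi> \<in> carrier D" using * by (auto intro!: D_mem A_D)
          then show ?case using D_vnorm_scale by (simp add: A_lin flip: ds.scale_right_diff_distrib)
        qed
        moreover have "((\<lambda>p. cmod c * vnorm D (A p \<phi> - \<phi>)) \<longlongrightarrow> 0) \<P>"
          using tendsto_mult_left[OF *(2), of "cmod c"] by simp
        ultimately show "cscale D c \<phi> \<in> carrier D \<and> ((\<lambda>p. vnorm D (A p (cscale D c \<phi>) - cscale D c \<phi>)) \<longlongrightarrow> 0) \<P>"
          using * by (simp add: D_mem tendsto_cong)
      qed
    next
      case (step \<psi>)
      then obtain x where x: "x \<in> B" "\<psi> = eval_at V x" by blast
      show ?case unfolding x(2) using delta_lim[OF x(1)] delta_D[OF x(1)] by blast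
    qed
    then show ?thesis by simp
  qed
  have G_lim: "((\<lambda>p. vnorm D (A p \<phi> - \<phi>)) \<longlongrightarrow> 0) \<P>" if \<phi>: "\<phi> \<in> carrier G" for \<phi>
  proof (rule tendstoI)
    fix e :: real assume "e > 0"
    then have e: "e / 3 > 0" by simp
    obtain \<psi> where \<psi>: "\<psi> \<in> dspan" "vnorm D (\<phi> - \<psi>) < e / 3" using \<phi> e unfolding mem_G by blast
    have "\<forall>\<^sub>F p in \<P>. vnorm D (A p \<psi> - \<psi>) < e / 3"
      using order_tendstoD(2)[OF span_lim[OF \<psi>(1)] e] .
    with good show "\<forall>\<^sub>F p in \<P>. dist (vnorm D (A p \<phi> - \<phi>)) 0 < e"
    proof eventually_elim
      case (elim p)
      have m: "\<phi> - \<psi> \<in> carrier D" "A p (\<phi> - \<psi>) \<in> carrier D" "A p \<psi> - \<psi> \<in> carrier D" "\<psi> - \<phi> \<in> carrier D"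
        using elim G_D[OF \<phi>] dspan_D[OF \<psi>(1)] by (auto intro!: D_mem A_D)
      \<comment> \<open>The first and last summands are small by contractivity and density, the
        middle one by convergence on the span.\<close>
      have eq: "A p \<phi> - \<phi> = A p (\<phi> - \<psi>) + ((A p \<psi> - \<psi>) + (\<psi> - \<phi>))" by (simp add: A_lin)
      have "vnorm D (A p \<phi> - \<phi>) \<le> vnorm D (A p (\<phi> - \<psi>)) + (vnorm D (A p \<psi> - \<psi>) + vnorm D (\<psi> - \<phi>))"
        unfolding eq using D_vnorm_triangle[OF m(2) D_mem(1)[OF m(3,4)]] D_vnorm_triangle[OF m(3,4)] by linarith
      moreover have "vnorm D (A p (\<phi> - \<psi>)) \<le> vnorm D (\<phi> - \<psi>)" using elim m by (intro A_D) auto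
      moreover have "vnorm D (\<psi> - \<phi>) = vnorm D (\<phi> - \<psi>)" using G_D[OF \<phi>] dspan_D[OF \<psi>(1)] by (intro D_vnorm_minus)
      moreover have "0 \<le> vnorm D (A p \<phi> - \<phi>)" unfolding eq
        by (rule D.vnorm_nonneg[OF D_mem(1)[OF m(2) D_mem(1)[OF m(3,4)]]])
      ultimately show ?case using \<psi>(2) elim by simp
    qed
  qed
  show ?thesis unfolding has_CMAP_def
  proof (intro exI[of _ "filtermap A \<P>"] conjI ballI)
    show "filtermap A \<P> \<noteq> bot" using \<F>(1) by (simp add: filtermap_bot_iff \<P>_def prod_filter_eq_bot)
    show "\<forall>\<^sub>F S in filtermap A \<P>. finite_rank G G S \<and> complete_contraction G G S"
      unfolding eventually_filtermap using good
      by eventually_elim (auto simp: A_def intro: approx_finite_rank approx_cc r)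
    fix \<phi> assume "\<phi> \<in> carrier G"
    then show "((\<lambda>S. vnorm G (S \<phi> - \<phi>)) \<longlongrightarrow> 0) (filtermap A \<P>)"
      unfolding filterlim_filtermap G_simps by (rule G_lim)
  qed
qed

end

section \<open>The matrix Hahn-Banach theorem\<close>

definition sublinear_on :: "(real \<Rightarrow> 'e::ab_group_add \<Rightarrow> 'e) \<Rightarrow> 'e set \<Rightarrow> ('e \<Rightarrow> real) \<Rightarrow> bool" where
  "sublinear_on sc S p \<longleftrightarrow> (\<forall>x\<in>S. \<forall>y\<in>S. p (x + y) \<le> p x + p y) \<and>
     (\<forall>x\<in>S. \<forall>t>0. p (sc t x) = t * p x)"

locale real_subspace = vector_space sc
  for sc :: "real \<Rightarrow> 'e::ab_group_add \<Rightarrow> 'e" +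
  fixes S :: "'e set"
  assumes S: "subspace S"
begin

lemma sublinear_0: "sublinear_on sc S p \<Longrightarrow> p 0 = 0"
proof -
  assume "sublinear_on sc S p"
  then have "\<forall>t>0. p (sc t 0) = t * p 0" using subspace_0[OF S] unfolding sublinear_on_def by blast
  then have "p (sc 2 0) = 2 * p 0" by (rule allE[of _ 2]) simp
  then show ?thesis by simp
qed

lemma sublinear_lower:
  assumes "sublinear_on sc S p" "x \<in> S" "y \<in> S"
  shows "p x - p (- y) \<le> p (x + y)"
proof -
  have "p ((x + y) + - y) \<le> p (x + y) + p (- y)"
    using assms subspace_add[OF S] subspace_neg[OF S] unfolding sublinear_on_def by blast
  then show ?thesis by simp
qed

text \<open>The reverse inequality for scaling follows from the hypothesis applied with
  \<open>1 / t\<close>.\<close>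

lemma sublinear_onI:
  assumes "\<And>x y. x \<in> S \<Longrightarrow> y \<in> S \<Longrightarrow> p (x + y) \<le> p x + p y"
    and le: "\<And>x t. x \<in> S \<Longrightarrow> t > 0 \<Longrightarrow> p (sc t x) \<le> t * p x"
  shows "sublinear_on sc S p"
  unfolding sublinear_on_def
proof (intro conjI ballI allI impI assms antisym)
  fix x and t :: real assume x: "x \<in> S" and t: "t > 0"
  have "p (sc (1 / t) (sc t x)) \<le> (1 / t) * p (sc t x)"
    using x t by (intro le subspace_scale[OF S]) auto
  then show "t * p x \<le> p (sc t x)" using t by (simp add: field_simps)
qed

text \<open>Lowering a sublinear functional in one direction; minimal functionals admit no lowering and
  are therefore additive.\<close>

definition lower :: "('e \<Rightarrow> real) \<Rightarrow> 'e \<Rightarrow> 'e \<Rightarrow> real" where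
  "lower p y x = (if x \<in> S then INF t\<in>{0..}. p (x + sc t y) - t * p y else 0)"

text \<open>The parameter 0 gives the comparison with \<open>p\<close>, the parameter 1 the value at
  \<open>- y\<close>; for subadditivity the parameters add. By \<open>sublinear_lower\<close> the
  infimum at \<open>x\<close> is bounded below by \<open>- p (- x)\<close>.\<close>

lemma lower:
  assumes p: "sublinear_on sc S p" and y: "y \<in> S"
  shows "sublinear_on sc S (lower p y)" and "x \<in> S \<Longrightarrow> lower p y x \<le> p x" and "lower p y (- y) \<le> - p y"
proof -
  have add: "p (x + x') \<le> p x + p x'" if "x \<in> S" "x' \<in> S" for x x'
    using p that by (simp add: sublinear_on_def)
  have hom: "p (sc t x) = t * p x" if "x \<in> S" "t \<ge> 0" for t x
  proof (cases "t = 0")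
    case False then show ?thesis using p that by (simp add: sublinear_on_def)
  qed (simp add: sublinear_0[OF p])
  note mem = subspace_add[OF S] subspace_neg[OF S] subspace_scale[OF S] y
  have bdd: "bdd_below ((\<lambda>t. p (x + sc t y) - t * p y) ` {0..})" if x: "x \<in> S" for x
  proof (rule bdd_belowI2)
    fix t :: real assume t: "t \<in> {0..}"
    have "p (sc t y) - p (- x) \<le> p (sc t y + x)" by (intro sublinear_lower[OF p] mem x)
    then show "- p (- x) \<le> p (x + sc t y) - t * p y" using hom[OF y] t by (simp add: add.commute)
  qed
  have le: "lower p y x \<le> p (x + sc t y) - t * p y" if "x \<in> S" "t \<ge> 0" for x t
    unfolding lower_def using that by (auto intro!: cINF_lower bdd)
  have ge: "c \<le> lower p y x" if "x \<in> S" "\<And>t. t \<ge> 0 \<Longrightarrow> c \<le> p (x + sc t y) - t * p y" for x c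
    unfolding lower_def using that by (auto intro!: cINF_greatest)
  show "lower p y x \<le> p x" if "x \<in> S" using le[OF that, of 0] by simp
  show "lower p y (- y) \<le> - p y" using le[of "- y" 1] mem sublinear_0[OF p] by simp
  show "sublinear_on sc S (lower p y)"
  proof (rule sublinear_onI)
    fix x x' assume x: "x \<in> S" "x' \<in> S"
    have "lower p y (x + x') - (p (x + sc t y) - t * p y) \<le> p (x' + sc s y) - s * p y" if "t \<ge> 0" "s \<ge> 0" for t s
    proof -
      have "lower p y (x + x') \<le> p ((x + x') + sc (t + s) y) - (t + s) * p y"
        using that x by (intro le mem) auto
      also have "(x + x') + sc (t + s) y = (x + sc t y) + (x' + sc s y)" by (simp add: scale_left_distrib algebra_simps)
      also have "p \<dots> \<le> p (x + sc t y) + p (x' + sc s y)" using x by (intro add mem)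
      finally show ?thesis by (simp add: algebra_simps)
    qed
    then have "lower p y (x + x') - (p (x + sc t y) - t * p y) \<le> lower p y x'" if "t \<ge> 0" for t
      using that x by (intro ge) auto
    then have "lower p y (x + x') - lower p y x' \<le> lower p y x" using x by (intro ge) (auto simp: algebra_simps)
    then show "lower p y (x + x') \<le> lower p y x + lower p y x'" by simp
  next
    fix x and c :: real assume x: "x \<in> S" and c: "c > 0"
    have "lower p y (sc c x) / c \<le> lower p y x"
    proof (rule ge[OF x])
      fix t :: real assume t: "t \<ge> 0"
      have "lower p y (sc c x) \<le> p (sc c x + sc (c * t) y) - (c * t) * p y"
        using c t x by (intro le mem) auto
      also have "sc c x + sc (c * t) y = sc c (x + sc t y)" by (simp add: scale_right_distrib)
      also have "p \<dots> = c * p (x + sc t y)" using c x by (intro hom mem) auto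
      finally show "lower p y (sc c x) / c \<le> p (x + sc t y) - t * p y" using c by (simp add: field_simps)
    qed
    then show "lower p y (sc c x) \<le> c * lower p y x" using c by (simp add: field_simps)
  qed
qed

text \<open>Zorn's lemma, with pointwise infima as bounds of chains. Functionals are cut off to zero
  outside \<open>S\<close> so that their values on \<open>S\<close> determine them.\<close>

lemma minimal_sublinear:
  assumes p: "sublinear_on sc S p"
  obtains m where "sublinear_on sc S m" "\<And>x. x \<in> S \<Longrightarrow> m x \<le> p x"
    "\<And>q. sublinear_on sc S q \<Longrightarrow> (\<And>x. x \<in> S \<Longrightarrow> q x \<le> m x) \<Longrightarrow> (\<And>x. x \<in> S \<Longrightarrow> q x = m x)"
proof -
  define A where "A = {q. sublinear_on sc S q \<and> (\<forall>x\<in>S. q x \<le> p x) \<and> (\<forall>x. x \<notin> S \<longrightarrow> q x = 0)}"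
  \<comment> \<open>The order is reversed, so that the maximal elements found by Zorn's lemma are
    minimal functionals.\<close>
  define P where "P = (\<lambda>(q::'e \<Rightarrow> real) q'. \<forall>x. q' x \<le> q x)"
  note mem = subspace_add[OF S] subspace_neg[OF S] subspace_scale[OF S]
  have cut: "(\<lambda>x. if x \<in> S then q x else 0) \<in> A" if "sublinear_on sc S q" "\<And>x. x \<in> S \<Longrightarrow> q x \<le> p x" for q
    using that mem unfolding A_def by (auto simp: sublinear_on_def)
  have "\<exists>m\<in>A. \<forall>a\<in>A. P m a \<longrightarrow> a = m"
  proof (rule predicate_Zorn)
    show "partial_order_on A (relation_of P A)"
      by (rule partial_order_on_relation_ofI) (auto simp: P_def fun_eq_iff intro: order_trans antisym)
    fix C assume C: "C \<in> Chains (relation_of P A)"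
    then have CA: "C \<subseteq> A" using Chains_relation_of by blast
    show "\<exists>u\<in>A. \<forall>a\<in>C. P a u"
    proof (cases "C = {}")
      case True
      then show ?thesis using cut[OF p] by blast
    next
      case False
      have tot: "P q q' \<or> P q' q" if "q \<in> C" "q' \<in> C" for q q'
        using C that unfolding Chains_def relation_of_def by blast
      define u where "u x = (INF q\<in>C. q x)" for x
      have sub: "sublinear_on sc S q" "\<And>x. x \<in> S \<Longrightarrow> q x \<le> p x" "\<And>x. x \<notin> S \<Longrightarrow> q x = 0" if "q \<in> C" for q
        using CA that unfolding A_def by auto
      have bdd: "bdd_below ((\<lambda>q. q x) ` C)" for x
      proof (cases "x \<in> S")
        case True
        show ?thesis
        proof (rule bdd_belowI2)
          fix q assume q: "q \<in> C"
          have "q 0 - q (- x) \<le> q (0 + x)" using True subspace_0[OF S] by (intro sublinear_lower[OF sub(1)[OF q]])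
          moreover have "q (- x) \<le> p (- x)" using True by (intro sub(2)[OF q] mem)
          ultimately show "- p (- x) \<le> q x" using sublinear_0[OF sub(1)[OF q]] by simp
        qed
      next
        case False
        show ?thesis
        proof (rule bdd_belowI2[of _ 0])
          fix q assume "q \<in> C"
          from sub(3)[OF this False] show "0 \<le> q x" by simp
        qed
      qed
      have ule: "u x \<le> q x" if "q \<in> C" for q x unfolding u_def by (rule cINF_lower[OF bdd that])
      have uge: "c \<le> u x" if "\<And>q. q \<in> C \<Longrightarrow> c \<le> q x" for c x
        unfolding u_def by (rule cINF_greatest[OF False that])
      have "sublinear_on sc S u"
      proof (rule sublinear_onI)
        fix x y assume x: "x \<in> S" "y \<in> S"
        \<comment> \<open>Members of a chain are comparable, so the smaller of \<open>q1\<close> and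
          \<open>q2\<close> serves for both summands.\<close>
        have le: "u (x + y) \<le> q1 x + q2 y" if q: "q1 \<in> C" "q2 \<in> C" for q1 q2
        proof -
          obtain q where "q \<in> C" "q x \<le> q1 x" "q y \<le> q2 y"
            using tot[OF q] q unfolding P_def by blast
          moreover have "q (x + y) \<le> q x + q y"
            using sub(1)[OF \<open>q \<in> C\<close>] x unfolding sublinear_on_def by blast
          ultimately show ?thesis using ule[of q "x + y"] by linarith
        qed
        have "u (x + y) - q2 y \<le> u x" if "q2 \<in> C" for q2
          by (rule uge) (use le[OF _ that] in \<open>simp add: algebra_simps\<close>)
        then have "u (x + y) - u x \<le> u y" by (intro uge) (simp add: algebra_simps)
        then show "u (x + y) \<le> u x + u y" by simp
      next
        fix x and t :: real assume x: "x \<in> S" and t: "t > 0"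
        have "u (sc t x) / t \<le> u x"
        proof (rule uge)
          fix q assume q: "q \<in> C"
          have "u (sc t x) \<le> t * q x" using ule[OF q, of "sc t x"] sub(1)[OF q] x t by (simp add: sublinear_on_def)
          then show "u (sc t x) / t \<le> q x" using t by (simp add: field_simps)
        qed
        then show "u (sc t x) \<le> t * u x" using t by (simp add: field_simps)
      qed
      moreover obtain q where "q \<in> C" using False by blast
      then have "\<forall>x\<in>S. u x \<le> p x" using ule sub(2) order_trans by blast
      moreover have "u x = 0" if "x \<notin> S" for x
      proof -
        have "(\<lambda>q. q x) ` C = (\<lambda>q. 0) ` C" using sub(3)[OF _ that] by (intro image_cong) auto
        then show ?thesis unfolding u_def using False by simp
      qed
      ultimately have "u \<in> A" unfolding A_def by blast
      then show ?thesis using ule unfolding P_def by blast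
    qed
  qed
  then obtain m where m: "m \<in> A" "\<And>a. a \<in> A \<Longrightarrow> P m a \<Longrightarrow> a = m" by blast
  show thesis
  proof (rule that[of m])
    show "sublinear_on sc S m" "\<And>x. x \<in> S \<Longrightarrow> m x \<le> p x" using m(1) by (auto simp: A_def)
    fix q x assume q: "sublinear_on sc S q" "\<And>x. x \<in> S \<Longrightarrow> q x \<le> m x" and x: "x \<in> S"
    have "(\<lambda>x. if x \<in> S then q x else 0) = m"
    proof (rule m(2))
      show "(\<lambda>x. if x \<in> S then q x else 0) \<in> A"
        using q m(1) by (intro cut) (auto simp: A_def intro: order_trans)
      show "P m (\<lambda>x. if x \<in> S then q x else 0)" using q(2) m(1) by (auto simp: P_def A_def)
    qed
    then show "q x = m x" using x by meson
  qed
qed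

text \<open>Lowering \<open>p\<close> at \<open>x0\<close> before minimising forces the value at
  \<open>- x0\<close> down to \<open>- p x0\<close>, hence equality at \<open>x0\<close>. A minimal
  functional equals its own lowering in every direction, which makes it superadditive.\<close>

theorem hahn_banach_sublinear:
  assumes p: "sublinear_on sc S p" and x0: "x0 \<in> S"
  obtains l where "\<And>x y. x \<in> S \<Longrightarrow> y \<in> S \<Longrightarrow> l (x + y) = l x + l y"
    "\<And>t x. x \<in> S \<Longrightarrow> l (sc t x) = t * l x" "\<And>x. x \<in> S \<Longrightarrow> l x \<le> p x" "l x0 = p x0"
proof -
  obtain m where m: "sublinear_on sc S m" "\<And>x. x \<in> S \<Longrightarrow> m x \<le> lower p x0 x"
    "\<And>q x. sublinear_on sc S q \<Longrightarrow> (\<And>x. x \<in> S \<Longrightarrow> q x \<le> m x) \<Longrightarrow> x \<in> S \<Longrightarrow> q x = m x"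
    using minimal_sublinear[OF lower(1)[OF p x0]] by blast
  note mem = subspace_add[OF S] subspace_neg[OF S] subspace_scale[OF S]
  have add: "m (x + y) = m x + m y" if x: "x \<in> S" and y: "y \<in> S" for x y
  proof (rule antisym)
    show "m (x + y) \<le> m x + m y" using m(1) x y by (simp add: sublinear_on_def)
    have "lower m y x = m x" by (rule m(3)[OF lower(1,2)[OF m(1) y] x])
    moreover have "lower m y x \<le> m (x + sc 1 y) - 1 * m y"
    proof -
      have "bdd_below ((\<lambda>t. m (x + sc t y) - t * m y) ` {0..})"
      proof (rule bdd_belowI2)
        fix t :: real assume t: "t \<in> {0..}"
        have "m (sc t y) - m (- x) \<le> m (sc t y + x)" by (intro sublinear_lower[OF m(1)] mem x y)
        moreover have "m (sc t y) = t * m y"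
          using t y m(1) sublinear_0[OF m(1)] by (cases "t = 0") (auto simp: sublinear_on_def)
        ultimately show "- m (- x) \<le> m (x + sc t y) - t * m y" by (simp add: add.commute)
      qed
      from cINF_lower[OF this, of 1] show ?thesis unfolding lower_def using x by simp
    qed
    ultimately show "m x + m y \<le> m (x + y)" by simp
  qed
  have neg: "m (- x) = - m x" if "x \<in> S" for x
    using add[OF that mem(2)[OF that]] sublinear_0[OF m(1)] by simp
  have hom0: "m (sc t x) = t * m x" if "x \<in> S" "t > 0" for t x
    using m(1) that unfolding sublinear_on_def by blast
  have hom: "m (sc t x) = t * m x" if x: "x \<in> S" for t x
  proof -
    consider "t > 0" | "t = 0" | "t < 0" by linarith
    then show ?thesis
    proof cases
      case 3
      then have "m (sc (- t) x) = (- t) * m x" by (intro hom0 x) simp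
      then show ?thesis using neg[OF mem(3)[OF x, of t]] by simp
    qed (use m(1) x sublinear_0[OF m(1)] in \<open>auto simp: sublinear_on_def\<close>)
  qed
  have le: "m x \<le> p x" if "x \<in> S" for x
    using m(2)[OF that] lower(2)[OF p x0 that] by simp
  have "m (- x0) \<le> - p x0" using m(2)[OF mem(2)[OF x0]] lower(3)[OF p x0] by simp
  then have "m x0 = p x0" using neg[OF x0] le[OF x0] by simp
  then show thesis using that[OF add hom le] by blast
qed

end

text \<open>Gram-Schmidt applied to the unit vectors: \<open>u\<close> is orthonormal for
  \<open>h\<close>, and \<open>c\<close> expresses the unit vectors through it. \<open>h\<close>
  acts on sequences, so positivity is asked of those that do not vanish on all indices below
  \<open>n\<close>.\<close>

lemma gram_schmidt_form:
  fixes h :: "(nat \<Rightarrow> complex) \<Rightarrow> (nat \<Rightarrow> complex) \<Rightarrow> complex"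
  assumes add: "\<And>a b b'. h a (\<lambda>i. b i + b' i) = h a b + h a b'"
    and scale: "\<And>a b c. h a (\<lambda>i. c * b i) = c * h a b"
    and sym: "\<And>a b. h b a = cnj (h a b)"
    and pos: "\<And>a i. i < n \<Longrightarrow> a i \<noteq> 0 \<Longrightarrow> Re (h a a) > 0"
  obtains u :: "nat \<Rightarrow> nat \<Rightarrow> complex" and c :: "nat \<Rightarrow> nat \<Rightarrow> complex"
  where "\<And>j i. j < n \<Longrightarrow> (if i = j then 1 else 0) = (\<Sum>k<n. c j k * u k i)"
    and "\<And>\<eta>. h (\<lambda>i. \<Sum>k<n. \<eta> k * u k i) (\<lambda>i. \<Sum>k<n. \<eta> k * u k i) = of_real (\<Sum>k<n. (cmod (\<eta> k))\<^sup>2)"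
proof -
  have zero: "h a (\<lambda>i. 0) = 0" for a using scale[of a 0 "\<lambda>i. 0"] by simp
  have sum: "h a (\<lambda>i. \<Sum>k\<in>K. \<eta> k * b k i) = (\<Sum>k\<in>K. \<eta> k * h a (b k))" for a K \<eta> and b :: "nat \<Rightarrow> nat \<Rightarrow> complex"
    by (induction K rule: infinite_finite_induct) (auto simp: zero add scale)
  have diff: "h a (\<lambda>i. b i - b' i) = h a b - h a b'" for a b b'
    using add[of a b "\<lambda>i. (-1) * b' i"] scale[of a "-1" b'] by simp
  have suml: "h (\<lambda>i. \<Sum>k\<in>K. \<eta> k * b k i) a = (\<Sum>k\<in>K. cnj (\<eta> k) * h (b k) a)" for a K \<eta> and b :: "nat \<Rightarrow> nat \<Rightarrow> complex"
    by (subst sym) (simp add: sum sym[of _ a])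
  have scalel: "h (\<lambda>i. c * b i) a = cnj c * h b a" for a b c
    by (subst sym) (simp add: scale sym[of _ a])
  define e :: "nat \<Rightarrow> nat \<Rightarrow> complex" where "e j i = (if i = j then 1 else 0)" for j i
  have "\<exists>u c. (\<forall>k<m. \<forall>i\<ge>m. u k i = 0) \<and> (\<forall>k<m. \<forall>l<m. h (u k) (u l) = (if k = l then 1 else 0)) \<and>
    (\<forall>j<m. \<forall>i. e j i = (\<Sum>k<m. c j k * u k i))" if "m \<le> n" for m
    using that
  proof (induction m)
    case 0
    show ?case by simp
  next
    case (Suc m)
    then have "m \<le> n" by simp
    from Suc.IH[OF this] obtain u c where supp': "\<forall>k<m. \<forall>i\<ge>m. u k i = 0"
      and orth': "\<forall>k<m. \<forall>l<m. h (u k) (u l) = (if k = l then 1 else 0)"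
      and rep': "\<forall>j<m. \<forall>i. e j i = (\<Sum>k<m. c j k * u k i)" by (elim exE conjE)
    note supp = supp'[rule_format] and orth = orth'[rule_format] and rep = rep'[rule_format]
    define \<gamma> where "\<gamma> k = h (u k) (e m)" for k
    define \<rho> where "\<rho> i = e m i - (\<Sum>k<m. \<gamma> k * u k i)" for i
    \<comment> \<open>The \<open>u k\<close> with \<open>k < m\<close> vanish at index
      \<open>m\<close>, an invariant carried for this purpose; so \<open>\<rho>\<close> is not zero
      and can be normalised.\<close>
    have "\<rho> m = 1" using supp by (simp add: \<rho>_def e_def)
    then have N: "Re (h \<rho> \<rho>) > 0" using Suc.prems by (intro pos[of m]) auto
    define N where "N = sqrt (Re (h \<rho> \<rho>))"
    have "Im (h \<rho> \<rho>) = 0" using arg_cong[OF sym[of \<rho> \<rho>], of Im] by simp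
    moreover have "N * N = Re (h \<rho> \<rho>)" using N by (simp add: N_def)
    ultimately have N': "N > 0" "h \<rho> \<rho> = of_real (N * N)"
      using N by (simp_all add: N_def complex_eq_iff del: real_sqrt_mult_self)
    have orth_\<rho>: "h (u k) \<rho> = 0" if "k < m" for k
    proof -
      have "h (u k) \<rho> = h (u k) (e m) - (\<Sum>l<m. \<gamma> l * h (u k) (u l))"
        unfolding \<rho>_def[abs_def] by (simp add: diff sum)
      also have "(\<Sum>l<m. \<gamma> l * h (u k) (u l)) = (\<Sum>l<m. if k = l then \<gamma> l else 0)"
        using orth[OF that] by (intro sum.cong) auto
      also have "\<dots> = \<gamma> k" using that by simp
      finally show ?thesis by (simp add: \<gamma>_def)
    qed
    define v where "v i = of_real (1 / N) * \<rho> i" for i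
    define u' where "u' = u(m := v)"
    define c' where "c' j k = (if j = m then if k = m then of_real N else \<gamma> k else if k = m then 0 else c j k)" for j k
    have hv: "h (u k) v = 0" "h v (u k) = 0" if "k < m" for k
    proof -
      show "h (u k) v = 0" unfolding v_def[abs_def] using orth_\<rho>[OF that] by (simp only: scale mult_zero_right)
      then show "h v (u k) = 0" by (subst sym) simp
    qed
    have hvv: "h v v = 1"
      unfolding v_def[abs_def] scale scalel N'(2) using N'(1) by simp
    show ?case
    proof (rule exI[of _ u'], rule exI[of _ c'], intro conjI allI impI)
      fix k i assume "k < Suc m" "Suc m \<le> i"
      then show "u' k i = 0" using supp by (auto simp: u'_def v_def \<rho>_def e_def less_Suc_eq)
    next
      fix k l assume "k < Suc m" "l < Suc m"
      then show "h (u' k) (u' l) = (if k = l then 1 else 0)"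
        using orth hv hvv by (auto simp: u'_def less_Suc_eq)
    next
      fix j i assume j: "j < Suc m"
      have s: "(\<Sum>k<m. c' j k * u' k i) = (\<Sum>k<m. (if j = m then \<gamma> k else c j k) * u k i)"
        by (intro sum.cong) (auto simp: c'_def u'_def)
      show "e j i = (\<Sum>k<Suc m. c' j k * u' k i)"
      proof (cases "j = m")
        case True
        then show ?thesis using s N' by (simp add: c'_def u'_def v_def \<rho>_def)
      next
        case False
        then show ?thesis using s j rep[of j i] by (simp add: c'_def)
      qed
    qed
  qed
  from this[OF order_refl] obtain u c where
    orth': "\<forall>k<n. \<forall>l<n. h (u k) (u l) = (if k = l then 1 else 0)"
    and rep': "\<forall>j<n. \<forall>i. e j i = (\<Sum>k<n. c j k * u k i)" by (elim exE conjE)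
  note orth = orth'[rule_format] and rep = rep'[rule_format]
  show thesis
  proof (rule that[where u = u and c = c])
    show "(if i = j then 1 else 0) = (\<Sum>k<n. c j k * u k i)" if "j < n" for i j
      using rep[OF that, of i] by (simp add: e_def)
    fix \<eta> :: "nat \<Rightarrow> complex"
    have "h (\<lambda>i. \<Sum>k<n. \<eta> k * u k i) (\<lambda>i. \<Sum>k<n. \<eta> k * u k i) =
      (\<Sum>k<n. cnj (\<eta> k) * (\<Sum>l<n. \<eta> l * h (u k) (u l)))" by (simp add: suml sum)
    also have "\<dots> = (\<Sum>k<n. cnj (\<eta> k) * (\<Sum>l<n. if k = l then \<eta> l else 0))"
      using orth by (intro sum.cong refl arg_cong2[where f = "(*)"]) auto
    also have "\<dots> = (\<Sum>k<n. of_real ((cmod (\<eta> k))\<^sup>2))"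
      by (intro sum.cong refl) (simp add: complex_norm_square mult.commute del: of_real_power)
    finally show "h (\<lambda>i. \<Sum>k<n. \<eta> k * u k i) (\<lambda>i. \<Sum>k<n. \<eta> k * u k i) = of_real (\<Sum>k<n. (cmod (\<eta> k))\<^sup>2)"
      by simp
  qed
qed

section \<open>Quadratic forms and complexification of functionals\<close>

lemma sum_lessThan_split: "(\<Sum>k<r + r'. f k) = (\<Sum>k<r. f k) + (\<Sum>k<r'. f (r + k :: nat) :: 'b::comm_monoid_add)"
  by (induction r') (simp_all add: add.assoc)

text \<open>Scaling \<open>w\<close> and \<open>v\<close> to norm 1 makes the arithmetic and
  geometric means coincide. Sums of squares are what the quadratic forms below produce.\<close>

lemma form_bound_amgm:
  assumes fin: "finite I" "finite J" and C: "0 \<le> C"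
    and le: "\<And>w v. cmod (\<Sum>i\<in>I. \<Sum>j\<in>J. w i * A i j * v j) \<le> C / 2 * ((l2 I w)\<^sup>2 + (l2 J v)\<^sup>2)"
  shows "form_bound I J A C"
proof (rule form_boundI[OF C])
  fix w v
  show "cmod (\<Sum>i\<in>I. \<Sum>j\<in>J. w i * A i j * v j) \<le> C * l2 I w * l2 J v"
  proof (cases "l2 I w = 0 \<or> l2 J v = 0")
    case True
    then have "(\<forall>i\<in>I. w i = 0) \<or> (\<forall>j\<in>J. v j = 0)" using fin by (simp add: L2_set_eq_0_iff)
    then have "(\<Sum>i\<in>I. \<Sum>j\<in>J. w i * A i j * v j) = 0" by (auto intro!: sum.neutral)
    then show ?thesis using C by (simp add: L2_set_nonneg)
  next
    case False
    then have pos: "l2 I w > 0" "l2 J v > 0" by (auto simp: L2_set_nonneg less_le)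
    define s where "s = l2 I w"
    define t where "t = l2 J v"
    note st = pos[folded s_def t_def]
    have n: "l2 I (\<lambda>i. of_real (1 / s) * w i) = 1" "l2 J (\<lambda>j. of_real (1 / t) * v j) = 1"
      unfolding l2_scale using st by (simp_all add: s_def t_def norm_divide)
    have "(\<Sum>i\<in>I. \<Sum>j\<in>J. (of_real (1 / s) * w i) * A i j * (of_real (1 / t) * v j)) =
      of_real (1 / (s * t)) * (\<Sum>i\<in>I. \<Sum>j\<in>J. w i * A i j * v j)"
      by (simp add: sum_distrib_left mult_ac)
    then have "cmod (of_real (1 / (s * t)) * (\<Sum>i\<in>I. \<Sum>j\<in>J. w i * A i j * v j)) \<le> C / 2 * (1\<^sup>2 + 1\<^sup>2)"
      using le[of "\<lambda>i. of_real (1 / s) * w i" "\<lambda>j. of_real (1 / t) * v j"] unfolding n by metis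
    then have "1 / (s * t) * cmod (\<Sum>i\<in>I. \<Sum>j\<in>J. w i * A i j * v j) \<le> C"
      using st by (simp add: norm_mult norm_divide)
    then show ?thesis using st unfolding s_def[symmetric] t_def[symmetric] by (simp add: field_simps)
  qed
qed

text \<open>\<open>P\<close> is not assumed Hermitian: the real part discards its skew-Hermitian
  part and makes the form real linear in \<open>P\<close>.\<close>

definition qf :: "nat \<Rightarrow> (nat \<Rightarrow> nat \<Rightarrow> complex) \<Rightarrow> (nat \<Rightarrow> complex) \<Rightarrow> real" where
  "qf n P v = Re (\<Sum>i<n. \<Sum>j<n. cnj (v i) * P i j * v j)"

definition rank1 :: "(nat \<Rightarrow> complex) \<Rightarrow> nat \<Rightarrow> nat \<Rightarrow> complex" where
  "rank1 a i j = cnj (a i) * a j"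

lemma qf_add: "qf n (P + Q) v = qf n P v + qf n Q v"
  by (simp add: qf_def algebra_simps sum.distrib)

lemma qf_scale: "qf n (\<lambda>i j. of_real c * P i j) v = c * qf n P v"
proof -
  have "(\<Sum>i<n. \<Sum>j<n. cnj (v i) * (of_real c * P i j) * v j) = of_real c * (\<Sum>i<n. \<Sum>j<n. cnj (v i) * P i j * v j)"
    by (simp add: sum_distrib_left mult_ac)
  then show ?thesis by (simp add: qf_def)
qed

lemma qf_0 [simp]: "qf n 0 v = 0" by (simp add: qf_def)

lemma qf_sum: "qf n (\<Sum>k\<in>K. P k) v = (\<Sum>k\<in>K. qf n (P k) v)"
proof (induction K rule: infinite_finite_induct)
  case (insert x F)
  then show ?case by (simp only: sum.insert[OF insert.hyps] qf_add)
next
  case (infinite A)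
  then show ?case using qf_0[of n v] by (metis sum.infinite)
qed (simp only: sum.empty qf_0)

lemma qf_rank1: "qf n (rank1 a) v = (cmod (\<Sum>i<n. a i * v i))\<^sup>2"
proof -
  have "(\<Sum>i<n. \<Sum>j<n. cnj (v i) * rank1 a i j * v j) = cnj (\<Sum>i<n. a i * v i) * (\<Sum>i<n. a i * v i)"
    unfolding cnj_sum sum_product by (simp add: rank1_def mult_ac)
  also have "\<dots> = of_real ((cmod (\<Sum>i<n. a i * v i))\<^sup>2)" by (simp add: complex_norm_square mult.commute del: of_real_power)
  finally show ?thesis by (simp add: qf_def del: of_real_power)
qed

lemma qf_minus: "qf n (- P) v = - qf n P v"
  by (simp add: qf_def sum_negf)

lemma qf_unit: assumes "n > 0" shows "qf n P (\<lambda>i. if i = 0 then 1 else 0) = Re (P 0 0)"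
proof -
  have "(\<Sum>i<n. \<Sum>j<n. cnj (if i = 0 then 1 else 0) * P i j * (if j = 0 then 1 else 0)) =
    (\<Sum>i<n. if i = 0 then (\<Sum>j<n. if j = 0 then P i j else 0) else 0)"
  proof (intro sum.cong refl)
    fix i
    have "(\<Sum>j<n. cnj (if i = 0 then 1 else 0) * P i j * (if j = 0 then 1 else 0)) =
      (\<Sum>j<n. if i = 0 then (if j = 0 then P i j else 0) else 0)" by (intro sum.cong) auto
    then show "(\<Sum>j<n. cnj (if i = 0 then 1 else 0) * P i j * (if j = 0 then 1 else 0)) =
      (if i = 0 then (\<Sum>j<n. if j = 0 then P i j else 0) else 0)" by simp
  qed
  also have "\<dots> = P 0 0" using assms by simp
  finally show ?thesis by (simp add: qf_def)
qed

lemma l2_unit: "n > 0 \<Longrightarrow> l2 {..<n :: nat} (\<lambda>i. if i = 0 then 1 else 0 :: complex) = 1"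
proof -
  assume "n > 0"
  have sq: "(cmod (if b then 1 else 0))\<^sup>2 = (if b then 1 else 0)" for b by simp
  show ?thesis unfolding L2_set_def sq using \<open>n > 0\<close> by simp
qed

lemma qf_bounded: obtains K where "\<And>v. qf n P v \<le> K * (l2 {..<n} v)\<^sup>2"
proof
  fix v :: "nat \<Rightarrow> complex"
  let ?K = "\<Sum>i<n. \<Sum>j<n. cmod (P i j)"
  have "qf n P v \<le> cmod (\<Sum>i<n. \<Sum>j<n. cnj (v i) * P i j * v j)"
    unfolding qf_def by (rule complex_Re_le_cmod)
  also have "\<dots> \<le> ?K * l2 {..<n} (\<lambda>i. cnj (v i)) * l2 {..<n} v"
    by (rule form_boundD[OF form_bound_crude]) auto
  finally show "qf n P v \<le> ?K * (l2 {..<n} v)\<^sup>2" by (simp add: power2_eq_square mult.assoc)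
qed

locale complexify = vector_space scl for scl :: "complex \<Rightarrow> 'w::ab_group_add \<Rightarrow> 'w" +
  fixes S :: "'w set" and L :: "'w \<Rightarrow> real"
  assumes S: "subspace S"
    and L_add: "x \<in> S \<Longrightarrow> y \<in> S \<Longrightarrow> L (x + y) = L x + L y"
    and L_scale: "x \<in> S \<Longrightarrow> L (scl (of_real t) x) = t * L x"
begin

text \<open>The complex linear functional with real part \<open>L\<close>; the sign reflects that
  the real part of \<open>\<i>\<close> times a number is minus its imaginary part.\<close>

definition Lc :: "'w \<Rightarrow> complex" where "Lc x = of_real (L x) - \<i> * of_real (L (scl \<i> x))"

lemma Re_Lc: "Re (Lc x) = L x" by (simp add: Lc_def)

lemma Lc_add: "x \<in> S \<Longrightarrow> y \<in> S \<Longrightarrow> Lc (x + y) = Lc x + Lc y"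
  using subspace_scale[OF S] by (simp add: Lc_def scale_right_distrib L_add algebra_simps)

lemma Lc_scale:
  assumes x: "x \<in> S" shows "Lc (scl c x) = c * Lc x"
proof -
  have c: "c = of_real (Re c) + \<i> * of_real (Im c)" by (simp add: complex_eq_iff)
  note mem = subspace_scale[OF S] x
  have "scl c x = scl (of_real (Re c)) x + scl (of_real (Im c)) (scl \<i> x)"
    by (subst c) (simp add: scale_left_distrib mult.commute)
  then have 1: "L (scl c x) = Re c * L x + Im c * L (scl \<i> x)"
    using mem by (simp add: L_add L_scale del: scale_scale)
  have "\<i> * c = of_real (Re c) * \<i> + of_real (- Im c)" by (simp add: complex_eq_iff)
  then have "scl (\<i> * c) x = scl (of_real (Re c)) (scl \<i> x) + scl (of_real (- Im c)) x"
    by (simp add: scale_left_distrib scale_left_diff_distrib)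
  then have "scl \<i> (scl c x) = scl (of_real (Re c)) (scl \<i> x) + scl (of_real (- Im c)) x" by simp
  then have 2: "L (scl \<i> (scl c x)) = Re c * L (scl \<i> x) - Im c * L x"
    using mem by (simp add: L_add L_scale del: scale_scale of_real_minus)
  show ?thesis unfolding Lc_def 1 2 by (simp add: complex_eq_iff)
qed

lemma Lc_0: "Lc 0 = 0" using Lc_scale[OF subspace_0[OF S], of 0] by simp

lemma Lc_sum: "(\<And>k. k \<in> K \<Longrightarrow> x k \<in> S) \<Longrightarrow> Lc (\<Sum>k\<in>K. x k) = (\<Sum>k\<in>K. Lc (x k))"
  by (induction K rule: infinite_finite_induct) (auto simp: Lc_0 Lc_add subspace_sum[OF S])

end

context op_space
begin

text \<open>Factorisations Y = a X b with X in the unit ball, where s and t bound P + a* a and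
  Q + b* b as quadratic forms.\<close>

definition fac :: "nat \<Rightarrow> (nat \<Rightarrow> nat \<Rightarrow> 'v) \<Rightarrow> (nat \<Rightarrow> nat \<Rightarrow> complex) \<Rightarrow> (nat \<Rightarrow> nat \<Rightarrow> complex) \<Rightarrow> real \<Rightarrow> real \<Rightarrow> bool" where
  "fac n Y P Q s t \<longleftrightarrow> (\<exists>r a b X. r > 0 \<and> X \<in> Mat_over r V \<and> mnorm V X \<le> 1 \<and>
     (\<forall>i<n. \<forall>j<n. Y i j = (\<Sum>k<r. \<Sum>l<r. (a k i * b l j) \<cdot> (X $$ (k, l)))) \<and>
     (\<forall>v. qf n P v + (\<Sum>k<r. qf n (rank1 (a k)) v) \<le> s * (l2 {..<n} v)\<^sup>2) \<and>
     (\<forall>v. qf n Q v + (\<Sum>k<r. qf n (rank1 (b k)) v) \<le> t * (l2 {..<n} v)\<^sup>2))"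

lemma facI:
  assumes "r > 0" "X \<in> Mat_over r V" "mnorm V X \<le> 1"
    "\<And>i j. i < n \<Longrightarrow> j < n \<Longrightarrow> Y i j = (\<Sum>k<r. \<Sum>l<r. (a k i * b l j) \<cdot> (X $$ (k, l)))"
    "\<And>v. qf n P v + (\<Sum>k<r. qf n (rank1 (a k)) v) \<le> s * (l2 {..<n} v)\<^sup>2"
    "\<And>v. qf n Q v + (\<Sum>k<r. qf n (rank1 (b k)) v) \<le> t * (l2 {..<n} v)\<^sup>2"
  shows "fac n Y P Q s t"
  unfolding fac_def using assms by blast

text \<open>\<open>X\<close> and \<open>X'\<close> form a block diagonal matrix and the factors are
  stacked. Ruan's maximum axiom keeps the norm at most 1, while the quadratic forms of the stacked
  factors add; hence the infimum of (s + t) / 2 is subadditive.\<close>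

lemma fac_add:
  assumes "fac n Y P Q s t" "fac n Y' P' Q' s' t'"
  shows "fac n (Y + Y') (P + P') (Q + Q') (s + s') (t + t')"
proof -
  obtain r a b X where 1: "r > 0" "X \<in> Mat_over r V" "mnorm V X \<le> 1"
    "\<And>i j. i < n \<Longrightarrow> j < n \<Longrightarrow> Y i j = (\<Sum>k<r. \<Sum>l<r. (a k i * b l j) \<cdot> (X $$ (k, l)))"
    "\<And>v. qf n P v + (\<Sum>k<r. qf n (rank1 (a k)) v) \<le> s * (l2 {..<n} v)\<^sup>2"
    "\<And>v. qf n Q v + (\<Sum>k<r. qf n (rank1 (b k)) v) \<le> t * (l2 {..<n} v)\<^sup>2"
    using assms(1) unfolding fac_def by blast
  obtain r' a' b' X' where 2: "r' > 0" "X' \<in> Mat_over r' V" "mnorm V X' \<le> 1"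
    "\<And>i j. i < n \<Longrightarrow> j < n \<Longrightarrow> Y' i j = (\<Sum>k<r'. \<Sum>l<r'. (a' k i * b' l j) \<cdot> (X' $$ (k, l)))"
    "\<And>v. qf n P' v + (\<Sum>k<r'. qf n (rank1 (a' k)) v) \<le> s' * (l2 {..<n} v)\<^sup>2"
    "\<And>v. qf n Q' v + (\<Sum>k<r'. qf n (rank1 (b' k)) v) \<le> t' * (l2 {..<n} v)\<^sup>2"
    using assms(2) unfolding fac_def by blast
  let ?X = "four_block_mat X (0\<^sub>m r r') (0\<^sub>m r' r) X'"
  let ?a = "\<lambda>k. if k < r then a k else a' (k - r)" and ?b = "\<lambda>k. if k < r then b k else b' (k - r)"
  have X: "X \<in> carrier_mat r r" "X' \<in> carrier_mat r' r'" using 1(2) 2(2) by (auto simp: Mat_over_def)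
  have idx: "?X $$ (k, l) = (if k < r then if l < r then X $$ (k, l) else 0
    else if l < r then 0 else X' $$ (k - r, l - r))" if "k < r + r'" "l < r + r'" for k l
    using X that by (auto simp: index_mat_four_block)
  show ?thesis
  proof (rule facI[where r = "r + r'" and X = ?X and a = ?a and b = ?b])
    show "?X \<in> Mat_over (r + r') V"
    proof (rule Mat_overI)
      fix i j assume "i < r + r'" "j < r + r'"
      then show "?X $$ (i, j) \<in> carrier V"
        unfolding idx[OF \<open>i < r + r'\<close> \<open>j < r + r'\<close>] using 1(2) 2(2) by (auto simp: Mat_over_def)
    qed (use X in auto)
    show "mnorm V ?X \<le> 1" using mn_block[OF 1(1) 2(1) 1(2) 2(2)] 1(3) 2(3) by simp
    fix i j assume ij: "i < n" "j < n"
    have row1: "(\<Sum>l<r + r'. (?a k i * ?b l j) \<cdot> (?X $$ (k, l))) = (\<Sum>l<r. (a k i * b l j) \<cdot> (X $$ (k, l)))"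
      if "k < r" for k
      using that by (simp add: sum_lessThan_split idx)
    have row2: "(\<Sum>l<r + r'. (?a (r + k) i * ?b l j) \<cdot> (?X $$ (r + k, l))) = (\<Sum>l<r'. (a' k i * b' l j) \<cdot> (X' $$ (k, l)))"
      if "k < r'" for k
      using that by (simp add: sum_lessThan_split idx)
    have "(\<Sum>k<r + r'. \<Sum>l<r + r'. (?a k i * ?b l j) \<cdot> (?X $$ (k, l))) =
      (\<Sum>k<r. \<Sum>l<r. (a k i * b l j) \<cdot> (X $$ (k, l))) + (\<Sum>k<r'. \<Sum>l<r'. (a' k i * b' l j) \<cdot> (X' $$ (k, l)))"
    proof -
      have "(\<Sum>k<r. \<Sum>l<r + r'. (?a k i * ?b l j) \<cdot> (?X $$ (k, l))) = (\<Sum>k<r. \<Sum>l<r. (a k i * b l j) \<cdot> (X $$ (k, l)))"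
        by (rule sum.cong[OF refl], rule row1, simp)
      moreover have "(\<Sum>k<r'. \<Sum>l<r + r'. (?a (r + k) i * ?b l j) \<cdot> (?X $$ (r + k, l))) =
        (\<Sum>k<r'. \<Sum>l<r'. (a' k i * b' l j) \<cdot> (X' $$ (k, l)))"
        by (rule sum.cong[OF refl], rule row2, simp)
      ultimately show ?thesis by (simp only: sum_lessThan_split[of "\<lambda>k. \<Sum>l<r + r'. (?a k i * ?b l j) \<cdot> (?X $$ (k, l))" r r'])
    qed
    then show "(Y + Y') i j = (\<Sum>k<r + r'. \<Sum>l<r + r'. (?a k i * ?b l j) \<cdot> (?X $$ (k, l)))"
      using 1(4)[OF ij] 2(4)[OF ij] by simp
  next
    fix v
    have "(\<Sum>k<r + r'. qf n (rank1 (?a k)) v) = (\<Sum>k<r. qf n (rank1 (a k)) v) + (\<Sum>k<r'. qf n (rank1 (a' k)) v)"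
      by (simp add: sum_lessThan_split)
    then show "qf n (P + P') v + (\<Sum>k<r + r'. qf n (rank1 (?a k)) v) \<le> (s + s') * (l2 {..<n} v)\<^sup>2"
      using 1(5)[of v] 2(5)[of v] unfolding qf_add distrib_right by linarith
    have "(\<Sum>k<r + r'. qf n (rank1 (?b k)) v) = (\<Sum>k<r. qf n (rank1 (b k)) v) + (\<Sum>k<r'. qf n (rank1 (b' k)) v)"
      by (simp add: sum_lessThan_split)
    then show "qf n (Q + Q') v + (\<Sum>k<r + r'. qf n (rank1 (?b k)) v) \<le> (t + t') * (l2 {..<n} v)\<^sup>2"
      using 1(6)[of v] 2(6)[of v] unfolding qf_add distrib_right by linarith
  qed (use 1 in auto)
qed

lemma qf_rank1_scale: "qf n (rank1 (\<lambda>i. c * a i)) v = (cmod c)\<^sup>2 * qf n (rank1 a) v"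
  by (simp add: qf_rank1 norm_mult power_mult_distrib mult.assoc flip: sum_distrib_left)

text \<open>The scalar is shared by the two factors as \<open>sqrt c\<close> each, so both quadratic
  bounds scale by \<open>c\<close>.\<close>

lemma fac_scale:
  assumes "fac n Y P Q s t" and c: "c > 0"
  shows "fac n (\<lambda>i j. of_real c \<cdot> Y i j) (\<lambda>i j. of_real c * P i j) (\<lambda>i j. of_real c * Q i j) (c * s) (c * t)"
proof -
  obtain r a b X where 1: "r > 0" "X \<in> Mat_over r V" "mnorm V X \<le> 1"
    "\<And>i j. i < n \<Longrightarrow> j < n \<Longrightarrow> Y i j = (\<Sum>k<r. \<Sum>l<r. (a k i * b l j) \<cdot> (X $$ (k, l)))"
    "\<And>v. qf n P v + (\<Sum>k<r. qf n (rank1 (a k)) v) \<le> s * (l2 {..<n} v)\<^sup>2"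
    "\<And>v. qf n Q v + (\<Sum>k<r. qf n (rank1 (b k)) v) \<le> t * (l2 {..<n} v)\<^sup>2"
    using assms(1) unfolding fac_def by blast
  let ?d = "complex_of_real (sqrt c)"
  have d: "?d * ?d = of_real c" "(cmod ?d)\<^sup>2 = c" using c by (simp_all flip: of_real_mult)
  show ?thesis
  proof (rule facI[OF 1(1-3), where a = "\<lambda>k i. ?d * a k i" and b = "\<lambda>k i. ?d * b k i"])
    fix i j assume ij: "i < n" "j < n"
    have "(?d * x) * (?d * y) = of_real c * (x * y)" for x y
      unfolding d(1)[symmetric] by (simp add: mult_ac)
    then show "of_real c \<cdot> Y i j = (\<Sum>k<r. \<Sum>l<r. ((?d * a k i) * (?d * b l j)) \<cdot> (X $$ (k, l)))"
      unfolding 1(4)[OF ij] by (simp only: vs.scale_sum_right vs.scale_scale)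
  next
    fix v
    show "qf n (\<lambda>i j. of_real c * P i j) v + (\<Sum>k<r. qf n (rank1 (\<lambda>i. ?d * a k i)) v) \<le> c * s * (l2 {..<n} v)\<^sup>2"
      unfolding qf_scale qf_rank1_scale d(2) using mult_left_mono[OF 1(5)[of v], of c] c
      by (simp add: sum_distrib_left distrib_left mult.assoc)
    show "qf n (\<lambda>i j. of_real c * Q i j) v + (\<Sum>k<r. qf n (rank1 (\<lambda>i. ?d * b k i)) v) \<le> c * t * (l2 {..<n} v)\<^sup>2"
      unfolding qf_scale qf_rank1_scale d(2) using mult_left_mono[OF 1(6)[of v], of c] c
      by (simp add: sum_distrib_left distrib_left mult.assoc)
  qed
qed

text \<open>With a zero middle matrix, \<open>s\<close> and \<open>t\<close> merely bound
  \<open>P\<close> and \<open>Q\<close>; this becomes the bound on the two positive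
  functionals.\<close>

lemma fac_trivial:
  assumes "\<And>v. qf n P v \<le> s * (l2 {..<n} v)\<^sup>2" "\<And>v. qf n Q v \<le> t * (l2 {..<n} v)\<^sup>2"
  shows "fac n 0 P Q s t"
proof (rule facI[where r = 1 and X = "0\<^sub>m 1 1" and a = "\<lambda>_ _. 0" and b = "\<lambda>_ _. 0"])
  have "0\<^sub>m 1 1 \<in> Mat_over 1 V" by (auto simp: Mat_over_def)
  then show "0\<^sub>m 1 1 \<in> Mat_over 1 V" "mnorm V (0\<^sub>m 1 1) \<le> 1" using mn_zero_iff[of 1 "0\<^sub>m 1 1"] by auto
qed (use assms in \<open>auto simp: qf_rank1\<close>)

text \<open>The middle matrix is \<open>Y\<close> divided by \<open>\<tau>\<close>, with
  \<open>sqrt \<tau>\<close> times the identity on both sides; the \<open>+ 1\<close> in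
  \<open>\<tau>\<close> covers \<open>Y = 0\<close>. Thus the infimum below is over a nonempty
  set.\<close>

lemma fac_exists:
  assumes Y: "\<And>i j. Y i j \<in> carrier V" and n: "n > 0"
  shows "\<exists>s t. fac n Y P Q s t"
proof -
  define M where "M = Matrix.mat n n (\<lambda>(i, j). Y i j)"
  have M: "M \<in> Mat_over n V" using Y by (auto simp: M_def Mat_over_def)
  define \<tau> where "\<tau> = mnorm V M + 1"
  have \<tau>: "\<tau> > 0" using mn_nonneg[OF n M] by (simp add: \<tau>_def)
  let ?X = "map_mat (cscale V (of_real (1 / \<tau>))) M"
  let ?a = "\<lambda>(k::nat) (i::nat). if i = k then complex_of_real (sqrt \<tau>) else 0"
  have sq: "complex_of_real (sqrt \<tau>) * complex_of_real (sqrt \<tau>) = of_real \<tau>"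
    using \<tau> by (simp flip: of_real_mult)
  obtain K where K: "\<And>v. qf n P v \<le> K * (l2 {..<n} v)\<^sup>2" using qf_bounded by blast
  obtain K' where K': "\<And>v. qf n Q v \<le> K' * (l2 {..<n} v)\<^sup>2" using qf_bounded by blast
  have ra: "(\<Sum>k<n. qf n (rank1 (?a k)) v) = \<tau> * (l2 {..<n} v)\<^sup>2" for v
  proof -
    have "(\<Sum>i<n. ?a k i * v i) = of_real (sqrt \<tau>) * v k" if "k < n" for k
    proof -
      have "(\<Sum>i<n. ?a k i * v i) = (\<Sum>i<n. if i = k then of_real (sqrt \<tau>) * v i else 0)"
        by (intro sum.cong) auto
      then show ?thesis using that by simp
    qed
    then show ?thesis using \<tau> unfolding qf_rank1 l2_sq sum_distrib_left
      by (intro sum.cong) (auto simp: norm_mult power_mult_distrib)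
  qed
  have "fac n Y P Q (K + \<tau>) (K' + \<tau>)"
  proof (rule facI[where r = n and X = ?X and a = ?a and b = ?a])
    show "?X \<in> Mat_over n V" using M by (auto simp: Mat_over_def)
    have "mnorm V ?X = 1 / \<tau> * mnorm V M" using mn_scale[OF n M] \<tau> by (simp add: norm_divide)
    then show "mnorm V ?X \<le> 1" using \<tau> by (simp add: \<tau>_def)
    fix i j assume ij: "i < n" "j < n"
    have "(\<Sum>k<n. \<Sum>l<n. (?a k i * ?a l j) \<cdot> (?X $$ (k, l))) =
      (\<Sum>k<n. if k = i then (\<Sum>l<n. if l = j then of_real \<tau> \<cdot> (?X $$ (k, l)) else 0) else 0)"
    proof (intro sum.cong refl)
      fix k
      have "(\<Sum>l<n. (?a k i * ?a l j) \<cdot> (?X $$ (k, l))) =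
        (\<Sum>l<n. if k = i then (if l = j then of_real \<tau> \<cdot> (?X $$ (k, l)) else 0) else 0)"
        using sq by (intro sum.cong) auto
      then show "(\<Sum>l<n. (?a k i * ?a l j) \<cdot> (?X $$ (k, l))) =
        (if k = i then (\<Sum>l<n. if l = j then of_real \<tau> \<cdot> (?X $$ (k, l)) else 0) else 0)" by simp
    qed
    also have "\<dots> = (\<Sum>k<n. if k = i then of_real \<tau> \<cdot> (?X $$ (k, j)) else 0)"
      using ij by (intro sum.cong) auto
    also have "\<dots> = of_real \<tau> \<cdot> (?X $$ (i, j))" using ij by simp
    also have "\<dots> = Y i j" using ij \<tau> by (simp add: M_def)
    finally show "Y i j = (\<Sum>k<n. \<Sum>l<n. (?a k i * ?a l j) \<cdot> (?X $$ (k, l)))" by simp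
  next
    fix v
    show "qf n P v + (\<Sum>k<n. qf n (rank1 (?a k)) v) \<le> (K + \<tau>) * (l2 {..<n} v)\<^sup>2"
      unfolding ra using K[of v] by (simp add: distrib_right)
    show "qf n Q v + (\<Sum>k<n. qf n (rank1 (?a k)) v) \<le> (K' + \<tau>) * (l2 {..<n} v)\<^sup>2"
      unfolding ra using K'[of v] by (simp add: distrib_right)
  qed (rule n)
  then show ?thesis by blast
qed

text \<open>Evaluating at the first unit vector bounds \<open>s\<close> and \<open>t\<close> from
  below, so the infimum is finite.\<close>

lemma fac_lower:
  assumes "fac n Y P Q s t" "n > 0"
  shows "Re (P 0 0) \<le> s" "Re (Q 0 0) \<le> t"
proof -
  let ?e = "\<lambda>i. if i = 0 then 1 else 0 :: complex"
  obtain r a b where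
    "\<forall>v. qf n P v + (\<Sum>k<(r::nat). qf n (rank1 (a k)) v) \<le> s * (l2 {..<n} v)\<^sup>2"
    "\<forall>v. qf n Q v + (\<Sum>k<r. qf n (rank1 (b k)) v) \<le> t * (l2 {..<n} v)\<^sup>2"
    using assms(1) unfolding fac_def by blast
  then have *: "qf n P ?e + (\<Sum>k<r. qf n (rank1 (a k)) ?e) \<le> s * (l2 {..<n} ?e)\<^sup>2"
    "qf n Q ?e + (\<Sum>k<r. qf n (rank1 (b k)) ?e) \<le> t * (l2 {..<n} ?e)\<^sup>2" by blast+
  have "0 \<le> (\<Sum>k<r. qf n (rank1 (a k)) ?e)" "0 \<le> (\<Sum>k<r. qf n (rank1 (b k)) ?e)"
    by (auto simp: qf_rank1 intro!: sum_nonneg)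
  then show "Re (P 0 0) \<le> s" "Re (Q 0 0) \<le> t"
    using * assms(2) by (simp_all only: qf_unit l2_unit) simp_all
qed

text \<open>With \<open>P\<close> and \<open>Q\<close> zero, the factors have operator norm at most
  \<open>sqrt s\<close> and \<open>sqrt t\<close>. Ruan's multiplication axiom and the inequality of
  arithmetic and geometric means give the bound.\<close>

lemma fac_norm:
  assumes X0: "X0 \<in> Mat_over n V" and n: "n > 0"
    and f: "fac n (\<lambda>i j. if i < n \<and> j < n then X0 $$ (i, j) else 0) 0 0 s t"
  shows "mnorm V X0 \<le> (s + t) / 2"
proof -
  obtain r a b X where 1: "r > 0" "X \<in> Mat_over r V" "mnorm V X \<le> 1"
    "\<And>i j. i < n \<Longrightarrow> j < n \<Longrightarrow> (if i < n \<and> j < n then X0 $$ (i, j) else 0) = (\<Sum>k<r. \<Sum>l<r. (a k i * b l j) \<cdot> (X $$ (k, l)))"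
    "\<And>v. qf n 0 v + (\<Sum>k<r. qf n (rank1 (a k)) v) \<le> s * (l2 {..<n} v)\<^sup>2"
    "\<And>v. qf n 0 v + (\<Sum>k<r. qf n (rank1 (b k)) v) \<le> t * (l2 {..<n} v)\<^sup>2"
    using f unfolding fac_def by blast
  have st: "0 \<le> s" "0 \<le> t" using fac_lower[OF f n] by simp_all
  define \<alpha> where "\<alpha> = Matrix.mat n r (\<lambda>(i, k). a k i)"
  define \<beta> where "\<beta> = Matrix.mat r n (\<lambda>(k, i). b k i)"
  have c: "\<alpha> \<in> carrier_mat n r" "\<beta> \<in> carrier_mat r n" by (auto simp: \<alpha>_def \<beta>_def)
  have l2le: "l2 {..<r} (\<lambda>k. \<Sum>i<n. d k i * v i) \<le> sqrt s * l2 {..<n} v"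
    if "(\<Sum>k<r. qf n (rank1 (d k)) v) \<le> s * (l2 {..<n} v)\<^sup>2" "0 \<le> s" for d v s
  proof -
    have "(l2 {..<r} (\<lambda>k. \<Sum>i<n. d k i * v i))\<^sup>2 \<le> (sqrt s * l2 {..<n} v)\<^sup>2"
      unfolding l2_sq[where I = "{..<r}"] power_mult_distrib using that by (simp add: qf_rank1)
    then show ?thesis by (rule power2_le_imp_le) (use that(2) in \<open>simp add: L2_set_nonneg\<close>)
  qed
  have "op_norm \<alpha> \<le> sqrt s"
    unfolding op_norm_le_iff[OF c(1)]
  proof (rule form_boundI)
    fix w v :: "nat \<Rightarrow> complex"
    have "(\<Sum>i<n. \<Sum>k<r. w i * \<alpha> $$ (i, k) * v k) = (\<Sum>i<n. \<Sum>k<r. v k * (a k i * w i))"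
      by (intro sum.cong refl) (auto simp: \<alpha>_def)
    also have "\<dots> = (\<Sum>k<r. \<Sum>i<n. v k * (a k i * w i))" by (rule sum.swap)
    also have "\<dots> = (\<Sum>k<r. v k * (\<Sum>i<n. a k i * w i))" by (simp add: sum_distrib_left)
    also have "cmod \<dots> \<le> l2 {..<r} v * l2 {..<r} (\<lambda>k. \<Sum>i<n. a k i * w i)" by (rule Cauchy_Schwarz_l2)
    also have "\<dots> \<le> l2 {..<r} v * (sqrt s * l2 {..<n} w)"
    proof (rule mult_left_mono)
      show "l2 {..<r} (\<lambda>k. \<Sum>i<n. a k i * w i) \<le> sqrt s * l2 {..<n} w"
        by (rule l2le) (use 1(5)[of w] st in simp_all)
    qed (simp add: L2_set_nonneg)
    finally show "cmod (\<Sum>i<n. \<Sum>k<r. w i * \<alpha> $$ (i, k) * v k) \<le> sqrt s * l2 {..<n} w * l2 {..<r} v"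
      by (simp add: mult_ac)
  qed (use st in auto)
  moreover have "op_norm \<beta> \<le> sqrt t"
    unfolding op_norm_le_iff[OF c(2)]
  proof (rule form_boundI)
    fix w v :: "nat \<Rightarrow> complex"
    have "(\<Sum>k<r. \<Sum>i<n. w k * \<beta> $$ (k, i) * v i) = (\<Sum>k<r. w k * (\<Sum>i<n. b k i * v i))"
      by (simp add: sum_distrib_left \<beta>_def mult.assoc)
    also have "cmod \<dots> \<le> l2 {..<r} w * l2 {..<r} (\<lambda>k. \<Sum>i<n. b k i * v i)" by (rule Cauchy_Schwarz_l2)
    also have "\<dots> \<le> l2 {..<r} w * (sqrt t * l2 {..<n} v)"
    proof (rule mult_left_mono)
      show "l2 {..<r} (\<lambda>k. \<Sum>i<n. b k i * v i) \<le> sqrt t * l2 {..<n} v"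
        by (rule l2le) (use 1(6)[of v] st in simp_all)
    qed (simp add: L2_set_nonneg)
    finally show "cmod (\<Sum>k<r. \<Sum>i<n. w k * \<beta> $$ (k, i) * v i) \<le> sqrt t * l2 {..<r} w * l2 {..<n} v"
      by (simp add: mult_ac)
  qed (use st in auto)
  moreover have "two_sided_mult V \<alpha> X \<beta> = X0"
  proof (rule eq_matI)
    show "dim_row (two_sided_mult V \<alpha> X \<beta>) = dim_row X0" "dim_col (two_sided_mult V \<alpha> X \<beta>) = dim_col X0"
      using c X0 by (auto simp: two_sided_mult_def Mat_over_def)
    fix i j assume "i < dim_row X0" "j < dim_col X0"
    then have ij: "i < n" "j < n" using X0 by (auto simp: Mat_over_def)
    have d: "dim_row X = r" "dim_col X = r" using 1(2) by (auto simp: Mat_over_def)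
    show "two_sided_mult V \<alpha> X \<beta> $$ (i, j) = X0 $$ (i, j)"
      using 1(4)[OF ij] ij c by (simp add: two_sided_mult_def d) (simp add: \<alpha>_def \<beta>_def)
  qed
  ultimately have le: "mnorm V X0 \<le> op_norm \<alpha> * mnorm V X * op_norm \<beta>"
    and ab: "op_norm \<alpha> \<le> sqrt s" "op_norm \<beta> \<le> sqrt t"
    using mn_mult[OF 1(1) n 1(2) c] by auto
  have "op_norm \<alpha> * mnorm V X \<le> sqrt s * 1"
    by (rule mult_mono[OF ab(1) 1(3)]) (use st mn_nonneg[OF 1(1,2)] in auto)
  then have "op_norm \<alpha> * mnorm V X * op_norm \<beta> \<le> sqrt s * sqrt t"
    by (intro mult_mono ab(2)) (use st op_norm_nonneg in auto)
  moreover note le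
  moreover have "sqrt s * sqrt t \<le> (s + t) / 2"
    using arith_geo_mean_sqrt[OF st] by (simp add: real_sqrt_mult)
  ultimately show ?thesis by linarith
qed

end

context op_space
begin

text \<open>Hahn-Banach for the gauge \<open>p\<close> on triples, supporting it at
  \<open>X0\<close> with zero forms; \<open>LV\<close>, \<open>LA\<close> and \<open>LB\<close> are
  the three coordinates of the functional. \<open>fac_norm\<close> bounds the gauge at
  \<open>X0\<close> below by the norm. The value (s + t) / 2 makes \<open>LA\<close> and
  \<open>LB\<close> positive functionals of mass at most 1/2.\<close>

lemma norming_states:
  assumes X0: "X0 \<in> Mat_over n V" and n: "n > 0"
  obtains LV :: "(nat \<Rightarrow> nat \<Rightarrow> 'v) \<Rightarrow> real" and LA LB :: "(nat \<Rightarrow> nat \<Rightarrow> complex) \<Rightarrow> real"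
  where "\<And>Y Y'. (\<And>i j. Y i j \<in> carrier V) \<Longrightarrow> (\<And>i j. Y' i j \<in> carrier V) \<Longrightarrow> LV (Y + Y') = LV Y + LV Y'"
    and "\<And>t Y. (\<And>i j. Y i j \<in> carrier V) \<Longrightarrow> LV (\<lambda>i j. of_real t \<cdot> Y i j) = t * LV Y"
    and "\<And>P P'. LA (P + P') = LA P + LA P'" and "\<And>t P. LA (\<lambda>i j. of_real t * P i j) = t * LA P"
    and "\<And>P P'. LB (P + P') = LB P + LB P'" and "\<And>t P. LB (\<lambda>i j. of_real t * P i j) = t * LB P"
    and "\<And>P s. (\<And>v. qf n P v \<le> s * (l2 {..<n} v)\<^sup>2) \<Longrightarrow> LA P \<le> s / 2"
    and "\<And>P s. (\<And>v. qf n P v \<le> s * (l2 {..<n} v)\<^sup>2) \<Longrightarrow> LB P \<le> s / 2"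
    and "\<And>r X a b. r > 0 \<Longrightarrow> X \<in> Mat_over r V \<Longrightarrow> mnorm V X \<le> 1 \<Longrightarrow>
      LV (\<lambda>i j. \<Sum>k<r. \<Sum>l<r. (a k i * b l j) \<cdot> (X $$ (k, l))) \<le>
      LA (\<Sum>k<r. rank1 (a k)) + LB (\<Sum>k<r. rank1 (b k))"
    and "mnorm V X0 \<le> LV (\<lambda>i j. if i < n \<and> j < n then X0 $$ (i, j) else 0)"
proof -
  define sc :: "real \<Rightarrow> (nat \<Rightarrow> nat \<Rightarrow> 'v) \<times> (nat \<Rightarrow> nat \<Rightarrow> complex) \<times> (nat \<Rightarrow> nat \<Rightarrow> complex) \<Rightarrow> _" where
    "sc t x = (\<lambda>i j. of_real t \<cdot> fst x i j, \<lambda>i j. of_real t * fst (snd x) i j, \<lambda>i j. of_real t * snd (snd x) i j)" for t x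
  define S :: "((nat \<Rightarrow> nat \<Rightarrow> 'v) \<times> (nat \<Rightarrow> nat \<Rightarrow> complex) \<times> (nat \<Rightarrow> nat \<Rightarrow> complex)) set" where
    "S = {x. \<forall>i j. fst x i j \<in> carrier V}"
  have vsp: "vector_space sc"
    by unfold_locales (auto simp: sc_def prod_eq_iff fun_eq_iff vs.scale_right_distrib vs.scale_left_distrib algebra_simps)
  interpret R0: vector_space sc by (rule vsp)
  interpret R: real_subspace sc S
  proof unfold_locales
    show "R0.subspace S"
      by (intro R0.subspaceI) (auto simp: S_def sc_def)
  qed
  define W where "W x = {(s + t) / 2 | s t. fac n (fst x) (fst (snd x)) (snd (snd x)) s t}" for x
  define p where "p x = Inf (W x)" for x
  have ne: "W x \<noteq> {}" if "x \<in> S" for x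
    using fac_exists[of "fst x", OF _ n] that unfolding S_def W_def by blast
  have bdd: "bdd_below (W x)" for x
  proof (rule bdd_belowI)
    fix e assume "e \<in> W x"
    then show "(Re (fst (snd x) 0 0) + Re (snd (snd x) 0 0)) / 2 \<le> e"
      unfolding W_def using fac_lower[OF _ n] by fastforce
  qed
  have ple: "p x \<le> e" if "e \<in> W x" for x e unfolding p_def by (rule cInf_lower[OF that bdd])
  have pge: "c \<le> p x" if "x \<in> S" "\<And>e. e \<in> W x \<Longrightarrow> c \<le> e" for x c
    unfolding p_def by (rule cInf_greatest[OF ne[OF that(1)] that(2)])
  have pfac: "p (Y, P, Q) \<le> (s + t) / 2" if "fac n Y P Q s t" for Y P Q s t
    by (rule ple) (use that in \<open>auto simp: W_def\<close>)
  have sub: "sublinear_on sc S p"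
  proof (rule R.sublinear_onI)
    fix x y assume xy: "x \<in> S" "y \<in> S"
    have "e + e' \<in> W (x + y)" if e: "e \<in> W x" "e' \<in> W y" for e e'
    proof -
      obtain s t s' t' where st: "e = (s + t) / 2" "fac n (fst x) (fst (snd x)) (snd (snd x)) s t"
        "e' = (s' + t') / 2" "fac n (fst y) (fst (snd y)) (snd (snd y)) s' t'"
        using e unfolding W_def by blast
      have "e + e' = ((s + s') + (t + t')) / 2" using st by simp
      moreover have "fac n (fst (x + y)) (fst (snd (x + y))) (snd (snd (x + y))) (s + s') (t + t')"
        using fac_add[OF st(2,4)] by simp
      ultimately show ?thesis unfolding W_def by blast
    qed
    then have "p (x + y) - e' \<le> e" if "e \<in> W x" "e' \<in> W y" for e e'
      using ple[of "e + e'" "x + y"] that by fastforce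
    then have "p (x + y) - e' \<le> p x" if "e' \<in> W y" for e' using that xy by (intro pge)
    then have "p (x + y) - p x \<le> e'" if "e' \<in> W y" for e' using that by fastforce
    then have "p (x + y) - p x \<le> p y" using xy by (intro pge)
    then show "p (x + y) \<le> p x + p y" by simp
  next
    fix x and c :: real assume x: "x \<in> S" and c: "c > 0"
    have "p (sc c x) / c \<le> e" if e: "e \<in> W x" for e
    proof -
      obtain s t where st: "e = (s + t) / 2" "fac n (fst x) (fst (snd x)) (snd (snd x)) s t"
        using e unfolding W_def by blast
      have "p (sc c x) \<le> (c * s + c * t) / 2"
        unfolding sc_def by (rule pfac[OF fac_scale[OF st(2) c]])
      also have "\<dots> = c * e" using st(1) by (simp add: field_simps)
      finally show ?thesis using c by (simp add: divide_le_eq mult.commute)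
    qed
    then have "p (sc c x) / c \<le> p x" using x by (intro pge)
    then show "p (sc c x) \<le> c * p x" using c by (simp add: field_simps)
  qed
  let ?Y0 = "\<lambda>i j. if i < n \<and> j < n then X0 $$ (i, j) else 0"
  have x0: "(?Y0, 0, 0) \<in> S" using X0 by (auto simp: S_def Mat_over_def)
  obtain l where l_add: "\<And>x y. x \<in> S \<Longrightarrow> y \<in> S \<Longrightarrow> l (x + y) = l x + l y"
    and l_scale: "\<And>t x. x \<in> S \<Longrightarrow> l (sc t x) = t * l x" and l_le: "\<And>x. x \<in> S \<Longrightarrow> l x \<le> p x"
    and l_x0: "l (?Y0, 0, 0) = p (?Y0, 0, 0)"
    using R.hahn_banach_sublinear[OF sub x0] by blast
  have inS: "(Y, P, Q) \<in> S \<longleftrightarrow> (\<forall>i j. Y i j \<in> carrier V)" for Y P Q by (simp add: S_def)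
  have 0: "(0::nat \<Rightarrow> nat \<Rightarrow> complex) = (\<lambda>i j. 0)" "(0::nat \<Rightarrow> nat \<Rightarrow> 'v) = (\<lambda>i j. 0)" by (auto simp: fun_eq_iff)
  show thesis
  proof (rule that[where LV = "\<lambda>Y. l (Y, 0, 0)" and LA = "\<lambda>P. l (0, P, 0)" and LB = "\<lambda>Q. l (0, 0, Q)"])
    fix Y Y' :: "nat \<Rightarrow> nat \<Rightarrow> 'v" assume Y: "\<And>i j. Y i j \<in> carrier V" "\<And>i j. Y' i j \<in> carrier V"
    show "l (Y + Y', 0, 0) = l (Y, 0, 0) + l (Y', 0, 0)"
      using l_add[of "(Y, 0, 0)" "(Y', 0, 0)"] Y by (simp add: inS)
  next
    fix t and Y :: "nat \<Rightarrow> nat \<Rightarrow> 'v" assume Y: "\<And>i j. Y i j \<in> carrier V"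
    show "l (\<lambda>i j. of_real t \<cdot> Y i j, 0, 0) = t * l (Y, 0, 0)"
      using l_scale[of "(Y, 0, 0)" t] Y by (simp add: inS sc_def 0)
  next
    fix P P' :: "nat \<Rightarrow> nat \<Rightarrow> complex" and t :: real
    show "l (0, P + P', 0) = l (0, P, 0) + l (0, P', 0)"
      using l_add[of "(0, P, 0)" "(0, P', 0)"] by (simp add: inS)
    show "l (0, 0, P + P') = l (0, 0, P) + l (0, 0, P')"
      using l_add[of "(0, 0, P)" "(0, 0, P')"] by (simp add: inS)
    show "l (0, \<lambda>i j. of_real t * P i j, 0) = t * l (0, P, 0)"
      using l_scale[of "(0, P, 0)" t] by (simp add: inS sc_def 0)
    show "l (0, 0, \<lambda>i j. of_real t * P i j) = t * l (0, 0, P)"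
      using l_scale[of "(0, 0, P)" t] by (simp add: inS sc_def 0)
  next
    fix P :: "nat \<Rightarrow> nat \<Rightarrow> complex" and s assume P: "\<And>v. qf n P v \<le> s * (l2 {..<n} v)\<^sup>2"
    have z: "\<And>v. qf n 0 v \<le> 0 * (l2 {..<n} v)\<^sup>2" by simp
    show "l (0, P, 0) \<le> s / 2"
      using l_le[of "(0, P, 0)"] pfac[OF fac_trivial[OF P z]] by (simp add: inS)
    show "l (0, 0, P) \<le> s / 2"
      using l_le[of "(0, 0, P)"] pfac[OF fac_trivial[OF z P]] by (simp add: inS)
  next
    fix r :: nat and X and a b :: "nat \<Rightarrow> nat \<Rightarrow> complex" assume X: "r > 0" "X \<in> Mat_over r V" "mnorm V X \<le> 1"
    let ?Y = "\<lambda>i j. \<Sum>k<r. \<Sum>l<r. (a k i * b l j) \<cdot> (X $$ (k, l))"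
    let ?A = "\<Sum>k<r. rank1 (a k)" and ?B = "\<Sum>k<r. rank1 (b k)"
    \<comment> \<open>Subtracting the forms of the factors themselves gives the triple a gauge at
      most 0; linearity turns this into the inequality between \<open>LV\<close>, \<open>LA\<close>
      and \<open>LB\<close>.\<close>
    have "fac n ?Y (- ?A) (- ?B) 0 0"
      by (rule facI[OF X]) (auto simp: qf_minus qf_sum)
    then have p: "p (?Y, - ?A, - ?B) \<le> 0" using pfac by fastforce
    have Y: "?Y i j \<in> carrier V" for i j
      using X(2) by (intro vs.subspace_sum[OF subspace] scale_mem) (auto simp: Mat_over_def)
    have "l (?Y, - ?A, - ?B) \<le> p (?Y, - ?A, - ?B)" by (intro l_le) (use Y in \<open>simp add: inS\<close>)
    moreover have "l ((?Y, - ?A, - ?B) + ((0, ?A, 0) + (0, 0, ?B))) = l (?Y, - ?A, - ?B) + l ((0, ?A, 0) + (0, 0, ?B))"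
      using Y by (intro l_add) (simp_all add: inS)
    moreover have "l ((0, ?A, 0) + (0, 0, ?B)) = l (0, ?A, 0) + l (0, 0, ?B)"
      by (intro l_add) (simp_all add: inS)
    moreover have "(?Y, - ?A, - ?B) + ((0, ?A, 0) + (0, 0, ?B)) = (?Y, 0, 0)" by simp
    ultimately show "l (?Y, 0, 0) \<le> l (0, ?A, 0) + l (0, 0, ?B)" using p by simp
  next
    show "mnorm V X0 \<le> l (?Y0, 0, 0)"
      unfolding l_x0
    proof (rule pge[OF x0])
      fix e assume "e \<in> W (?Y0, 0, 0)"
      then obtain s t where "e = (s + t) / 2" "fac n ?Y0 0 0 s t" unfolding W_def by auto
      from fac_norm[OF X0 n this(2)] this(1) show "mnorm V X0 \<le> e" by linarith
    qed
  qed
qed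

end

lemma sum_fun_apply': "(\<Sum>s\<in>S. f s) x y = (\<Sum>s\<in>S. f s x y)"
  by (induction S rule: infinite_finite_induct) auto

lemma vector_space_mat_fun: "vector_space (\<lambda>c (P :: nat \<Rightarrow> nat \<Rightarrow> complex) i j. c * P i j)"
  by unfold_locales (auto simp: fun_eq_iff algebra_simps)

text \<open>An orthonormal basis for a slight perturbation of the positive form given by a state.\<close>

lemma state_basis:
  fixes L :: "(nat \<Rightarrow> nat \<Rightarrow> complex) \<Rightarrow> real" and \<epsilon> :: real
  assumes L_add: "\<And>P P'. L (P + P') = L P + L P'" and L_scale: "\<And>t P. L (\<lambda>i j. of_real t * P i j) = t * L P"
    and L_le: "\<And>P s. (\<And>v. qf n P v \<le> s * (l2 {..<n} v)\<^sup>2) \<Longrightarrow> L P \<le> s / 2" and \<epsilon>: "\<epsilon> > 0"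
  shows "\<exists>u c. (\<forall>j<n. \<forall>i. (if i = j then 1 else 0) = (\<Sum>k<n. c j k * u k i)) \<and>
    (\<forall>\<eta>. L (rank1 (\<lambda>i. \<Sum>k<n. \<eta> k * u k i)) \<le> (\<Sum>k<n. (cmod (\<eta> k))\<^sup>2) / 2) \<and>
    (\<Sum>j<n. \<Sum>k<n. (cmod (c j k))\<^sup>2) \<le> 1 + n * \<epsilon>"
proof -
  interpret C: complexify "\<lambda>c (P :: nat \<Rightarrow> nat \<Rightarrow> complex) i j. c * P i j" UNIV L
  proof -
    interpret vector_space "\<lambda>c (P :: nat \<Rightarrow> nat \<Rightarrow> complex) i j. c * P i j" by (rule vector_space_mat_fun)
    show "complexify (\<lambda>c (P :: nat \<Rightarrow> nat \<Rightarrow> complex) i j. c * P i j) UNIV L"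
      by unfold_locales (simp_all add: L_add L_scale)
  qed
  have L_neg: "L (- P) = - L P" for P
  proof -
    have "- P = (\<lambda>i j. of_real (-1) * P i j)" by (simp add: fun_eq_iff)
    then show ?thesis using L_scale[of "-1" P] by (simp only:)
  qed
  have L_pos: "0 \<le> L P" if "\<And>v. 0 \<le> qf n P v" for P
    using L_le[of "- P" 0] that by (simp add: qf_minus L_neg)
  have skew: "L P = 0" if "\<And>v. qf n P v = 0" for P
    using L_le[of P 0] L_pos[of P] that by simp
  \<comment> \<open>\<open>L\<close> does not distinguish \<open>P\<close> from its adjoint, as
    their quadratic forms agree; this yields the Hermitian symmetry that
    \<open>gram_schmidt_form\<close> demands of \<open>h\<close>.\<close>
  define adj where "adj P i j = cnj (P j i)" for P :: "nat \<Rightarrow> nat \<Rightarrow> complex" and i j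
  have qf_adj: "qf n (adj P) v = qf n P v" for P v
  proof -
    have "(\<Sum>i<n. \<Sum>j<n. cnj (v i) * adj P i j * v j) = (\<Sum>j<n. \<Sum>i<n. cnj (v i) * adj P i j * v j)"
      by (rule sum.swap)
    also have "\<dots> = cnj (\<Sum>j<n. \<Sum>i<n. cnj (v j) * P j i * v i)" by (simp add: adj_def mult_ac)
    finally have "(\<Sum>i<n. \<Sum>j<n. cnj (v i) * adj P i j * v j) = cnj (\<Sum>j<n. \<Sum>i<n. cnj (v j) * P j i * v i)" .
    then show ?thesis unfolding qf_def by (simp only: cnj.simps(1))
  qed
  have L_adj: "L (adj P) = L P" for P
  proof -
    have "L (adj P + - P) = 0" by (rule skew) (simp only: qf_add qf_minus qf_adj)
    then show ?thesis by (simp only: L_add L_neg add_eq_0_iff minus_minus)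
  qed
  have Lc_adj: "C.Lc (adj P) = cnj (C.Lc P)" for P
  proof -
    have "(\<lambda>i j. \<i> * adj P i j) = - adj (\<lambda>i j. \<i> * P i j)" by (simp add: adj_def fun_eq_iff)
    then have "L (\<lambda>i j. \<i> * adj P i j) = - L (\<lambda>i j. \<i> * P i j)" by (simp only: L_neg L_adj)
    then show ?thesis by (simp add: C.Lc_def L_adj)
  qed
  define M where "M a b i j = cnj (a i) * b j" for a b :: "nat \<Rightarrow> complex" and i j :: nat
  define ip where "ip a b = (\<Sum>i<n. cnj (a i) * b i)" for a b :: "nat \<Rightarrow> complex"
  \<comment> \<open>The factor 2 compensates the bound \<open>s / 2\<close>; the multiple
    \<open>\<epsilon>\<close> of the standard inner product makes the form strictly positive even if
    \<open>L\<close> is degenerate.\<close>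
  define h where "h a b = 2 * C.Lc (M a b) + of_real \<epsilon> * ip a b" for a b
  have M_rank1: "M a a = rank1 a" for a by (simp add: M_def rank1_def fun_eq_iff)
  have haa: "Re (h a a) = 2 * L (rank1 a) + \<epsilon> * (l2 {..<n} a)\<^sup>2" for a
  proof -
    have "ip a a = of_real ((l2 {..<n} a)\<^sup>2)"
      unfolding ip_def l2_sq of_real_sum complex_norm_square by (simp add: mult.commute)
    then show ?thesis by (simp add: h_def C.Re_Lc M_rank1 del: of_real_power)
  qed
  have rank1_pos: "0 \<le> L (rank1 a)" for a by (rule L_pos) (simp add: qf_rank1)
  obtain u c where u: "\<And>j i. j < n \<Longrightarrow> (if i = j then 1 else 0) = (\<Sum>k<n. c j k * u k i)"
    "\<And>\<eta>. h (\<lambda>i. \<Sum>k<n. \<eta> k * u k i) (\<lambda>i. \<Sum>k<n. \<eta> k * u k i) = of_real (\<Sum>k<n. (cmod (\<eta> k))\<^sup>2)"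
  proof (rule gram_schmidt_form[of h n])
    fix a b b' :: "nat \<Rightarrow> complex" and c :: complex
    have "M a (\<lambda>i. b i + b' i) = M a b + M a b'" by (simp add: M_def fun_eq_iff distrib_left)
    then have "C.Lc (M a (\<lambda>i. b i + b' i)) = C.Lc (M a b) + C.Lc (M a b')" by (simp only: C.Lc_add UNIV_I)
    then show "h a (\<lambda>i. b i + b' i) = h a b + h a b'"
      by (simp add: h_def ip_def distrib_left sum.distrib)
    have "M a (\<lambda>i. c * b i) = (\<lambda>i j. c * M a b i j)" by (simp add: M_def fun_eq_iff)
    then have "C.Lc (M a (\<lambda>i. c * b i)) = c * C.Lc (M a b)" by (simp only: C.Lc_scale UNIV_I)
    moreover have "ip a (\<lambda>i. c * b i) = c * ip a b" by (simp add: ip_def sum_distrib_left mult_ac)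
    ultimately show "h a (\<lambda>i. c * b i) = c * h a b" by (simp add: h_def algebra_simps)
    have "M b a = adj (M a b)" by (simp add: M_def adj_def fun_eq_iff)
    then have "C.Lc (M b a) = cnj (C.Lc (M a b))" by (simp only: Lc_adj)
    then show "h b a = cnj (h a b)" by (simp add: h_def ip_def mult.commute)
  next
    fix a :: "nat \<Rightarrow> complex" and i assume "i < n" "a i \<noteq> 0"
    then have "l2 {..<n} a > 0" by (subst l2_pos_iff) auto
    then show "0 < Re (h a a)" unfolding haa using rank1_pos[of a] \<epsilon> by (intro add_nonneg_pos) auto
  qed blast
  show ?thesis
  proof (rule exI[of _ u], rule exI[of _ c], intro conjI allI impI)
    show "(if i = j then 1 else 0) = (\<Sum>k<n. c j k * u k i)" if "j < n" for i j using u(1)[OF that] .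
    show "L (rank1 (\<lambda>i. \<Sum>k<n. \<eta> k * u k i)) \<le> (\<Sum>k<n. (cmod (\<eta> k))\<^sup>2) / 2" for \<eta>
    proof -
      have "2 * L (rank1 (\<lambda>i. \<Sum>k<n. \<eta> k * u k i)) \<le> Re (h (\<lambda>i. \<Sum>k<n. \<eta> k * u k i) (\<lambda>i. \<Sum>k<n. \<eta> k * u k i))"
        unfolding haa using \<epsilon> by simp
      also have "\<dots> = (\<Sum>k<n. (cmod (\<eta> k))\<^sup>2)" unfolding u(2) by (simp only: Re_complex_of_real)
      finally show ?thesis by simp
    qed
    define e :: "nat \<Rightarrow> nat \<Rightarrow> complex" where "e j i = (if i = j then 1 else 0)" for j i
    have sum_e: "(\<Sum>i<n. e j i * v i) = v j" if "j < n" for j v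
    proof -
      have "(\<Sum>i<n. e j i * v i) = (\<Sum>i<n. if i = j then v i else 0)" by (intro sum.cong) (auto simp: e_def)
      then show ?thesis using that by simp
    qed
    have "(\<Sum>k<n. (cmod (c j k))\<^sup>2) = 2 * L (rank1 (e j)) + \<epsilon>" if j: "j < n" for j
    proof -
      have ej: "e j = (\<lambda>i. \<Sum>k<n. c j k * u k i)" unfolding e_def[abs_def] using u(1)[OF j] by (rule ext)
      have "(\<Sum>k<n. (cmod (c j k))\<^sup>2) = Re (h (e j) (e j))" unfolding ej u(2) by (simp only: Re_complex_of_real)
      also have "(l2 {..<n} (e j))\<^sup>2 = 1"
      proof -
        have "(\<Sum>i<n. (cmod (e j i))\<^sup>2) = (\<Sum>i<n. if i = j then 1 else 0)" by (intro sum.cong) (auto simp: e_def)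
        then show ?thesis unfolding l2_sq using j by simp
      qed
      then have "Re (h (e j) (e j)) = 2 * L (rank1 (e j)) + \<epsilon>" unfolding haa by simp
      finally show ?thesis .
    qed
    \<comment> \<open>Summed over \<open>j\<close>, the matrices \<open>rank1 (e j)\<close> give the
      identity form, on which \<open>L\<close> is at most 1/2; this leaves 1 plus
      \<open>n * \<epsilon>\<close>.\<close>
    then have "(\<Sum>j<n. \<Sum>k<n. (cmod (c j k))\<^sup>2) = 2 * (\<Sum>j<n. L (rank1 (e j))) + n * \<epsilon>"
      by (simp add: sum.distrib sum_distrib_left)
    also have "(\<Sum>j<n. L (rank1 (e j))) = L (\<Sum>j<n. rank1 (e j))"
    proof -
      have "L 0 = 0" using skew[of 0] by simp
      then show ?thesis by (induction n) (simp_all add: L_add)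
    qed
    also have "L (\<Sum>j<n. rank1 (e j)) \<le> 1 / 2"
    proof (rule L_le)
      fix v
      have "qf n (\<Sum>j<n. rank1 (e j)) v = (\<Sum>j<n. (cmod (v j))\<^sup>2)"
        unfolding qf_sum qf_rank1 using sum_e by (intro sum.cong) auto
      then show "qf n (\<Sum>j<n. rank1 (e j)) v \<le> 1 * (l2 {..<n} v)\<^sup>2" by (simp add: l2_sq)
    qed
    finally show "(\<Sum>j<n. \<Sum>k<n. (cmod (c j k))\<^sup>2) \<le> 1 + n * \<epsilon>" by simp
  qed
qed

context op_space
begin

text \<open>The matrix Hahn-Banach theorem of Effros and Ruan.\<close>

theorem completely_contractive_norming:
  assumes X0: "X0 \<in> Mat_over n V" and n: "n > 0" and \<delta>: "\<delta> > 0"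
  obtains f :: "nat \<Rightarrow> nat \<Rightarrow> 'v \<Rightarrow> complex" where
    "\<And>k l. f k l \<in> carrier (dual_os V)"
    "\<And>r X. r > 0 \<Longrightarrow> X \<in> Mat_over r V \<Longrightarrow> mnorm V X \<le> 1 \<Longrightarrow>
       form_bound ({..<n} \<times> {..<r}) ({..<n} \<times> {..<r}) (\<lambda>(k, p) (l, q). f k l (X $$ (p, q))) 1"
    "\<And>C. form_bound ({..<n} \<times> {..<n}) ({..<n} \<times> {..<n}) (\<lambda>(k, p) (l, q). f k l (X0 $$ (p, q))) C
       \<Longrightarrow> mnorm V X0 \<le> C * (1 + \<delta>)"
proof -
  obtain LV LA LB where
    LV: "\<And>Y Y'. (\<And>i j. Y i j \<in> carrier V) \<Longrightarrow> (\<And>i j. Y' i j \<in> carrier V) \<Longrightarrow> LV (Y + Y') = LV Y + LV Y'"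
      "\<And>t Y. (\<And>i j. Y i j \<in> carrier V) \<Longrightarrow> LV (\<lambda>i j. of_real t \<cdot> Y i j) = t * LV Y"
    and LA: "\<And>P P'. LA (P + P') = LA P + LA P'" "\<And>t P. LA (\<lambda>i j. of_real t * P i j) = t * LA P"
    and LB: "\<And>P P'. LB (P + P') = LB P + LB P'" "\<And>t P. LB (\<lambda>i j. of_real t * P i j) = t * LB P"
    and LA_le: "\<And>P s. (\<And>v. qf n P v \<le> s * (l2 {..<n} v)\<^sup>2) \<Longrightarrow> LA P \<le> s / 2"
    and LB_le: "\<And>P s. (\<And>v. qf n P v \<le> s * (l2 {..<n} v)\<^sup>2) \<Longrightarrow> LB P \<le> s / 2"
    and main: "\<And>r X a b. r > 0 \<Longrightarrow> X \<in> Mat_over r V \<Longrightarrow> mnorm V X \<le> 1 \<Longrightarrow>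
      LV (\<lambda>i j. \<Sum>k<r. \<Sum>l<r. (a k i * b l j) \<cdot> (X $$ (k, l))) \<le>
      LA (\<Sum>k<r. rank1 (a k)) + LB (\<Sum>k<r. rank1 (b k))"
    and low: "mnorm V X0 \<le> LV (\<lambda>i j. if i < n \<and> j < n then X0 $$ (i, j) else 0)"
    by (rule norming_states[OF X0 n]) blast
  \<comment> \<open>The choice turns the bound \<open>1 + n * \<epsilon>\<close> of
    \<open>state_basis\<close> into \<open>1 + \<delta>\<close>.\<close>
  define \<epsilon> where "\<epsilon> = \<delta> / n"
  have \<epsilon>: "\<epsilon> > 0" "n * \<epsilon> = \<delta>" using \<delta> n by (simp_all add: \<epsilon>_def)
  have basis: "\<exists>u c. (\<forall>j<n. \<forall>i. (if i = j then 1 else 0) = (\<Sum>k<n. c j k * u k i)) \<and>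
    (\<forall>\<eta>. L (rank1 (\<lambda>i. \<Sum>k<n. \<eta> k * u k i)) \<le> (\<Sum>k<n. (cmod (\<eta> k))\<^sup>2) / 2) \<and>
    (\<Sum>j<n. \<Sum>k<n. (cmod (c j k))\<^sup>2) \<le> 1 + n * \<epsilon>" if L: "L = LA \<or> L = LB" for L
  proof (rule state_basis)
    show "L (P + P') = L P + L P'" for P P' using L LA(1) LB(1) by blast
    show "L (\<lambda>i j. of_real t * P i j) = t * L P" for t P using L LA(2) LB(2) by blast
    show "L P \<le> s / 2" if "\<And>v. qf n P v \<le> s * (l2 {..<n} v)\<^sup>2" for P s
      using L LA_le[OF that] LB_le[OF that] by blast
  qed (rule \<epsilon>(1))
  from basis[of LA] obtain u c where
    u': "\<forall>j<n. \<forall>i. (if i = j then 1 else 0) = (\<Sum>k<n. c j k * u k i)"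
    "\<forall>\<eta>. LA (rank1 (\<lambda>i. \<Sum>k<n. \<eta> k * u k i)) \<le> (\<Sum>k<n. (cmod (\<eta> k))\<^sup>2) / 2"
    "(\<Sum>j<n. \<Sum>k<n. (cmod (c j k))\<^sup>2) \<le> 1 + n * \<epsilon>"
    by blast
  note u = u'(1)[rule_format] u'(2)[rule_format] u'(3)
  from basis[of LB] obtain w d where
    w': "\<forall>j<n. \<forall>i. (if i = j then 1 else 0) = (\<Sum>k<n. d j k * w k i)"
    "\<forall>\<eta>. LB (rank1 (\<lambda>i. \<Sum>k<n. \<eta> k * w k i)) \<le> (\<Sum>k<n. (cmod (\<eta> k))\<^sup>2) / 2"
    "(\<Sum>j<n. \<Sum>k<n. (cmod (d j k))\<^sup>2) \<le> 1 + n * \<epsilon>"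
    by blast
  note w = w'(1)[rule_format] w'(2)[rule_format] w'(3)
  define scl where "scl c Y = (\<lambda>(i::nat) (j::nat). c \<cdot> Y i j)" for c Y
  define S where "S = {Y :: nat \<Rightarrow> nat \<Rightarrow> 'v. \<forall>i j. Y i j \<in> carrier V}"
  have vsp: "vector_space scl"
    by unfold_locales (auto simp: scl_def fun_eq_iff vs.scale_right_distrib vs.scale_left_distrib)
  interpret F0: vector_space scl by (rule vsp)
  interpret F: complexify scl S LV
  proof unfold_locales
    show "F0.subspace S" by (intro F0.subspaceI) (auto simp: S_def scl_def)
    show "LV (x + y) = LV x + LV y" if "x \<in> S" "y \<in> S" for x y using that by (intro LV) (auto simp: S_def)
    show "LV (scl (of_real t) x) = t * LV x" if "x \<in> S" for x t
      unfolding scl_def using that by (intro LV) (auto simp: S_def)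
  qed
  define el where "el k l x = (\<lambda>i j. (u k i * w l j) \<cdot> x)" for k l x
  have el: "el k l x \<in> S" if "x \<in> carrier V" for k l x using that by (simp add: S_def el_def)
  \<comment> \<open>The coefficients of the complexified \<open>LV\<close> in the orthonormal bases
    \<open>u\<close> and \<open>w\<close> of the two perturbed forms.\<close>
  define f where "f k l x = (if x \<in> carrier V then F.Lc (el k l x) else 0)" for k l x
  \<comment> \<open>\<open>X\<close> multiplied on both sides by scalar matrices with coordinates
    \<open>\<eta>\<close> and \<open>\<xi>\<close> in these bases; by \<open>expand\<close>, the
    form of \<open>f\<close> at \<open>X\<close> is the value of \<open>F.Lc\<close> on it.\<close>
  define Y where "Y \<eta> \<xi> r X = (\<lambda>i j. \<Sum>p<r. \<Sum>q<r.
    ((\<Sum>k<n. \<eta> (k, p) * u k i) * (\<Sum>l<n. \<xi> (l, q) * w l j)) \<cdot> (X $$ (p, q)))" for \<eta> \<xi> :: "nat \<times> nat \<Rightarrow> complex" and r :: nat and X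
  have expand: "F.Lc (Y \<eta> \<xi> r X) =
    (\<Sum>a\<in>{..<n} \<times> {..<r}. \<Sum>b\<in>{..<n} \<times> {..<r}. \<eta> a * (case a of (k, p) \<Rightarrow> \<lambda>(l, q). f k l (X $$ (p, q))) b * \<xi> b)"
    if X: "X \<in> Mat_over r V" for \<eta> \<xi> r X
  proof -
    let ?I = "{..<n} \<times> {..<r}"
    have Xc: "X $$ (p, q) \<in> carrier V" if "p < r" "q < r" for p q using Mat_overD(2)[OF X that] .
    have "Y \<eta> \<xi> r X = (\<Sum>a\<in>?I. \<Sum>b\<in>?I. scl (\<eta> a * \<xi> b) (el (fst a) (fst b) (X $$ (snd a, snd b))))" (is "_ = ?R")
    proof (intro ext)
      fix i j
      have "?R i j = (\<Sum>a\<in>?I. \<Sum>b\<in>?I. ((\<eta> a * u (fst a) i) * (\<xi> b * w (fst b) j)) \<cdot> (X $$ (snd a, snd b)))"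
        by (simp add: sum_fun_apply' scl_def el_def mult_ac)
      also have "\<dots> = (\<Sum>k<n. \<Sum>p<r. \<Sum>l<n. \<Sum>q<r. ((\<eta> (k, p) * u k i) * (\<xi> (l, q) * w l j)) \<cdot> (X $$ (p, q)))"
        by (simp add: sum.cartesian_product')
      also have "\<dots> = (\<Sum>p<r. \<Sum>k<n. \<Sum>l<n. \<Sum>q<r. ((\<eta> (k, p) * u k i) * (\<xi> (l, q) * w l j)) \<cdot> (X $$ (p, q)))"
        by (rule sum.swap)
      also have "\<dots> = (\<Sum>p<r. \<Sum>k<n. \<Sum>q<r. \<Sum>l<n. ((\<eta> (k, p) * u k i) * (\<xi> (l, q) * w l j)) \<cdot> (X $$ (p, q)))"
        by (rule sum.cong[OF refl], rule sum.cong[OF refl], rule sum.swap)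
      also have "\<dots> = (\<Sum>p<r. \<Sum>q<r. \<Sum>k<n. \<Sum>l<n. ((\<eta> (k, p) * u k i) * (\<xi> (l, q) * w l j)) \<cdot> (X $$ (p, q)))"
        by (rule sum.cong[OF refl], rule sum.swap)
      also have "\<dots> = Y \<eta> \<xi> r X i j"
        unfolding Y_def by (simp only: sum_product vs.scale_sum_left)
      finally show "Y \<eta> \<xi> r X i j = ?R i j" by simp
    qed
    then have "F.Lc (Y \<eta> \<xi> r X) = F.Lc ?R" by simp
    also have "\<dots> = (\<Sum>a\<in>?I. F.Lc (\<Sum>b\<in>?I. scl (\<eta> a * \<xi> b) (el (fst a) (fst b) (X $$ (snd a, snd b)))))"
      using Xc by (intro F.Lc_sum F0.subspace_sum[OF F.S] F0.subspace_scale[OF F.S] el) auto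
    also have "\<dots> = (\<Sum>a\<in>?I. \<Sum>b\<in>?I. F.Lc (scl (\<eta> a * \<xi> b) (el (fst a) (fst b) (X $$ (snd a, snd b)))))"
      using Xc by (intro sum.cong refl F.Lc_sum F0.subspace_scale[OF F.S] el) auto
    also have "\<dots> = (\<Sum>a\<in>?I. \<Sum>b\<in>?I. \<eta> a * (case a of (k, p) \<Rightarrow> \<lambda>(l, q). f k l (X $$ (p, q))) b * \<xi> b)"
    proof (intro sum.cong refl)
      fix a b assume "a \<in> ?I" "b \<in> ?I"
      then have "X $$ (snd a, snd b) \<in> carrier V" using Xc by auto
      then show "F.Lc (scl (\<eta> a * \<xi> b) (el (fst a) (fst b) (X $$ (snd a, snd b)))) =
        \<eta> a * (case a of (k, p) \<Rightarrow> \<lambda>(l, q). f k l (X $$ (p, q))) b * \<xi> b"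
        by (simp add: F.Lc_scale[OF el] f_def split_def mult_ac)
    qed
    finally show ?thesis .
  qed
  have Lsum: "L (\<Sum>p<r. rank1 (a p)) \<le> (\<Sum>p<r. s p)"
    if "\<And>P P'. L (P + P') = L P + L P'" "\<And>p. L (rank1 (a p)) \<le> s p" for L :: "_ \<Rightarrow> real" and a s and r :: nat
  proof (induction r)
    case 0
    have "L (0 + 0) = L 0 + L 0" by (rule that(1))
    then have L0: "L 0 = 0" by (simp only: add_0_right add_cancel_left_right)
    show ?case by (simp only: lessThan_0 sum.empty L0 order_refl)
  next
    case (Suc r)
    then show ?case using that(2)[of r] by (simp only: sum.lessThan_Suc that(1))
  qed
  have cc: "form_bound ({..<n} \<times> {..<r}) ({..<n} \<times> {..<r}) (\<lambda>(k, p) (l, q). f k l (X $$ (p, q))) 1"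
    if X: "r > 0" "X \<in> Mat_over r V" "mnorm V X \<le> 1" for r X
  proof (rule form_bound_amgm)
    let ?I = "{..<n} \<times> {..<r}"
    fix \<eta> \<xi> :: "nat \<times> nat \<Rightarrow> complex"
    let ?z = "F.Lc (Y \<eta> \<xi> r X)"
    \<comment> \<open>A phase absorbed into \<open>\<eta>\<close> makes the value real and
      nonnegative, so that the bound for the real functional \<open>LV\<close> applies.\<close>
    define \<theta> where "\<theta> = (if ?z = 0 then 1 else of_real (cmod ?z) / ?z)"
    have \<theta>: "cmod \<theta> = 1" "\<theta> * ?z = of_real (cmod ?z)" by (auto simp: \<theta>_def norm_divide)
    have "F.Lc (Y (\<lambda>a. \<theta> * \<eta> a) \<xi> r X) = \<theta> * ?z"
      unfolding expand[OF X(2)] by (simp add: sum_distrib_left mult_ac)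
    then have "cmod ?z = Re (F.Lc (Y (\<lambda>a. \<theta> * \<eta> a) \<xi> r X))" unfolding \<theta>(2) by simp
    also have "\<dots> = LV (Y (\<lambda>a. \<theta> * \<eta> a) \<xi> r X)" by (rule F.Re_Lc)
    also have "\<dots> \<le> LA (\<Sum>p<r. rank1 (\<lambda>i. \<Sum>k<n. (\<theta> * \<eta> (k, p)) * u k i)) + LB (\<Sum>q<r. rank1 (\<lambda>j. \<Sum>l<n. \<xi> (l, q) * w l j))"
      unfolding Y_def by (rule main[OF X])
    also have "LA (\<Sum>p<r. rank1 (\<lambda>i. \<Sum>k<n. (\<theta> * \<eta> (k, p)) * u k i)) \<le> (\<Sum>p<r. (\<Sum>k<n. (cmod (\<theta> * \<eta> (k, p)))\<^sup>2) / 2)"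
      by (rule Lsum[OF LA(1) u(2)])
    also have "LB (\<Sum>q<r. rank1 (\<lambda>j. \<Sum>l<n. \<xi> (l, q) * w l j)) \<le> (\<Sum>q<r. (\<Sum>l<n. (cmod (\<xi> (l, q)))\<^sup>2) / 2)"
      by (rule Lsum[OF LB(1) w(2)])
    also have "(\<Sum>p<r. (\<Sum>k<n. (cmod (\<theta> * \<eta> (k, p)))\<^sup>2) / 2) = (l2 ?I \<eta>)\<^sup>2 / 2"
      unfolding l2_sq sum.cartesian_product' by (subst sum.swap) (simp add: norm_mult \<theta>(1) sum_divide_distrib)
    also have "(\<Sum>q<r. (\<Sum>l<n. (cmod (\<xi> (l, q)))\<^sup>2) / 2) = (l2 ?I \<xi>)\<^sup>2 / 2"
      unfolding l2_sq sum.cartesian_product' by (subst sum.swap) (simp add: sum_divide_distrib)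
    finally show "cmod (\<Sum>a\<in>?I. \<Sum>b\<in>?I. \<eta> a * (case a of (k, p) \<Rightarrow> \<lambda>(l, q). f k l (X $$ (p, q))) b * \<xi> b)
      \<le> 1 / 2 * ((l2 ?I \<eta>)\<^sup>2 + (l2 ?I \<xi>)\<^sup>2)"
      unfolding expand[OF X(2)] by simp
  qed auto
  have f_add: "f k l (x + y) = f k l x + f k l y" if "x \<in> carrier V" "y \<in> carrier V" for k l x y
  proof -
    have "el k l (x + y) = el k l x + el k l y" by (simp add: el_def fun_eq_iff vs.scale_right_distrib)
    then show ?thesis using that by (simp add: f_def F.Lc_add el)
  qed
  have f_scale: "f k l (t \<cdot> x) = t * f k l x" if "x \<in> carrier V" for k l x t
  proof -
    have "el k l (t \<cdot> x) = scl t (el k l x)" by (simp add: el_def scl_def fun_eq_iff mult.commute)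
    then show ?thesis using that by (simp add: f_def F.Lc_scale el)
  qed
  have f_bound: "cmod (f k l x) \<le> nv x" if kl: "k < n" "l < n" and x: "x \<in> carrier V" for k l x
  proof (rule field_le_epsilon)
    fix e :: real assume e: "e > 0"
    define t where "t = nv x + e"
    have t: "t > 0" using e nv_nonneg[OF x] by (simp add: t_def)
    let ?X = "Matrix.mat 1 1 (\<lambda>_. of_real (1 / t) \<cdot> x)"
    have "mnorm V ?X = nv (of_real (1 / t) \<cdot> x)" by (simp add: vnorm_def)
    also have "\<dots> \<le> 1" using t e x by (simp add: nv_scale norm_divide) (simp add: t_def)
    finally have "form_bound ({..<n} \<times> {..<1::nat}) ({..<n} \<times> {..<1}) (\<lambda>(k, p) (l, q). f k l (?X $$ (p, q))) 1"
      using x by (intro cc) (auto intro!: single_Mat[simplified])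
    from form_bound_entry[OF this, of "(k, 0)" "(l, 0)"] kl
    have "cmod (f k l (of_real (1 / t) \<cdot> x)) \<le> 1" by simp
    then have "cmod (f k l x) \<le> t" using t unfolding f_scale[OF x] by (simp add: norm_mult norm_divide)
    then show "cmod (f k l x) \<le> nv x + e" by (simp add: t_def)
  qed
  have f_out: "f k l x = 0" if "x \<notin> carrier V" for k l x using that by (simp add: f_def)
  \<comment> \<open>\<open>f_bound\<close> covers only indices below \<open>n\<close>; cutting off
    gives membership in the dual for all \<open>k\<close> and \<open>l\<close>.\<close>
  define g where "g k l = (if k < n \<and> l < n then f k l else (\<lambda>x. 0))" for k l
  have g_form: "form_bound ({..<n} \<times> {..<r}) ({..<n} \<times> {..<r}) (\<lambda>(k, p) (l, q). g k l (X $$ (p, q))) C \<longleftrightarrow>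
    form_bound ({..<n} \<times> {..<r}) ({..<n} \<times> {..<r}) (\<lambda>(k, p) (l, q). f k l (X $$ (p, q))) C" for r X C
    by (rule form_bound_cong) (auto simp: g_def)
  show thesis
  proof (rule that[of g])
    fix k l
    show "g k l \<in> carrier (dual_os V)"
    proof (cases "k < n \<and> l < n")
      case True
      have "f k l \<in> carrier (dual_os V)"
        by (rule iffD2[OF mem_dual_iff[of V, OF nv_nonneg]], assumption)
          (use True f_add f_scale f_bound f_out in \<open>auto intro!: exI[of _ 1]\<close>)
      then show ?thesis using True by (simp add: g_def)
    next
      case False
      then have "g k l = (\<lambda>x. 0)" by (auto simp: g_def)
      then show ?thesis using dual_closed(1)[of V, OF nv_nonneg] by simp
    qed
  next
    fix r X assume "r > 0" "X \<in> Mat_over r V" "mnorm V X \<le> 1"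
    then show "form_bound ({..<n} \<times> {..<r}) ({..<n} \<times> {..<r}) (\<lambda>(k, p) (l, q). g k l (X $$ (p, q))) 1"
      unfolding g_form by (rule cc)
  next
    fix C assume "form_bound ({..<n} \<times> {..<n}) ({..<n} \<times> {..<n}) (\<lambda>(k, p) (l, q). g k l (X0 $$ (p, q))) C"
    then have fb: "form_bound ({..<n} \<times> {..<n}) ({..<n} \<times> {..<n}) (\<lambda>(k, p) (l, q). f k l (X0 $$ (p, q))) C"
      unfolding g_form .
    let ?I = "{..<n} \<times> {..<n}"
    \<comment> \<open>These coordinates express the unit vectors through \<open>u\<close> and
      \<open>w\<close>, so they reproduce \<open>X0\<close>; their norms are at most
      \<open>sqrt (1 + \<delta>)\<close>.\<close>
    let ?\<eta> = "\<lambda>a. c (snd a) (fst a)" and ?\<xi> = "\<lambda>a. d (snd a) (fst a)"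
    have "Y ?\<eta> ?\<xi> n X0 = (\<lambda>i j. if i < n \<and> j < n then X0 $$ (i, j) else 0)"
    proof (intro ext)
      fix i j
      have "Y ?\<eta> ?\<xi> n X0 i j = (\<Sum>p<n. \<Sum>q<n. ((if i = p then 1 else 0) * (if j = q then 1 else 0)) \<cdot> (X0 $$ (p, q)))"
        unfolding Y_def using u(1) w(1) by (intro sum.cong refl) simp
      also have "\<dots> = (\<Sum>p<n. if p = i then (\<Sum>q<n. if q = j then X0 $$ (p, q) else 0) else 0)"
      proof (intro sum.cong refl)
        fix p
        have "(\<Sum>q<n. ((if i = p then 1 else 0) * (if j = q then 1 else 0)) \<cdot> (X0 $$ (p, q))) =
          (\<Sum>q<n. if p = i then (if q = j then X0 $$ (p, q) else 0) else 0)" by (intro sum.cong) auto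
        then show "(\<Sum>q<n. ((if i = p then 1 else 0) * (if j = q then 1 else 0)) \<cdot> (X0 $$ (p, q))) =
          (if p = i then (\<Sum>q<n. if q = j then X0 $$ (p, q) else 0) else 0)" by simp
      qed
      also have "\<dots> = (if i < n \<and> j < n then X0 $$ (i, j) else 0)" by simp
      finally show "Y ?\<eta> ?\<xi> n X0 i j = (if i < n \<and> j < n then X0 $$ (i, j) else 0)" .
    qed
    then have "mnorm V X0 \<le> Re (F.Lc (Y ?\<eta> ?\<xi> n X0))" using low F.Re_Lc by simp
    also have "\<dots> \<le> cmod (F.Lc (Y ?\<eta> ?\<xi> n X0))" by (rule complex_Re_le_cmod)
    also have "\<dots> \<le> C * l2 ?I ?\<eta> * l2 ?I ?\<xi>"
      unfolding expand[OF X0] by (rule form_boundD[OF fb])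
    also have "\<dots> \<le> C * sqrt (1 + \<delta>) * sqrt (1 + \<delta>)"
    proof -
      have "(l2 ?I ?\<eta>)\<^sup>2 \<le> 1 + \<delta>" "(l2 ?I ?\<xi>)\<^sup>2 \<le> 1 + \<delta>"
        unfolding l2_sq sum.cartesian_product' using u(3) w(3) \<epsilon>(2)
        by (subst sum.swap, simp)+
      then have "l2 ?I ?\<eta> \<le> sqrt (1 + \<delta>)" "l2 ?I ?\<xi> \<le> sqrt (1 + \<delta>)" by (auto intro: real_le_rsqrt)
      then show ?thesis using form_bound_nonneg[OF fb] \<delta> by (intro mult_mono) (auto simp: L2_set_nonneg)
    qed
    also have "\<dots> = C * (1 + \<delta>)" using \<delta> by (simp add: mult.assoc)
    finally show "mnorm V X0 \<le> C * (1 + \<delta>)" .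
  qed
qed

end

section \<open>From the free space to the space\<close>

context op_space
begin

text \<open>Elements of \<open>H\<close> vanish off the ball by convention, while linear functionals
  live on all of \<open>V\<close>; this is the passage from the dual of \<open>V\<close> to
  functions on the ball.\<close>

definition restrict_B :: "('v \<Rightarrow> complex) \<Rightarrow> 'v \<Rightarrow> complex" where
  "restrict_B f x = (if x \<in> B then f x else 0)"

lemma dual_fd:
  assumes "f \<in> carrier (dual_os V)" "x \<in> carrier V"
  shows "fd f x"
  unfolding frechet_differentiable_at_def
proof (intro bexI[OF _ assms(1)] allI impI)
  fix e :: real assume "e > 0"
  then show "\<exists>d>0. \<forall>h\<in>carrier V. nv h < d \<longrightarrow> cmod (f (x + h) - f x - f h) \<le> e * nv h"
    using assms dual_add[OF assms(1)] by (intro exI[of _ 1]) simp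
qed

text \<open>Completely contractive families of functionals become test matrices for
  \<open>D\<close>. The bound for a single entry is obtained by compressing the family with unit
  vectors.\<close>

lemma restrict_tests:
  assumes f: "\<And>k l. f k l \<in> carrier (dual_os V)" and n: "n > 0"
    and cc: "\<And>r X. r > 0 \<Longrightarrow> X \<in> Mat_over r V \<Longrightarrow> mnorm V X \<le> 1 \<Longrightarrow>
       form_bound ({..<n} \<times> {..<r}) ({..<n} \<times> {..<r}) (\<lambda>(k, p) (l, q). f k l (X $$ (p, q))) 1"
  shows "Matrix.mat n n (\<lambda>(k, l). restrict_B (f k l)) \<in> tests"
proof -
  let ?F = "Matrix.mat n n (\<lambda>(k, l). restrict_B (f k l))"
  have F: "?F \<in> carrier_mat n n" by simp
  have restr: "restrict_B (f k l) (X $$ (p, q)) = f k l (X $$ (p, q))"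
    if "X \<in> matrix_unit_ball V" "X \<in> carrier_mat r r" "p < r" "q < r" for k l X p q r
    using mub_entry[OF that] by (simp add: restrict_B_def)
  have mub: "\<exists>r>0. X \<in> Mat_over r V \<and> mnorm V X \<le> 1 \<and> r = p"
    if "X \<in> matrix_unit_ball V" "X \<in> carrier_mat p p" for X p
    using that unfolding mem_mub by (force simp: Mat_over_def)
  have fb: "form_bound ({..<n} \<times> {..<p}) ({..<n} \<times> {..<p}) (\<lambda>(k, i) (l, j). restrict_B (f k l) (X $$ (i, j))) 1"
    if X: "X \<in> matrix_unit_ball V" "X \<in> carrier_mat p p" for X p
  proof -
    have "form_bound ({..<n} \<times> {..<p}) ({..<n} \<times> {..<p}) (\<lambda>(k, i) (l, j). f k l (X $$ (i, j))) 1"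
      using mub[OF X] cc by blast
    then show ?thesis
      by (subst form_bound_cong[where B = "\<lambda>(k, i) (l, j). f k l (X $$ (i, j))"]) (auto simp: restr[OF X])
  qed
  have H_mem: "restrict_B (f k l) \<in> carrier H" if kl: "k < n" "l < n" for k l
    unfolding mem_H
  proof (intro conjI ballI allI impI)
    fix x assume x: "x \<in> B"
    then have xV: "x \<in> carrier V" by (simp add: mem_B)
    show "fd (restrict_B (f k l)) x"
      by (rule fd_cong[where \<rho> = "1 - nv x" and g = "f k l", OF _ _ dual_fd[OF f xV] xV])
        (use x B_open[OF x] in \<open>auto simp: restrict_B_def mem_B\<close>)
  next
    have "form_bound {..<p} {..<p} (\<lambda>i j. restrict_B (f k l) (X $$ (i, j))) 1"
      if X: "X \<in> matrix_unit_ball V" "X \<in> carrier_mat p p" for X p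
    proof -
      let ?e = "\<lambda>m j. if j = m then 1 else 0 :: complex"
      have l2e: "l2 {..<n} (?e m) = 1" if "m < n" for m
      proof -
        have "(\<Sum>j<n. (cmod (?e m j))\<^sup>2) = (\<Sum>j<n. if j = m then 1 else 0)" by (intro sum.cong) auto
        then show ?thesis using that by (simp add: L2_set_def)
      qed
      have "form_bound {..<p} {..<p} (\<lambda>i j. \<Sum>k'<n. \<Sum>l'<n. ?e k k' * restrict_B (f k' l') (X $$ (i, j)) * ?e l l')
        (1 * l2 {..<n} (?e k) * l2 {..<n} (?e l))"
        by (rule form_bound_contract[OF _ _ fb[OF X]]) auto
      moreover have "(\<Sum>k'<n. \<Sum>l'<n. ?e k k' * restrict_B (f k' l') y * ?e l l') = restrict_B (f k l) y" for y
      proof -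
        have "(\<Sum>k'<n. \<Sum>l'<n. ?e k k' * restrict_B (f k' l') y * ?e l l') =
          (\<Sum>k'<n. if k' = k then (\<Sum>l'<n. if l' = l then restrict_B (f k' l') y else 0) else 0)"
        proof (rule sum.cong[OF refl])
          fix k'
          have "(\<Sum>l'<n. ?e k k' * restrict_B (f k' l') y * ?e l l') =
            (\<Sum>l'<n. if k' = k then (if l' = l then restrict_B (f k' l') y else 0) else 0)"
            by (rule sum.cong[OF refl]) auto
          then show "(\<Sum>l'<n. ?e k k' * restrict_B (f k' l') y * ?e l l') =
            (if k' = k then (\<Sum>l'<n. if l' = l then restrict_B (f k' l') y else 0) else 0)" by simp
        qed
        then show ?thesis using kl by simp
      qed
      ultimately show ?thesis using l2e kl by simp
    qed
    then show "bdd_above ((\<lambda>X. op_norm (map_mat (restrict_B (f k l)) X)) ` matrix_unit_ball V)"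
      by (intro iffD2[OF bdd_op_norm_iff[OF H.square]]) (use H.square in blast)+
  qed (simp add: restrict_B_def)
  have FH: "?F \<in> Mat_over n H" using H_mem by (intro Mat_overI) auto
  have "mnorm H ?F \<le> 1"
  proof (rule H.mnorm_leI_form[OF F])
    fix X p assume X: "X \<in> matrix_unit_ball V" "X \<in> carrier_mat p p"
    show "form_bound ({..<n} \<times> {..<p}) ({..<n} \<times> {..<p}) (\<lambda>(k, i) (l, j). (?F $$ (k, l)) (X $$ (i, j))) 1"
      using fb[OF X] by (subst form_bound_cong[where B = "\<lambda>(k, i) (l, j). restrict_B (f k l) (X $$ (i, j))"]) auto
  qed
  then show ?thesis unfolding mem_tests using FH n by blast
qed

text \<open>Linearisation of the inclusion of the ball, in weak form: \<open>\<phi>\<close> acts on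
  restricted functionals as \<open>x\<close> does. As a relation it respects sums and scalars before
  existence and uniqueness of \<open>x\<close> are known.\<close>

definition represents :: "(('v \<Rightarrow> complex) \<Rightarrow> complex) \<Rightarrow> 'v \<Rightarrow> bool" where
  "represents \<phi> x \<longleftrightarrow> x \<in> carrier V \<and>
     (\<forall>f \<in> carrier (dual_os V). restrict_B f \<in> carrier H \<longrightarrow> \<phi> (restrict_B f) = f x)"

text \<open>The functionals that almost norm \<open>X\<close> serve as a test matrix for
  \<open>\<Phi>\<close>; up to a shuffle of indices both sides are the same form. The slack
  \<open>\<delta>\<close> comes from \<open>completely_contractive_norming\<close>.\<close>

lemma represents_norm:
  assumes n: "n > 0" and \<Phi>: "\<Phi> \<in> Mat_over n D" and X: "X \<in> Mat_over n V"
    and rep: "\<And>i j. i < n \<Longrightarrow> j < n \<Longrightarrow> represents (\<Phi> $$ (i, j)) (X $$ (i, j))"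
  shows "mnorm V X \<le> mnorm D \<Phi>"
proof (rule field_le_epsilon)
  fix e :: real assume e: "e > 0"
  have D0: "0 \<le> mnorm D \<Phi>" by (rule D.mnorm_nonneg[OF \<Phi>])
  define \<delta> where "\<delta> = e / (mnorm D \<Phi> + 1)"
  have \<delta>: "\<delta> > 0" using e D0 by (simp add: \<delta>_def)
  obtain f where f: "\<And>k l. f k l \<in> carrier (dual_os V)"
    and cc: "\<And>r X. r > 0 \<Longrightarrow> X \<in> Mat_over r V \<Longrightarrow> mnorm V X \<le> 1 \<Longrightarrow>
       form_bound ({..<n} \<times> {..<r}) ({..<n} \<times> {..<r}) (\<lambda>(k, p) (l, q). f k l (X $$ (p, q))) 1"
    and low: "\<And>C. form_bound ({..<n} \<times> {..<n}) ({..<n} \<times> {..<n}) (\<lambda>(k, p) (l, q). f k l (X $$ (p, q))) C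
       \<Longrightarrow> mnorm V X \<le> C * (1 + \<delta>)"
    by (rule completely_contractive_norming[OF X n \<delta>]) blast
  let ?F = "Matrix.mat n n (\<lambda>(k, l). restrict_B (f k l))"
  have F: "?F \<in> tests" by (rule restrict_tests[OF f n cc])
  have FH: "restrict_B (f k l) \<in> carrier H" if "k < n" "l < n" for k l
  proof -
    have "?F \<in> Mat_over n H" using F unfolding mem_tests by (auto simp: Mat_over_def)
    then show ?thesis using Mat_overD(2)[of ?F n H k l] that by simp
  qed
  have "form_bound ({..<n} \<times> {..<n}) ({..<n} \<times> {..<n}) (\<lambda>(i, k) (j, l). (\<Phi> $$ (i, j)) (?F $$ (k, l))) (mnorm D \<Phi>)"
    by (rule D.mnorm_form[OF \<Phi> F]) simp
  then have "form_bound ({..<n} \<times> {..<n}) ({..<n} \<times> {..<n}) (\<lambda>(k, i) (l, j). (\<Phi> $$ (i, j)) (?F $$ (k, l))) (mnorm D \<Phi>)"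
    by (rule form_bound_swap[THEN iffD1])
  then have "form_bound ({..<n} \<times> {..<n}) ({..<n} \<times> {..<n}) (\<lambda>(k, i) (l, j). f k l (X $$ (i, j))) (mnorm D \<Phi>)"
    by (subst form_bound_cong[where B = "\<lambda>(k, i) (l, j). (\<Phi> $$ (i, j)) (?F $$ (k, l))"])
      (use rep f FH in \<open>auto simp: represents_def\<close>)
  from low[OF this] have "mnorm V X \<le> mnorm D \<Phi> + mnorm D \<Phi> * \<delta>" by (simp add: distrib_left)
  also have "mnorm D \<Phi> * \<delta> \<le> (mnorm D \<Phi> + 1) * \<delta>" using \<delta> by simp
  also have "\<dots> = e" using D0 by (simp add: \<delta>_def)
  finally show "mnorm V X \<le> mnorm D \<Phi> + e" by simp
qed

lemma represents_vnorm:
  assumes "\<phi> \<in> carrier D" "represents \<phi> x"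
  shows "nv x \<le> vnorm D \<phi>"
  unfolding vnorm_def
  by (rule represents_norm[OF _ D.single_Mat single_Mat]) (use assms in \<open>auto simp: represents_def\<close>)

lemma represents_add: "represents \<phi> x \<Longrightarrow> represents \<psi> y \<Longrightarrow> represents (\<phi> + \<psi>) (x + y)"
  by (auto simp: represents_def dual_add)

lemma represents_scale: "represents \<phi> x \<Longrightarrow> represents (cscale D c \<phi>) (c \<cdot> x)"
  by (auto simp: represents_def dual_scale D.cscale_def)

lemma represents_diff: "represents \<phi> x \<Longrightarrow> represents \<psi> y \<Longrightarrow> represents (\<phi> - \<psi>) (x - y)"
  using represents_add[of \<phi> x "cscale D (-1) \<psi>" "(-1) \<cdot> y"] represents_scale[of \<psi> y "-1"]
  by (simp add: represents_def)

text \<open>\<open>represents_vnorm\<close> applied to \<open>\<phi> - \<phi>\<close> and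
  \<open>x - y\<close> gives norm zero.\<close>

lemma represents_unique:
  assumes "\<phi> \<in> carrier D" "represents \<phi> x" "represents \<phi> y"
  shows "x = y"
proof -
  have "represents (\<phi> - \<phi>) (x - y)" by (intro represents_diff assms)
  then have "nv (x - y) \<le> vnorm D (\<phi> - \<phi>)" using assms(1) by (intro represents_vnorm D_mem)
  then have "nv (x - y) = 0" using assms by (simp add: represents_def order_antisym)
  then show ?thesis using nv_zero_iff[of "x - y"] assms by (simp add: represents_def)
qed

lemma represents_delta: "x \<in> B \<Longrightarrow> represents (eval_at V x) x"
  by (auto simp: represents_def eval_at_def restrict_B_def mem_B)

lemma represents_dspan: "\<psi> \<in> dspan \<Longrightarrow> \<exists>x. represents \<psi> x"
proof (induction rule: ds.span_induct)
  case base
  have "represents 0 0" using dual_scale[of _ V 0 0] by (auto simp: represents_def)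
  then show ?case
    by (intro ds.subspaceI) (auto intro: represents_add represents_scale)
next
  case (step \<psi>)
  then show ?case using represents_delta by auto
qed

text \<open>The points belonging to approximating combinations of evaluations form a Cauchy sequence
  by \<open>represents_vnorm\<close>; here the completeness of \<open>V\<close> enters. The relation
  passes to the limit since both sides are norm continuous.\<close>

lemma represents_G:
  assumes \<phi>: "\<phi> \<in> carrier G"
  shows "\<exists>x. represents \<phi> x"
proof -
  have "\<forall>n. \<exists>\<psi>\<in>dspan. vnorm D (\<phi> - \<psi>) < 1 / real (Suc n)"
    using \<phi> unfolding mem_G by (simp del: of_nat_Suc)
  then obtain \<psi> where \<psi>: "\<And>n. \<psi> n \<in> dspan" "\<And>n. vnorm D (\<phi> - \<psi> n) < 1 / real (Suc n)" by metis
  obtain s where s: "\<And>n. represents (\<psi> n) (s n)" using represents_dspan[OF \<psi>(1)] by metis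
  have sV: "s n \<in> carrier V" for n using s by (simp add: represents_def)
  note \<phi>D = G_D[OF \<phi>] and \<psi>D = dspan_D[OF \<psi>(1)]
  have dist: "nv (s k - s l) \<le> 1 / real (Suc k) + 1 / real (Suc l)" for k l
  proof -
    have "nv (s k - s l) \<le> vnorm D (\<psi> k - \<psi> l)"
      by (intro represents_vnorm represents_diff s D_mem \<psi>D)
    also have "\<psi> k - \<psi> l = (\<psi> k - \<phi>) + (\<phi> - \<psi> l)" by simp
    also have "vnorm D \<dots> \<le> vnorm D (\<psi> k - \<phi>) + vnorm D (\<phi> - \<psi> l)"
      by (intro D_vnorm_triangle D_mem \<psi>D \<phi>D)
    also have "vnorm D (\<psi> k - \<phi>) = vnorm D (\<phi> - \<psi> k)" by (intro D_vnorm_minus \<psi>D \<phi>D)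
    finally show ?thesis using \<psi>(2)[of k] \<psi>(2)[of l] by linarith
  qed
  obtain x where x: "x \<in> carrier V" "(\<lambda>k. nv (s k - x)) \<longlonglongrightarrow> 0"
  proof (rule complete_V[of s])
    fix e :: real assume "e > 0"
    then obtain N where N: "1 / real (Suc N) < e / 2"
      using nat_approx_posE[of "e / 2"] by (auto simp: inverse_eq_divide)
    have "nv (s k - s l) < e" if "k \<ge> N" "l \<ge> N" for k l
    proof -
      have "1 / real (Suc k) \<le> 1 / real (Suc N)" "1 / real (Suc l) \<le> 1 / real (Suc N)"
        using that by (auto intro!: divide_left_mono)
      then show ?thesis using dist[of k l] N by linarith
    qed
    then show "\<exists>N. \<forall>k\<ge>N. \<forall>l\<ge>N. nv (s k - s l) < e" by blast
  qed (rule sV)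
  have "\<phi> (restrict_B f) = f x" if f: "f \<in> carrier (dual_os V)" and fH: "restrict_B f \<in> carrier H" for f
  proof -
    obtain K where K: "K \<ge> 0" "\<And>y. y \<in> carrier V \<Longrightarrow> cmod (f y) \<le> K * nv y"
      using dual_boundedE[OF nv_nonneg f] by blast
    define t where "t = vnorm H (restrict_B f) + 1"
    have t: "t > 0" "vnorm H (restrict_B f) \<le> t" using H.vnorm_nonneg[OF fH] by (auto simp: t_def)
    have "vnorm H (\<lambda>x. of_real (1 / t) * restrict_B f x) \<le> 1"
      using t by (subst H.vnorm_scale[OF fH]) (simp add: norm_divide)
    then have *: "cmod (\<theta> (\<lambda>x. of_real (1 / t) * restrict_B f x)) \<le> vnorm D \<theta>" if "\<theta> \<in> carrier D" for \<theta>
      using that by (intro D_le_vnorm H.scale_closed fH)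
    have bnd: "cmod (\<theta> (restrict_B f)) \<le> t * vnorm D \<theta>" if "\<theta> \<in> carrier D" for \<theta>
      using *[OF that] t unfolding D_scale[OF that fH] by (simp add: norm_mult norm_divide field_simps)
    have "cmod (\<phi> (restrict_B f) - f x) \<le> t * (1 / real (Suc n)) + K * nv (s n - x)" for n
    proof -
      have "\<phi> (restrict_B f) - f x = (\<phi> - \<psi> n) (restrict_B f) + f (s n - x)"
      proof -
        have "f (s n) = f (s n - x) + f x" using dual_add[OF f diff_mem[OF sV x(1)] x(1)] by simp
        then show ?thesis using s[of n] f fH by (simp add: represents_def)
      qed
      also have "cmod \<dots> \<le> t * vnorm D (\<phi> - \<psi> n) + K * nv (s n - x)"
        by (intro norm_triangle_mono bnd K D_mem \<phi>D \<psi>D diff_mem sV x)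
      also have "t * vnorm D (\<phi> - \<psi> n) \<le> t * (1 / real (Suc n))"
        using t less_imp_le[OF \<psi>(2)] by (intro mult_left_mono) auto
      finally show ?thesis by simp
    qed
    moreover have "(\<lambda>n. t * (1 / real (Suc n)) + K * nv (s n - x)) \<longlonglongrightarrow> t * 0 + K * 0"
      by (intro tendsto_intros x(2)) (rule LIMSEQ_inverse_real_of_nat[unfolded inverse_eq_divide])
    ultimately have "cmod (\<phi> (restrict_B f) - f x) \<le> t * 0 + K * 0"
      by (intro LIMSEQ_le_const) auto
    then show ?thesis by simp
  qed
  then show ?thesis using x(1) unfolding represents_def by blast
qed

text \<open>The left inverse of \<open>delta_part 1\<close>; well defined on \<open>G\<close> by
  \<open>represents_G\<close> and \<open>represents_unique\<close>.\<close>

definition proj :: "(('v \<Rightarrow> complex) \<Rightarrow> complex) \<Rightarrow> 'v" where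
  "proj \<phi> = (THE x. represents \<phi> x)"

lemma proj:
  assumes "\<phi> \<in> carrier G" shows "represents \<phi> (proj \<phi>)"
  unfolding proj_def using represents_G[OF assms] represents_unique[OF G_D[OF assms]] by (metis theI)

lemma proj_eqI: "\<phi> \<in> carrier G \<Longrightarrow> represents \<phi> x \<Longrightarrow> proj \<phi> = x"
  using represents_unique[OF G_D] proj by blast

lemma proj_V: "\<phi> \<in> carrier G \<Longrightarrow> proj \<phi> \<in> carrier V"
  using proj by (simp add: represents_def)

lemma proj_add: "\<phi> \<in> carrier G \<Longrightarrow> \<psi> \<in> carrier G \<Longrightarrow> proj (\<phi> + \<psi>) = proj \<phi> + proj \<psi>"
  by (intro proj_eqI represents_add proj G_mem)

lemma proj_diff: "\<phi> \<in> carrier G \<Longrightarrow> \<psi> \<in> carrier G \<Longrightarrow> proj (\<phi> - \<psi>) = proj \<phi> - proj \<psi>"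
  by (intro proj_eqI represents_diff proj G_mem)

lemma proj_scale: "\<phi> \<in> carrier G \<Longrightarrow> proj (cscale D c \<phi>) = c \<cdot> proj \<phi>"
  by (intro proj_eqI represents_scale proj G_mem)

lemma proj_contraction:
  assumes n: "n > 0" and \<Phi>: "\<Phi> \<in> Mat_over n G"
  shows "mnorm V (map_mat proj \<Phi>) \<le> mnorm D \<Phi>"
proof (rule represents_norm[OF n])
  show "\<Phi> \<in> Mat_over n D" using \<Phi> G_D by (auto simp: Mat_over_def)
  show "map_mat proj \<Phi> \<in> Mat_over n V" using \<Phi> proj_V by (auto simp: Mat_over_def)
  show "represents (\<Phi> $$ (i, j)) (map_mat proj \<Phi> $$ (i, j))" if "i < n" "j < n" for i j
    using Mat_overD[OF \<Phi>] that by (simp add: proj)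
qed

text \<open>The derivative of the evaluation map at the origin embeds V into its free space.\<close>

lemma homog_part_1:
  assumes f: "f \<in> carrier H"
  shows "x \<in> carrier V \<Longrightarrow> y \<in> carrier V \<Longrightarrow> homog_part 1 f (x + y) = homog_part 1 f x + homog_part 1 f y"
proof -
  obtain L where L: "L \<in> carrier (dual_os V)"
    "\<And>e. e > 0 \<Longrightarrow> \<exists>d>0. \<forall>h \<in> carrier V. nv h < d \<longrightarrow> cmod (f (0 + h) - f 0 - L h) \<le> e * nv h"
    using H_fd[OF f zero_B] unfolding frechet_differentiable_at_def by blast
  have "homog_part 1 f h = L h" if "h \<in> carrier V" for h
    using DERIV_imp_deriv[OF frechet_line[OF L that]] by (simp add: homog_part_def)
  then show "x \<in> carrier V \<Longrightarrow> y \<in> carrier V \<Longrightarrow> homog_part 1 f (x + y) = homog_part 1 f x + homog_part 1 f y"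
    using dual_add[OF L(1)] by simp
qed

lemma delta_part_1_add: "x \<in> carrier V \<Longrightarrow> y \<in> carrier V \<Longrightarrow> delta_part 1 (x + y) = delta_part 1 x + delta_part 1 y"
  using homog_part_1 by (auto simp: delta_part_def fun_eq_iff)

lemma delta_part_1_scale: "x \<in> carrier V \<Longrightarrow> delta_part 1 (c \<cdot> x) = cscale D c (delta_part 1 x)"
  using homog_part_scale[of _ x 1 c] by (auto simp: delta_part_def fun_eq_iff D.cscale_def)

text \<open>Cauchy's estimate for the first coefficient, applied to matrices by
  \<open>homog_part_form\<close>. As this requires the open unit ball, \<open>X\<close> is divided
  by a number slightly above its norm.\<close>

lemma delta_part_1_contraction:
  assumes n: "n > 0" and X: "X \<in> Mat_over n V"
  shows "mnorm D (map_mat (delta_part 1) X) \<le> mnorm V X"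
proof (rule field_le_epsilon)
  fix e :: real assume e: "e > 0"
  define t where "t = mnorm V X + e"
  have t: "t > 0" "mnorm V X < t" using e mn_nonneg[OF n X] by (auto simp: t_def)
  let ?Z = "map_mat (cscale V (of_real (1 / t))) X"
  have "mnorm V ?Z = 1 / t * mnorm V X" using mn_scale[OF n X] t by (simp add: norm_divide)
  also have "\<dots> < 1" using t by simp
  finally have Z: "?Z \<in> matrix_unit_ball V" unfolding mem_mub
    using n X by (intro exI[of _ n]) (auto simp: Mat_over_def)
  have Zc: "?Z \<in> carrier_mat n n" using X by (auto simp: Mat_over_def)
  have Zv: "?Z $$ (i, j) = of_real (1 / t) \<cdot> (X $$ (i, j))" if "i < n" "j < n" for i j
    using that Mat_overD(1)[OF X] by simp
  have "mnorm D (map_mat (delta_part 1) X) \<le> t"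
  proof (rule D.mnorm_leI_form)
    show "map_mat (delta_part 1) X \<in> carrier_mat n n" using Mat_overD(1)[OF X] by auto
    fix F p assume F: "F \<in> tests" "F \<in> carrier_mat p p"
    then have FH: "F \<in> Mat_over p H" "mnorm H F \<le> 1" unfolding mem_tests by (auto simp: Mat_over_def)
    let ?I = "{..<p} \<times> {..<n}"
    have "form_bound ?I ?I (\<lambda>a b. homog_part 1 (F $$ (fst a, fst b)) (?Z $$ (snd a, snd b))) (mnorm H F)"
    proof (rule homog_part_form(1))
      fix l :: complex assume l: "cmod l < 1"
      show "form_bound ?I ?I (\<lambda>a b. (F $$ (fst a, fst b)) (l \<cdot> (?Z $$ (snd a, snd b)))) (mnorm H F)"
        using mub_scale_form[OF FH(1) Z Zc l] by (simp only: split_def)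
    next
      fix a b assume "a \<in> ?I" "b \<in> ?I"
      then show "F $$ (fst a, fst b) \<in> carrier H" "?Z $$ (snd a, snd b) \<in> B"
        using Mat_overD(2)[OF FH(1)] mub_entry[OF Z Zc] by auto
    qed simp
    from form_bound_scale[OF form_bound_mono[OF this FH(2)], of "of_real t"]
    have "form_bound ?I ?I (\<lambda>a b. of_real t * homog_part 1 (F $$ (fst a, fst b)) (?Z $$ (snd a, snd b))) t"
      using t by simp
    then have "form_bound ?I ?I (\<lambda>(k, i) (l, j). (map_mat (delta_part 1) X $$ (i, j)) (F $$ (k, l))) t"
    proof (rule form_bound_cong[THEN iffD2, rotated])
      fix a b assume ab: "a \<in> ?I" "b \<in> ?I"
      then have "X $$ (snd a, snd b) \<in> carrier V" "F $$ (fst a, fst b) \<in> carrier H"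
        using Mat_overD(2)[OF X] Mat_overD(2)[OF FH(1)] by auto
      then show "(case a of (k, i) \<Rightarrow> \<lambda>(l, j). (map_mat (delta_part 1) X $$ (i, j)) (F $$ (k, l))) b =
        of_real t * homog_part 1 (F $$ (fst a, fst b)) (?Z $$ (snd a, snd b))"
        using ab t Mat_overD(1)[OF X] by (auto simp: delta_part_def homog_part_scale split_def)
    qed
    then show "form_bound ({..<n} \<times> {..<p}) ({..<n} \<times> {..<p}) (\<lambda>(i, k) (j, l). (map_mat (delta_part 1) X $$ (i, j)) (F $$ (k, l))) t"
      by (rule form_bound_swap[THEN iffD2])
  qed
  then show "mnorm D (map_mat (delta_part 1) X) \<le> mnorm V X + e" by (simp add: t_def)
qed

text \<open>For small \<open>l\<close> the point \<open>l \<cdot> x\<close> is in the ball, so the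
  restricted functional equals \<open>l * f x\<close> there, with derivative
  \<open>f x\<close>.\<close>

lemma represents_delta_part_1: "x \<in> carrier V \<Longrightarrow> represents (delta_part 1 x) x"
  unfolding represents_def
proof (intro conjI ballI impI)
  fix f assume x: "x \<in> carrier V" and f: "f \<in> carrier (dual_os V)" and fH: "restrict_B f \<in> carrier H"
  have "((\<lambda>l. l * f x) has_field_derivative f x) (at 0)"
    by (auto intro!: derivative_eq_intros)
  moreover have "\<forall>\<^sub>F l in nhds 0. restrict_B f (l \<cdot> x) = l * f x"
  proof -
    have "nv x + 1 > 0" using nv_nonneg[OF x] by linarith
    then have "\<forall>\<^sub>F l in nhds 0. l \<in> ball 0 (1 / (nv x + 1))"
      by (intro eventually_nhds_in_open) auto
    then show ?thesis
    proof eventually_elim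
      case (elim l)
      have "cmod l * nv x \<le> cmod l * (nv x + 1)" by (intro mult_left_mono) auto
      also have "\<dots> < 1" using elim \<open>nv x + 1 > 0\<close> by (simp add: field_simps)
      finally have "l \<cdot> x \<in> B" using x by (simp add: mem_B nv_scale)
      then show ?case using dual_scale[OF f x] by (simp add: restrict_B_def)
    qed
  qed
  ultimately have "((\<lambda>l. restrict_B f (l \<cdot> x)) has_field_derivative f x) (at 0)"
    by (subst DERIV_cong_ev) auto
  then show "delta_part 1 x (restrict_B f) = f x"
    using fH DERIV_imp_deriv by (simp add: delta_part_def homog_part_def)
qed

lemma proj_delta_part_1: "x \<in> carrier V \<Longrightarrow> proj (delta_part 1 x) = x"
  by (intro proj_eqI delta_part_G represents_delta_part_1)

text \<open>Sandwiching \<open>T\<close> between \<open>delta_part 1\<close> and \<open>proj\<close>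
  keeps finite rank and complete contractivity. As \<open>proj\<close> inverts
  \<open>delta_part 1\<close>, the error at \<open>x\<close> is \<open>proj\<close> of the error at
  \<open>delta_part 1 x\<close>.\<close>

lemma CMAP_backward:
  assumes "has_CMAP G"
  shows "has_CMAP V"
proof -
  obtain \<F> :: "((('v \<Rightarrow> complex) \<Rightarrow> complex) \<Rightarrow> (('v \<Rightarrow> complex) \<Rightarrow> complex)) filter" where \<F>: "\<F> \<noteq> bot"
    "\<forall>\<^sub>F T in \<F>. finite_rank G G T \<and> complete_contraction G G T"
    "\<And>\<phi>. \<phi> \<in> carrier G \<Longrightarrow> ((\<lambda>T. vnorm D (T \<phi> - \<phi>)) \<longlongrightarrow> 0) \<F>"
    using assms unfolding has_CMAP_def G_simps by blast
  define C where "C T x = proj (T (delta_part 1 x))" for T x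
  have good: "finite_rank V V (C T) \<and> complete_contraction V V (C T)"
    if T: "finite_rank G G T \<and> complete_contraction G G T" for T
  proof -
    have TG: "\<And>\<phi>. \<phi> \<in> carrier G \<Longrightarrow> T \<phi> \<in> carrier G"
      "\<And>\<phi> \<psi>. \<phi> \<in> carrier G \<Longrightarrow> \<psi> \<in> carrier G \<Longrightarrow> T (\<phi> + \<psi>) = T \<phi> + T \<psi>"
      "\<And>c \<phi>. \<phi> \<in> carrier G \<Longrightarrow> T (cscale D c \<phi>) = cscale D c (T \<phi>)"
      using T by (auto simp: complete_contraction_def linear_between_def)
    have Tn: "mnorm D (map_mat T \<Phi>) \<le> mnorm D \<Phi>" "map_mat T \<Phi> \<in> Mat_over n G"
      if "n > 0" "\<Phi> \<in> Mat_over n G" for n \<Phi>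
      using T that TG by (auto simp: complete_contraction_def Mat_over_def)
    have "complete_contraction V V (C T)"
      unfolding complete_contraction_def linear_between_def C_def
    proof (intro conjI ballI allI impI)
      fix n :: nat and X assume n: "n > 0" and X: "X \<in> Mat_over n V"
      have dX: "map_mat (delta_part 1) X \<in> Mat_over n G" using X delta_part_G by (auto simp: Mat_over_def)
      have "map_mat (\<lambda>x. proj (T (delta_part 1 x))) X = map_mat proj (map_mat T (map_mat (delta_part 1) X))"
        by (rule eq_matI) auto
      also have "mnorm V \<dots> \<le> mnorm D (map_mat T (map_mat (delta_part 1) X))"
        by (rule proj_contraction[OF n Tn(2)[OF n dX]])
      also have "\<dots> \<le> mnorm D (map_mat (delta_part 1) X)" by (rule Tn(1)[OF n dX])
      also have "\<dots> \<le> mnorm V X" by (rule delta_part_1_contraction[OF n X])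
      finally show "mnorm V (map_mat (\<lambda>x. proj (T (delta_part 1 x))) X) \<le> mnorm V X" .
    qed (simp_all add: delta_part_1_add[unfolded One_nat_def] delta_part_1_scale[unfolded One_nat_def] delta_part_G TG proj_add proj_scale proj_V)
    moreover have "finite_rank V V (C T)"
    proof -
      obtain E where E: "finite E" "E \<subseteq> carrier G" "T ` carrier G \<subseteq> ds.span E"
        using T unfolding finite_rank_def G_simps by blast
      have "proj \<phi> \<in> vs.span (proj ` E)" if "\<phi> \<in> ds.span E" for \<phi>
      proof -
        have "\<phi> \<in> carrier G \<and> proj \<phi> \<in> vs.span (proj ` E)"
          using that
        proof (induction rule: ds.span_induct)
          case base
          have "proj 0 = 0" using proj_scale[OF G_mem(4), of 0] by simp
          then show ?case
            by (intro ds.subspaceI) (auto simp: G_mem proj_add proj_scale vs.span_zero vs.span_add vs.span_scale)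
        next
          case (step \<phi>)
          then show ?case using E(2) by (auto intro: vs.span_base)
        qed
        then show ?thesis by blast
      qed
      then have "C T ` carrier V \<subseteq> vs.span (proj ` E)"
        using E(3) delta_part_G unfolding C_def by blast
      moreover have "proj ` E \<subseteq> carrier V" using E(2) proj_V by blast
      ultimately show ?thesis unfolding finite_rank_def using E(1) by blast
    qed
    ultimately show ?thesis by blast
  qed
  show ?thesis unfolding has_CMAP_def
  proof (intro exI[of _ "filtermap C \<F>"] conjI ballI)
    show "filtermap C \<F> \<noteq> bot" using \<F>(1) by (simp add: filtermap_bot_iff)
    show "\<forall>\<^sub>F S in filtermap C \<F>. finite_rank V V S \<and> complete_contraction V V S"
      unfolding eventually_filtermap using \<F>(2) by (rule eventually_mono) (rule good)
    fix x assume x: "x \<in> carrier V"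
    have "((\<lambda>T. nv (C T x - x)) \<longlongrightarrow> 0) \<F>"
    proof (rule Lim_null_comparison)
      show "\<forall>\<^sub>F T in \<F>. norm (nv (C T x - x)) \<le> vnorm D (T (delta_part 1 x) - delta_part 1 x)"
        using \<F>(2)
      proof eventually_elim
        case (elim T)
        then have T: "T (delta_part 1 x) \<in> carrier G"
          using delta_part_G[OF x] by (auto simp: complete_contraction_def linear_between_def)
        have "C T x - x = proj (T (delta_part 1 x) - delta_part 1 x)"
          using proj_diff[OF T delta_part_G[OF x]] proj_delta_part_1[OF x] by (simp add: C_def)
        moreover have d: "T (delta_part 1 x) - delta_part 1 x \<in> carrier G" by (intro G_mem T delta_part_G x)
        ultimately show ?case using represents_vnorm[OF G_D[OF d] proj[OF d]] proj_V[OF d] by simp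
      qed
    qed (rule \<F>(3)[OF delta_part_G[OF x]])
    then show "((\<lambda>S. nv (S x - x)) \<longlongrightarrow> 0) (filtermap C \<F>)"
      unfolding filterlim_filtermap .
  qed
qed

end

theorem theorem7p8:
  fixes V :: "'v::ab_group_add matrix_normed"
  assumes "operator_space V"
  shows "has_CMAP V \<longleftrightarrow> has_CMAP (Ginf_cb V)"
proof -
  interpret op_space V by unfold_locales (rule assms)
  show ?thesis using CMAP_forward CMAP_backward by blast
qed

end
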